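(* Let $d \ge 2$ be a constant integer, let $c \ge 2$ be a constant, and let $m = O(n)$. Then there is a choice of the parameters $\delta_1,\delta_2,k,k_g$ in the hash family $\mathcal{H}$ described in the context, such that $\mathcal{H}$ is sampled using $O(\log n \log\log n)$ random bits, and such that for every set of $m$ balls in $U$, with probability at least $1-n^{-c}$ (over $d$ independent samples $h^{(1)},\ldots,h^{(d)}$ from $\mathcal{H}$), the max-load of the Uniform-Greedy scheme with the $d$ choices $h^{(1)},\ldots,h^{(d)}$ is at most $\log_d \log n + O\!\left(c + \frac{m}{n}\right)$ (the implied constant may depend on $d$; $n$ sufficiently large).
   Context: There are $n$ bins, $n$ a power of $2$, identified with $[n]$ (equivalently with $\{0,1\}^{\log_2 n}$); logarithms are base 2. $U$ is a universe of balls with $|U| = \mathrm{poly}(n)$, and $m \ge n$ balls from $U$ are inserted in an arbitrary fixed order. A distribution on functions $U \to [p]$ (viewed as vectors in $\mathbb{F}_p^{U}$) is a $k$-wise $\delta$-biased space if for every nontrivial character $\chi_\alpha$ of $\mathbb{F}_p^{U}$ whose support has size at most $k$, $|\mathbb{E}[\chi_\alpha(x)]| \le \delta$. A family of functions $U\to[n]$ is $k$-wise independent if the values at any $k$ distinct points are uniform on $[n]^k$. Hash family $\mathcal{H}$ with parameters $\delta_1,\delta_2>0$ and integers $k,k_g$: independently sample (i) for each $i\in[k]$, a function $h_i : U \to [n^{2^{-i}}]$ from an $O(\log^2 n)$-wise $\delta_1$-biased space; (ii) a function $h_{k+1}: U \to [n^{2^{-k}}]$ from an $O(\log^2 n)$-wise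 $\delta_2$-biased space (so that the concatenation of the binary strings $h_1(x)\circ h_2(x)\circ\cdots\circ h_{k+1}(x)$ is an element of $[n]$); (iii) a function $g: U\to[n]$ from a $k_g$-wise independent family. Then $h(x) = \big(h_1(x)\circ\cdots\circ h_k(x)\circ h_{k+1}(x)\big)\oplus g(x)$, where $\circ$ is concatenation of bit strings and $\oplus$ is bitwise XOR. Uniform-Greedy scheme with $d$ choices: given hash functions $h^{(1)},\ldots,h^{(d)}: U\to[n]$, each ball $x$ in turn is placed into a bin among $h^{(1)}(x),\ldots,h^{(d)}(x)$ with the currently smallest number of balls (ties broken arbitrarily). The max-load is the maximum number of balls in any bin after all $m$ balls are placed. *)

theory Defs
  imports "HOL-Probability.Probability" "HOL-Probability.Product_PMF"
begin

text \<open>The set \<open>[2 ^ l]\<close> is represented by the bit strings of length \<open>l\<close>; a function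
  \<open>U \<rightarrow> [2 ^ l]\<close> is an extensional function on the finite universe \<open>U\<close>.\<close>

definition bitstrings :: "nat \<Rightarrow> bool list set" where
  "bitstrings l = {v. length v = l}"

definition bxor :: "bool list \<Rightarrow> bool list \<Rightarrow> bool list" (infixl "\<oplus>\<^sub>b" 65) where
  "v \<oplus>\<^sub>b w = map2 (\<noteq>) v w"

definition vecs :: "nat \<Rightarrow> 'a set \<Rightarrow> ('a \<Rightarrow> bool list) set" where
  "vecs l U = U \<rightarrow>\<^sub>E bitstrings l"

text \<open>Characters of \<open>F\<^sub>p\<^sup>U\<close> for \<open>p = 2 ^ l\<close> are the characters of its additive group, and addition in
  \<open>F\<^sub>p\<close> is bitwise XOR once the field elements are written in a basis over \<open>F\<^sub>2\<close>. No choice of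
  basis or of a labelling \<open>\<alpha> \<mapsto> \<psi>\<^sub>\<alpha>\<close> is needed: \<open>\<alpha>\<close> is non-zero at \<open>u\<close> exactly if
  \<open>\<psi>\<^sub>\<alpha>\<close> is non-trivial on the vectors that vanish outside \<open>u\<close>.\<close>

definition is_character :: "nat \<Rightarrow> 'a set \<Rightarrow> (('a \<Rightarrow> bool list) \<Rightarrow> complex) \<Rightarrow> bool" where
  "is_character l U \<psi> \<longleftrightarrow>
     (\<forall>x\<in>vecs l U. cmod (\<psi> x) = 1) \<and>
     (\<forall>x\<in>vecs l U. \<forall>y\<in>vecs l U. \<psi> (\<lambda>u\<in>U. x u \<oplus>\<^sub>b y u) = \<psi> x * \<psi> y)"

definition nontrivial_character :: "nat \<Rightarrow> 'a set \<Rightarrow> (('a \<Rightarrow> bool list) \<Rightarrow> complex) \<Rightarrow> bool" where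
  "nontrivial_character l U \<psi> \<longleftrightarrow> is_character l U \<psi> \<and> (\<exists>x\<in>vecs l U. \<psi> x \<noteq> 1)"

definition character_support :: "nat \<Rightarrow> 'a set \<Rightarrow> (('a \<Rightarrow> bool list) \<Rightarrow> complex) \<Rightarrow> 'a set" where
  "character_support l U \<psi> =
     {u \<in> U. \<exists>x\<in>vecs l U. (\<forall>v\<in>U - {u}. x v = replicate l False) \<and> \<psi> x \<noteq> 1}"

definition kwise_biased :: "nat \<Rightarrow> real \<Rightarrow> nat \<Rightarrow> 'a set \<Rightarrow> ('a \<Rightarrow> bool list) pmf \<Rightarrow> bool" where
  "kwise_biased k \<delta> l U D \<longleftrightarrow>
     set_pmf D \<subseteq> vecs l U \<and>
     (\<forall>\<psi>. nontrivial_character l U \<psi> \<and> card (character_support l U \<psi>) \<le> k \<longrightarrow>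
        cmod (measure_pmf.expectation D \<psi>) \<le> \<delta>)"

definition kwise_independent :: "nat \<Rightarrow> nat \<Rightarrow> 'a set \<Rightarrow> ('a \<Rightarrow> bool list) pmf \<Rightarrow> bool" where
  "kwise_independent k l U D \<longleftrightarrow>
     set_pmf D \<subseteq> vecs l U \<and>
     (\<forall>A. A \<subseteq> U \<and> card A = k \<longrightarrow>
        map_pmf (\<lambda>f. restrict f A) D = pmf_of_set (A \<rightarrow>\<^sub>E bitstrings l))"

text \<open>Number of output bits of \<open>h\<^sub>i\<close> for \<open>n = 2 ^ L\<close>. The nominal ranges \<open>n\<close> to the power
  \<open>2\<^sup>-\<^sup>i\<close> need not be integral, so the number of bits still missing after \<open>h\<^sub>1, \<dots>, h\<^sub>i\<close> is taken
  to be \<open>L / 2 ^ i\<close> rounded down. Every length is then its nominal value rounded up or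
  down (exact if \<open>2 ^ k\<close> divides \<open>L\<close>), and the lengths add up to \<open>L\<close>.\<close>

definition block_len :: "nat \<Rightarrow> nat \<Rightarrow> nat \<Rightarrow> nat" where
  "block_len L k i = (if i \<le> k then L div 2 ^ (i - 1) - L div 2 ^ i else L div 2 ^ k)"

lemma sum_block_len: "(\<Sum>i = 1..k + 1. block_len L k i) = L"
proof -
  have "(\<Sum>i = 1..k. L div 2 ^ (i - 1) - L div 2 ^ i) + L div 2 ^ k = L"
  proof (induction k)
    case (Suc k)
    have "L div 2 ^ Suc k \<le> L div 2 ^ k"
      by (intro div_le_mono2) auto
    then show ?case using Suc by simp
  qed simp
  then show ?thesis by (simp add: block_len_def)
qed

text \<open>\<open>hash_family L U w \<delta>1 \<delta>2 k kg S\<close>: \<open>S\<close> is the joint distribution of independent components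
  \<open>((h\<^sub>1, \<dots>, h\<^sub>k\<^sub>+\<^sub>1), g)\<close> as prescribed for the parameters, for some choice of the
  \<open>w\<close>-wise biased spaces and of the \<open>kg\<close>-wise independent family.
  The map \<open>hash_fun k\<close> turns the components into the hash function.\<close>

definition hash_family :: "nat \<Rightarrow> 'a set \<Rightarrow> nat \<Rightarrow> real \<Rightarrow> real \<Rightarrow> nat \<Rightarrow> nat \<Rightarrow>
    ((nat \<Rightarrow> 'a \<Rightarrow> bool list) \<times> ('a \<Rightarrow> bool list)) pmf \<Rightarrow> bool" where
  "hash_family L U w \<delta>1 \<delta>2 k kg S \<longleftrightarrow>
     (\<exists>D G. (\<forall>i\<in>{1..k}. kwise_biased w \<delta>1 (block_len L k i) U (D i)) \<and>
        kwise_biased w \<delta>2 (block_len L k (k + 1)) U (D (k + 1)) \<and>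
        kwise_independent kg L U G \<and>
        S = pair_pmf (Pi_pmf {1..k + 1} undefined D) G)"

definition hash_fun :: "nat \<Rightarrow> (nat \<Rightarrow> 'a \<Rightarrow> bool list) \<times> ('a \<Rightarrow> bool list) \<Rightarrow> 'a \<Rightarrow> bool list" where
  "hash_fun k = (\<lambda>(hs, g) x. concat (map (\<lambda>i. hs i x) [1..<k + 2]) \<oplus>\<^sub>b g x)"

definition sampled_with_bits :: "nat \<Rightarrow> 'b pmf \<Rightarrow> bool" where
  "sampled_with_bits s S \<longleftrightarrow> (\<exists>F. S = map_pmf F (pmf_of_set (bitstrings s)))"

text \<open>\<open>uniform_greedy d h xs load\<close>: inserting the balls \<open>xs\<close> from left to right can, under some way of
  breaking ties, end with \<open>load b\<close> balls in each bin \<open>b\<close>.\<close>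

inductive uniform_greedy ::
    "nat \<Rightarrow> (nat \<Rightarrow> 'a \<Rightarrow> 'b) \<Rightarrow> 'a list \<Rightarrow> ('b \<Rightarrow> nat) \<Rightarrow> bool"
  for d :: nat and h :: "nat \<Rightarrow> 'a \<Rightarrow> 'b" where
  empty: "uniform_greedy d h [] (\<lambda>_. 0)"
| insert: "uniform_greedy d h xs load \<Longrightarrow> j < d \<Longrightarrow>
     (\<And>i. i < d \<Longrightarrow> load (h j x) \<le> load (h i x)) \<Longrightarrow>
     uniform_greedy d h (xs @ [x]) (load(h j x := load (h j x) + 1))"

definition max_load :: "nat \<Rightarrow> (bool list \<Rightarrow> nat) \<Rightarrow> nat" where
  "max_load L load = Max (load ` bitstrings L)"

end

theory Submission
  imports Defs "HOL-Real_Asymp.Real_Asymp"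
begin

text \<open>
  Put \<open>n = 2 ^ L\<close>. The seed budget allows \<open>g\<close> to be \<open>O(log log n)\<close>-wise independent. Therefore, with high
  probability, every set \<open>A\<close> of \<open>O(log log n)\<close> balls has at least \<open>(d - 1) |A| - O(c)\<close> bins among its
  choices. Since a witness tree only has depth about \<open>log\<^sub>d log n\<close>, two paths that spoil its tree
  structure form such a small set \<open>A\<close>; hence next to a bin of too large load there is a bin that is the root of
  a binomial witness tree with pairwise distinct bins and \<open>O(log n)\<close> balls.

  Such trees are excluded by a union bound that conditions on \<open>g\<close> and on \<open>h\<^sub>1, \<dots>, h\<^sub>k\<close>. A moment
  bound, applied level by level, shows that each prefix of \<open>L - l\<close> bits, \<open>l = O(log log n)\<close>, is
  hit by at most \<open>3 (m / n) 2 ^ l\<close> balls, so that few trees are compatible with the prefixes.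
  The remaining \<open>l\<close> bits of \<open>O(log n)\<close> balls are decided by \<open>h\<^sub>k\<^sub>+\<^sub>1\<close>, whose bias
  \<open>\<delta>\<^sub>2 = n ^ (- O(log log n))\<close> is smaller than the probability of a single tree.

  The spaces are needed only as distributions with a short seed, so they are obtained by the
  probabilistic method, without any finite field.
\<close>

text \<open>The obstacle is the seed. A tree has \<open>N = O(log n)\<close> constraints, and the
  union bound over trees needs an error below \<open>2 ^ (- l * N)\<close>, where \<open>l\<close>
  is the number of bits left open. With all \<open>L\<close> bits open this would cost order
  \<open>log^2 n\<close> seed bits. With only \<open>l = O(log log n)\<close> bits open, a single
  block needs such a tiny bias. The loads of the prefixes are needed only up to error
  \<open>n ^ (- O(1))\<close>, so each of the at most \<open>log log n\<close> other blocks can do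
  with bias \<open>n ^ (- O(1))\<close> and \<open>O(log n)\<close> seed bits. The factor 3 in the
  prefix loads is a bound for \<open>(1 + 1/k) ^ k\<close>: each of the \<open>k\<close> levels may
  lose a factor \<open>1 + 1/k\<close>. The additive term \<open>O(c + m/n)\<close> has two sources.
  The leaf size \<open>s\<close> is linear in \<open>c + m/n\<close>, so that a leaf has weight at
  most \<open>2 ^ (- (c + 3))\<close>; a tree has \<open>d ^ t \<ge> log n\<close> leaves, which
  gives \<open>n ^ (- (c + 3))\<close>. The defect \<open>r = c + 1\<close> that is tolerated for
  small sets of balls costs another \<open>2 * r\<close> and a constant.\<close>

abbreviation prob :: "'a pmf \<Rightarrow> 'a set \<Rightarrow> real" where
  "prob M \<equiv> measure_pmf.prob M"

abbreviation expect :: "'a pmf \<Rightarrow> ('a \<Rightarrow> 'b :: {banach, second_countable_topology}) \<Rightarrow> 'b" where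
  "expect M \<equiv> measure_pmf.expectation M"

section \<open>Characters and biased distributions\<close>

definition bit_sign :: "bool \<Rightarrow> real" where
  "bit_sign b = (if b then - 1 else 1)"

text \<open>Over bit vectors these are all the characters; the set \<open>S\<close> of (ball, bit)
  positions serves as the index, and the values are real signs.\<close>

definition chi :: "('a \<times> nat) set \<Rightarrow> ('a \<Rightarrow> bool list) \<Rightarrow> real" where
  "chi S x = (\<Prod>(u, b)\<in>S. bit_sign (x u ! b))"

definition vec_of :: "nat \<Rightarrow> 'a set \<Rightarrow> ('a \<times> nat) set \<Rightarrow> 'a \<Rightarrow> bool list" where
  "vec_of l U X = (\<lambda>u\<in>U. map (\<lambda>b. (u, b) \<in> X) [0..<l])"

lemma bit_sign_mult: "bit_sign a * bit_sign b = bit_sign (a \<noteq> b)"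
  by (simp add: bit_sign_def)

lemma bit_sign_abs [simp]: "\<bar>bit_sign b\<bar> = 1"
  by (simp add: bit_sign_def)

lemma finite_bitstrings [simp]: "finite (bitstrings l)"
  using finite_lists_length_eq[of "UNIV :: bool set" l] by (simp add: bitstrings_def)

lemma card_bitstrings [simp]: "card (bitstrings l) = 2 ^ l"
  using card_lists_length_eq[of "UNIV :: bool set" l] by (simp add: bitstrings_def)

lemma bitstrings_nonempty [simp]: "bitstrings l \<noteq> {}"
proof -
  have "replicate l False \<in> bitstrings l" by (simp add: bitstrings_def)
  then show ?thesis by blast
qed

lemma finite_vecs: "finite U \<Longrightarrow> finite (vecs l U)"
  by (simp add: vecs_def finite_PiE)

lemma vecs_length: "x \<in> vecs l U \<Longrightarrow> u \<in> U \<Longrightarrow> length (x u) = l"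
  by (auto simp: vecs_def bitstrings_def)

lemma nth_bxor: "length v = l \<Longrightarrow> length w = l \<Longrightarrow> b < l \<Longrightarrow> (v \<oplus>\<^sub>b w) ! b = (v ! b \<noteq> w ! b)"
  by (simp add: bxor_def)

lemma length_bxor: "length v = l \<Longrightarrow> length w = l \<Longrightarrow> length (v \<oplus>\<^sub>b w) = l"
  by (simp add: bxor_def)

lemma abs_chi [simp]: "\<bar>chi S x\<bar> = 1"
  by (simp add: chi_def abs_prod case_prod_unfold)

lemma chi_mult:
  assumes "S \<subseteq> U \<times> {..<l}" "x \<in> vecs l U" "y \<in> vecs l U"
  shows "chi S (\<lambda>u\<in>U. x u \<oplus>\<^sub>b y u) = chi S x * chi S y"
proof -
  have "bit_sign ((\<lambda>u\<in>U. x u \<oplus>\<^sub>b y u) u ! b) = bit_sign (x u ! b) * bit_sign (y u ! b)" if "(u, b) \<in> S" for u b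
    using that assms by (auto simp: bit_sign_mult nth_bxor[of _ l] vecs_length)
  then show ?thesis
    unfolding chi_def prod.distrib[symmetric] by (intro prod.cong) auto
qed

lemma is_character_chi:
  assumes "S \<subseteq> U \<times> {..<l}"
  shows "is_character l U (\<lambda>x. complex_of_real (chi S x))"
  using chi_mult[OF assms] by (simp add: is_character_def)

lemma vec_of_in_vecs: "vec_of l U X \<in> vecs l U"
  by (auto simp: vec_of_def vecs_def bitstrings_def)

lemma chi_vec_of:
  assumes "finite S" "S \<subseteq> U \<times> {..<l}"
  shows "chi S (vec_of l U X) = (\<Prod>e\<in>S. bit_sign (e \<in> X))"
  unfolding chi_def
proof (intro prod.cong refl, clarify)
  fix u b assume "(u, b) \<in> S"
  then show "bit_sign (vec_of l U X u ! b) = bit_sign ((u, b) \<in> X)"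
    using assms by (auto simp: vec_of_def)
qed

lemma chi_unit:
  assumes "finite S" "S \<subseteq> U \<times> {..<l}"
  shows "chi S (vec_of l U {e}) = bit_sign (e \<in> S)"
proof -
  have "chi S (vec_of l U {e}) = (\<Prod>e'\<in>S. if e' = e then - 1 else 1)"
    unfolding chi_vec_of[OF assms] by (intro prod.cong) (auto simp: bit_sign_def)
  also have "\<dots> = bit_sign (e \<in> S)"
    using assms(1) by (simp add: bit_sign_def)
  finally show ?thesis .
qed

lemma nontrivial_character_chi:
  assumes "finite S" "S \<subseteq> U \<times> {..<l}" "S \<noteq> {}"
  shows "nontrivial_character l U (\<lambda>x. complex_of_real (chi S x))"
proof -
  obtain e where "e \<in> S" using assms by auto
  then have "complex_of_real (chi S (vec_of l U {e})) \<noteq> 1"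
    by (simp add: chi_unit[OF assms(1,2)] bit_sign_def)
  then show ?thesis
    using is_character_chi[OF assms(2)] vec_of_in_vecs unfolding nontrivial_character_def by blast
qed

lemma character_support_chi:
  assumes "S \<subseteq> U \<times> {..<l}"
  shows "character_support l U (\<lambda>x. complex_of_real (chi S x)) \<subseteq> fst ` S"
proof
  fix u assume "u \<in> character_support l U (\<lambda>x. complex_of_real (chi S x))"
  then obtain x where x: "x \<in> vecs l U" "\<forall>v\<in>U - {u}. x v = replicate l False" "chi S x \<noteq> 1"
    by (auto simp: character_support_def)
  show "u \<in> fst ` S"
  proof (rule ccontr)
    assume "u \<notin> fst ` S"
    then have "bit_sign (x v ! b) = 1" if "(v, b) \<in> S" for v b
      using that assms x(2) by (force simp: bit_sign_def)
    then have "chi S x = 1" unfolding chi_def by (intro prod.neutral) auto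
    with x(3) show False by simp
  qed
qed

lemma vec_of_insert:
  assumes "e \<notin> X"
  shows "vec_of l U (insert e X) = (\<lambda>u\<in>U. vec_of l U {e} u \<oplus>\<^sub>b vec_of l U X u)"
proof
  fix u
  show "vec_of l U (insert e X) u = (\<lambda>u\<in>U. vec_of l U {e} u \<oplus>\<^sub>b vec_of l U X u) u"
    using assms by (auto simp: vec_of_def nth_bxor[of _ l] length_bxor[of _ l] intro!: nth_equalityI)
qed

lemma vec_of_positions:
  assumes "x \<in> vecs l U"
  shows "x = vec_of l U {(u, b). u \<in> U \<and> b < l \<and> x u ! b}"
proof
  fix u
  show "x u = vec_of l U {(u, b). u \<in> U \<and> b < l \<and> x u ! b} u"
    using assms by (cases "u \<in> U")
      (auto simp: vec_of_def vecs_length[OF assms] vecs_def PiE_def extensional_def intro!: nth_equalityI)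
qed

text \<open>A vector XORed with itself is zero, so a character takes the values \<open>1\<close> and
  \<open>-1\<close> on unit vectors, and multiplicativity extends these signs to all vectors.
  Abstract characters thus become finitely many sets \<open>S\<close>, which makes a union bound
  over them possible.\<close>

lemma character_eq_chi:
  assumes fin: "finite U" and ch: "is_character l U \<psi>"
  defines "S \<equiv> {e \<in> U \<times> {..<l}. \<psi> (vec_of l U {e}) \<noteq> 1}"
  assumes x: "x \<in> vecs l U"
  shows "\<psi> x = complex_of_real (chi S x)"
proof -
  let ?v = "vec_of l U"
  have mult: "\<psi> (\<lambda>u\<in>U. a u \<oplus>\<^sub>b b u) = \<psi> a * \<psi> b" if "a \<in> vecs l U" "b \<in> vecs l U" for a b
    using ch that by (auto simp: is_character_def)
  have nz: "\<psi> a \<noteq> 0" if "a \<in> vecs l U" for a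
    using ch that by (auto simp: is_character_def)
  have self: "(\<lambda>u\<in>U. a u \<oplus>\<^sub>b a u) = ?v {}" if "a \<in> vecs l U" for a
  proof
    fix u show "(\<lambda>u\<in>U. a u \<oplus>\<^sub>b a u) u = ?v {} u"
      using vecs_length[OF that] 
      by (auto simp: vec_of_def nth_bxor[of _ l] length_bxor[of _ l] intro!: nth_equalityI)
  qed
  have zero: "\<psi> (?v {}) = 1"
    using mult[OF vec_of_in_vecs vec_of_in_vecs, of "{}" "{}"] self[OF vec_of_in_vecs, of "{}"]
      nz[OF vec_of_in_vecs, of "{}"] by simp
  have unit: "\<psi> (?v {e}) = of_real (bit_sign (e \<in> S))" if "e \<in> U \<times> {..<l}" for e
  proof -
    have "\<psi> (?v {e}) * \<psi> (?v {e}) = 1"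
      using mult[OF vec_of_in_vecs vec_of_in_vecs, of "{e}" "{e}"] self[OF vec_of_in_vecs, of "{e}"]
        zero by simp
    then have "\<psi> (?v {e}) = 1 \<or> \<psi> (?v {e}) = - 1"
      by (simp add: square_eq_1_iff)
    then show ?thesis using that by (auto simp: S_def bit_sign_def)
  qed
  have finS: "finite S" unfolding S_def using fin by auto
  have SU: "S \<subseteq> U \<times> {..<l}" by (auto simp: S_def)
  have main: "\<psi> (?v X) = of_real (\<Prod>e\<in>X. bit_sign (e \<in> S))" if "finite X" "X \<subseteq> U \<times> {..<l}" for X
    using that
  proof (induction X rule: finite_induct)
    case empty
    then show ?case using zero by simp
  next
    case (insert e X)
    have "\<psi> (?v (insert e X)) = \<psi> (?v {e}) * \<psi> (?v X)"
      unfolding vec_of_insert[OF insert.hyps(2)] by (rule mult[OF vec_of_in_vecs vec_of_in_vecs])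
    then show ?case
      using insert unit[of e] by simp
  qed
  define X where "X = {(u, b). u \<in> U \<and> b < l \<and> x u ! b}"
  have X: "X \<subseteq> U \<times> {..<l}" by (auto simp: X_def)
  have finX: "finite X" using finite_subset[OF X] fin by simp
  \<comment> \<open>Both products are \<open>-1\<close> to the power
    \<open>card (X \<inter> S)\<close>, so the vector and the index of the character can change
    places.\<close>
  have "(\<Prod>e\<in>X. bit_sign (e \<in> S)) = (\<Prod>e\<in>X \<inter> S. - 1)"
    using finX by (intro prod.mono_neutral_cong_right) (auto simp: bit_sign_def)
  also have "\<dots> = (\<Prod>e\<in>S. bit_sign (e \<in> X))"
    using finS by (intro prod.mono_neutral_cong_left) (auto simp: bit_sign_def)
  also have "\<dots> = chi S (?v X)"
    by (rule chi_vec_of[OF finS SU, symmetric])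
  finally show ?thesis
    using main[OF finX X] vec_of_positions[OF x] by (simp add: X_def)
qed

text \<open>The sum is the expanded product, over all positions, of \<open>1\<close> plus the
  product of the two signs. A factor is \<open>2\<close> where the vectors agree and
  \<open>0\<close> where they differ.\<close>

lemma indicator_eq_sum_chi:
  assumes fin: "finite A" and len: "\<And>u. u \<in> A \<Longrightarrow> length (x u) = l" "\<And>u. u \<in> A \<Longrightarrow> length (f u) = l"
  shows "(\<Sum>S\<in>Pow (A \<times> {..<l}). chi S x * chi S f) = (if \<forall>u\<in>A. x u = f u then 2 ^ (l * card A) else 0)"
proof -
  let ?E = "A \<times> {..<l}"
  let ?s = "\<lambda>e. bit_sign (x (fst e) ! snd e) * bit_sign (f (fst e) ! snd e)"
  have "(\<Sum>S\<in>Pow ?E. chi S x * chi S f) = (\<Sum>S\<in>Pow ?E. (\<Prod>e\<in>S. ?s e) * (\<Prod>e\<in>?E - S. 1))"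
    by (simp add: chi_def prod.distrib case_prod_unfold)
  also have "\<dots> = (\<Prod>e\<in>?E. ?s e + 1)"
    using fin by (intro prod_add[symmetric]) simp
  also have "\<dots> = (if \<forall>u\<in>A. x u = f u then 2 ^ (l * card A) else 0)"
  proof (cases "\<forall>u\<in>A. x u = f u")
    case True
    then have "(\<Prod>e\<in>?E. ?s e + 1) = (\<Prod>e\<in>?E. 2)"
      by (intro prod.cong) (auto simp: bit_sign_def)
    then show ?thesis using True by (simp add: card_cartesian_product mult.commute)
  next
    case False
    then obtain u where u: "u \<in> A" "x u \<noteq> f u" by auto
    then obtain b where b: "b < l" "x u ! b \<noteq> f u ! b"
      using nth_equalityI[of "x u" "f u"] len by metis
    have "?s (u, b) + 1 = 0" using b by (auto simp: bit_sign_def)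
    then have "(\<Prod>e\<in>?E. ?s e + 1) = 0"
      using u b fin by (subst prod_zero_iff) force+
    then show ?thesis using False by simp
  qed
  finally show ?thesis .
qed

text \<open>Fourier inversion: the empty \<open>S\<close> contributes the uniform probability. Each
  other coefficient is at most \<open>\<delta>\<close>, and the normalisation
  \<open>1 / 2 ^ (l * card A)\<close> cancels their number, so the error is \<open>\<delta>\<close>
  itself.\<close>

lemma prob_values_bound:
  assumes fin: "finite U" and D: "set_pmf D \<subseteq> vecs l U" and A: "A \<subseteq> U"
    and f: "\<And>u. u \<in> A \<Longrightarrow> length (f u) = l"
    and bias: "\<And>S. S \<subseteq> A \<times> {..<l} \<Longrightarrow> S \<noteq> {} \<Longrightarrow> \<bar>expect D (chi S)\<bar> \<le> \<delta>"
    and \<delta>: "\<delta> \<ge> 0"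
  shows "\<bar>prob D {x. \<forall>u\<in>A. x u = f u} - 1 / 2 ^ (l * card A)\<bar> \<le> \<delta>"
proof -
  have finD: "finite (set_pmf D)" using finite_subset[OF D] finite_vecs[OF fin] by auto
  have finA: "finite A" using A fin finite_subset by blast
  note int = integrable_measure_pmf_finite[OF finD]
  let ?N = "2 ^ (l * card A) :: real"
  let ?P = "Pow (A \<times> {..<l})"
  let ?E = "expect D"
  have finP: "finite ?P" using finA by simp
  have cP: "card ?P = 2 ^ (l * card A)" using finA by (simp add: card_Pow mult.commute)
  have "prob D {x. \<forall>u\<in>A. x u = f u} = ?E (indicator {x. \<forall>u\<in>A. x u = f u})"
    by simp
  also have "\<dots> = ?E (\<lambda>x. (\<Sum>S\<in>?P. chi S x * chi S f) / ?N)"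
  proof (intro integral_cong_AE; (simp; fail)?)
    show "AE x in measure_pmf D. indicator {x. \<forall>u\<in>A. x u = f u} x = (\<Sum>S\<in>?P. chi S x * chi S f) / ?N"
    proof (rule AE_pmfI)
      fix x assume "x \<in> set_pmf D"
      then have "length (x u) = l" if "u \<in> A" for u using D A that vecs_length by fastforce
      then show "indicator {x. \<forall>u\<in>A. x u = f u} x = (\<Sum>S\<in>?P. chi S x * chi S f) / ?N"
        by (subst indicator_eq_sum_chi[OF finA]) (auto simp: f)
    qed
  qed
  also have "\<dots> = (\<Sum>S\<in>?P. ?E (chi S) * chi S f) / ?N"
    by (simp add: int)
  also have "\<dots> = (1 + (\<Sum>S\<in>?P - {{}}. ?E (chi S) * chi S f)) / ?N"
    by (subst sum.remove[OF finP, of "{}"]) (auto simp: chi_def[abs_def])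
  finally have eq: "prob D {x. \<forall>u\<in>A. x u = f u} - 1 / ?N
      = (\<Sum>S\<in>?P - {{}}. ?E (chi S) * chi S f) / ?N"
    by (simp add: add_divide_distrib)
  have "\<bar>\<Sum>S\<in>?P - {{}}. ?E (chi S) * chi S f\<bar> \<le> (\<Sum>S\<in>?P - {{}}. \<delta>)"
  proof (rule order_trans[OF sum_abs], rule sum_mono)
    fix S assume "S \<in> ?P - {{}}"
    then show "\<bar>?E (chi S) * chi S f\<bar> \<le> \<delta>"
      using bias[of S] by (auto simp: abs_mult)
  qed
  also have "\<dots> \<le> (\<Sum>S\<in>?P. \<delta>)"
    using finP \<delta> by (intro sum_mono2) auto
  also have "\<dots> = \<delta> * ?N" using cP by simp
  finally show ?thesis unfolding eq abs_divide by (simp add: field_simps)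
qed

lemma kwise_biased_prob:
  assumes fin: "finite U" and D: "kwise_biased w \<delta> l U D" and A: "A \<subseteq> U" "card A \<le> w"
    and f: "\<And>u. u \<in> A \<Longrightarrow> length (f u) = l" and \<delta>: "\<delta> \<ge> 0"
  shows "\<bar>prob D {x. \<forall>u\<in>A. x u = f u} - 1 / 2 ^ (l * card A)\<bar> \<le> \<delta>"
proof (rule prob_values_bound[OF fin _ A(1) f _ \<delta>])
  show DU: "set_pmf D \<subseteq> vecs l U" using D by (simp add: kwise_biased_def)
  fix S assume S: "S \<subseteq> A \<times> {..<l}" "S \<noteq> {}"
  have finA: "finite A" using A fin finite_subset by blast
  have finS: "finite S" using S finA finite_subset[of S "A \<times> {..<l}"] by simp
  have SU: "S \<subseteq> U \<times> {..<l}" using S A by auto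
  have "fst ` S \<subseteq> A" using S by auto
  then have "character_support l U (\<lambda>x. complex_of_real (chi S x)) \<subseteq> A"
    using character_support_chi[OF SU] by auto
  then have "card (character_support l U (\<lambda>x. complex_of_real (chi S x))) \<le> w"
    using card_mono[OF finA] A(2) by (meson le_trans)
  then have "cmod (expect D (\<lambda>x. complex_of_real (chi S x))) \<le> \<delta>"
    using D nontrivial_character_chi[OF finS SU S(2)] by (auto simp: kwise_biased_def)
  then show "\<bar>expect D (chi S)\<bar> \<le> \<delta>"
    by simp
qed

text \<open>Independence is defined by sets of exactly \<open>k\<close> points. A smaller
  \<open>A\<close> is first enlarged to such a set, which is possible by
  \<open>k \<le> card U\<close>.\<close>

lemma kwise_independent_prob:
  assumes fin: "finite U" and G: "kwise_independent k l U G" and k: "k \<le> card U"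
    and A: "A \<subseteq> U" "card A \<le> k" and f: "\<And>u. u \<in> A \<Longrightarrow> length (f u) = l"
  shows "prob G {x. \<forall>u\<in>A. x u = f u} = 1 / 2 ^ (l * card A)"
proof -
  obtain A' where A': "A \<subseteq> A'" "A' \<subseteq> U" "card A' = k"
    using exists_subset_between[OF A(2) k A(1) fin] by blast
  have finA': "finite A'" using A' fin finite_subset by blast
  let ?B = "\<lambda>u. if u \<in> A then {f u} else bitstrings l"
  have "prob G {x. \<forall>u\<in>A. x u = f u} = prob (map_pmf (\<lambda>f. restrict f A') G) {x. \<forall>u\<in>A. x u = f u}"
    using A'(1) by (auto simp: subset_iff intro!: arg_cong[where f = "prob G"])
  also have "map_pmf (\<lambda>f. restrict f A') G = pmf_of_set (A' \<rightarrow>\<^sub>E bitstrings l)"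
    using G A' by (auto simp: kwise_independent_def)
  also have "prob \<dots> {x. \<forall>u\<in>A. x u = f u} =
      card ((A' \<rightarrow>\<^sub>E bitstrings l) \<inter> {x. \<forall>u\<in>A. x u = f u}) / card (A' \<rightarrow>\<^sub>E bitstrings l)"
    by (intro measure_pmf_of_set) (auto simp: PiE_eq_empty_iff finite_PiE finA')
  also have "(A' \<rightarrow>\<^sub>E bitstrings l) \<inter> {x. \<forall>u\<in>A. x u = f u} = PiE A' ?B"
    using A'(1) f by (auto simp: PiE_def Pi_def bitstrings_def split: if_splits)
  also have "card (PiE A' ?B) = (\<Prod>u\<in>A'. if u \<in> A then 1 else 2 ^ l)"
    unfolding card_PiE[OF finA'] by (intro prod.cong) auto
  also have "\<dots> = (2 ^ l) ^ card (A' - A)"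
    using finA' A'(1) by (subst prod.If_cases) (auto simp: Int_absorb1 Diff_eq)
  also have "card (A' \<rightarrow>\<^sub>E bitstrings l) = (2 ^ l) ^ card A'"
    unfolding card_PiE[OF finA'] by simp
  also have "card A' = card (A' - A) + card A"
    using A'(1) finA' card_mono[OF finA' A'(1)] by (subst card_Diff_subset) (auto intro: finite_subset)
  finally show ?thesis
    by (simp add: power_add power_mult field_simps)
qed

section \<open>Concentration under bounded independence\<close>

text \<open>A power of \<open>b - q\<close> with a bit \<open>b\<close> is an affine function of
  \<open>b\<close>; this is its slope.\<close>

definition moment_slope :: "real \<Rightarrow> nat \<Rightarrow> real" where
  "moment_slope q e = (1 - q) ^ e - (- q) ^ e"

lemma moment_slope_abs:
  assumes "0 \<le> q" "q \<le> 1" "e > 0"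
  shows "\<bar>moment_slope q e\<bar> \<le> 1"
proof -
  have "\<bar>moment_slope q e\<bar> \<le> \<bar>(1 - q) ^ e\<bar> + \<bar>(- q) ^ e\<bar>"
    unfolding moment_slope_def by (rule abs_triangle_ineq4)
  also have "\<dots> = (1 - q) ^ e + q ^ e" using assms by (simp add: power_abs)
  also have "\<dots> \<le> (1 - q) ^ 1 + q ^ 1"
    using assms by (intro add_mono power_decreasing) auto
  finally show ?thesis by simp
qed

text \<open>The expression is the \<open>e\<close>-th central moment of a bit of mean
  \<open>q\<close>. For \<open>e \<ge> 2\<close> a factor \<open>q * (1 - q)\<close> splits off and
  leaves a slope of exponent \<open>e - 1\<close>.\<close>

lemma ideal_moment_abs:
  assumes "0 \<le> q" "q \<le> 1" "e \<ge> 2"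
  shows "\<bar>moment_slope q e * q + (- q) ^ e\<bar> \<le> q"
proof -
  obtain e' where e: "e = Suc e'" "e' \<ge> 1" using assms(3) by (cases e) auto
  have "moment_slope q e * q + (- q) ^ e = q * (1 - q) * ((1 - q) ^ e' - (- q) ^ e')"
    by (simp add: moment_slope_def e algebra_simps)
  also have "\<bar>\<dots>\<bar> = q * (1 - q) * \<bar>moment_slope q e'\<bar>"
    using assms by (simp add: abs_mult moment_slope_def)
  also have "\<dots> \<le> q * (1 - q) * 1"
    using assms e by (intro mult_left_mono moment_slope_abs) auto
  also have "\<dots> \<le> q" using assms by (simp add: algebra_simps)
  finally show ?thesis .
qed

text \<open>Only words of length \<open>p\<close> whose letters all repeat contribute to a central
  moment, and those have at most \<open>p / 2\<close> distinct letters. Grouped by image, the terms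
  with \<open>j\<close> letters sum to at most \<open>j ^ p * (card X * q) ^ j\<close>, and there
  are at most \<open>p\<close> values of \<open>j\<close>.\<close>

lemma sum_functions_small_image:
  fixes q \<mu> :: real
  assumes fin: "finite X" and q: "0 \<le> q" and \<mu>: "1 \<le> \<mu>" "card X * q \<le> \<mu>" and p: "p \<ge> 2"
  shows "(\<Sum>\<tau>\<in>{..<p} \<rightarrow>\<^sub>E X. if 2 * card (\<tau> ` {..<p}) \<le> p then q ^ card (\<tau> ` {..<p}) else 0)
     \<le> real p ^ (p + 1) * \<mu> ^ (p div 2)"
proof -
  let ?I = "\<lambda>\<tau>. \<tau> ` {..<p}"
  let ?F = "{..<p} \<rightarrow>\<^sub>E X"
  let ?g = "\<lambda>A. if 2 * card A \<le> p then q ^ card A else 0"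
  have finF: "finite ?F" using fin by (simp add: finite_PiE)
  have "(\<Sum>\<tau>\<in>?F. ?g (?I \<tau>)) = (\<Sum>A\<in>Pow X. \<Sum>\<tau>\<in>{\<tau>\<in>?F. ?I \<tau> = A}. ?g (?I \<tau>))"
    using fin finF by (intro sum.group[symmetric]) auto
  also have "\<dots> \<le> (\<Sum>A\<in>Pow X. (real (card A) ^ p) * ?g A)"
  proof (rule sum_mono)
    fix A assume "A \<in> Pow X"
    then have finA: "finite A" using fin finite_subset by auto
    have "{\<tau>\<in>?F. ?I \<tau> = A} \<subseteq> {..<p} \<rightarrow>\<^sub>E A" by (auto simp: PiE_def)
    then have "card {\<tau>\<in>?F. ?I \<tau> = A} \<le> card ({..<p} \<rightarrow>\<^sub>E A)"
      using finA by (intro card_mono finite_PiE) auto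
    also have "\<dots> = card A ^ p" by (simp add: card_PiE)
    finally have "real (card {\<tau>\<in>?F. ?I \<tau> = A}) \<le> real (card A) ^ p"
      by (metis of_nat_le_iff of_nat_power)
    moreover have "(\<Sum>\<tau>\<in>{\<tau>\<in>?F. ?I \<tau> = A}. ?g (?I \<tau>)) = real (card {\<tau>\<in>?F. ?I \<tau> = A}) * ?g A"
      by simp
    ultimately show "(\<Sum>\<tau>\<in>{\<tau>\<in>?F. ?I \<tau> = A}. ?g (?I \<tau>)) \<le> (real (card A) ^ p) * ?g A"
      using q by (simp add: mult_right_mono)
  qed
  also have "\<dots> = (\<Sum>j\<in>{..card X}. \<Sum>A\<in>{A\<in>Pow X. card A = j}. (real (card A) ^ p) * ?g A)"
    using fin by (intro sum.group[symmetric]) (auto simp: card_mono)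
  also have "\<dots> = (\<Sum>j\<le>card X. real (card X choose j) * (real j ^ p * (if 2 * j \<le> p then q ^ j else 0)))"
    using n_subsets[OF fin] by (intro sum.cong) (auto simp: Pow_def)
  also have "\<dots> = (\<Sum>j\<in>{j. j \<le> card X \<and> 2 * j \<le> p}. real (card X choose j) * (real j ^ p * q ^ j))"
    by (intro sum.mono_neutral_cong_right) auto
  also have "\<dots> \<le> (\<Sum>j\<in>{j. j \<le> card X \<and> 2 * j \<le> p}. real p ^ p * \<mu> ^ (p div 2))"
  proof (rule sum_mono)
    fix j assume j: "j \<in> {j. j \<le> card X \<and> 2 * j \<le> p}"
    have "real (card X choose j) * (real j ^ p * q ^ j) \<le> real (card X) ^ j * (real j ^ p * q ^ j)"
      using q binomial_le_pow[of j "card X"] j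
      by (intro mult_right_mono) (auto simp flip: of_nat_power)
    also have "\<dots> = real j ^ p * (card X * q) ^ j" by (simp add: power_mult_distrib)
    also have "\<dots> \<le> real p ^ p * \<mu> ^ j"
      using j q \<mu> by (intro mult_mono power_mono) auto
    also have "\<dots> \<le> real p ^ p * \<mu> ^ (p div 2)"
      using j \<mu> by (intro mult_left_mono power_increasing) auto
    finally show "real (card X choose j) * (real j ^ p * q ^ j) \<le> real p ^ p * \<mu> ^ (p div 2)" .
  qed
  also have "\<dots> = real (card {j. j \<le> card X \<and> 2 * j \<le> p}) * (real p ^ p * \<mu> ^ (p div 2))" by simp
  also have "\<dots> \<le> real p * (real p ^ p * \<mu> ^ (p div 2))"
  proof (rule mult_right_mono)
    have "{j. j \<le> card X \<and> 2 * j \<le> p} \<subseteq> {..p div 2}" by auto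
    then have "card {j. j \<le> card X \<and> 2 * j \<le> p} \<le> p div 2 + 1"
      using card_mono[of "{..p div 2}"] by simp
    then show "real (card {j. j \<le> card X \<and> 2 * j \<le> p}) \<le> real p" using p by linarith
  qed (use \<mu> in auto)
  finally show ?thesis by simp
qed

lemma power_indicator_affine:
  "(of_bool b - q) ^ e = moment_slope q e * of_bool b + (- q :: real) ^ e"
  by (cases b) (auto simp: moment_slope_def)

text \<open>The product expands into events "all of \<open>B\<close> hold". Replacing each
  probability by \<open>q ^ card B\<close> costs \<open>\<delta>\<close> per subset; what remains
  factors into central moments of independent bits, and one exponent \<open>1\<close> makes it
  vanish.\<close>

lemma expectation_product_bound:
  fixes M :: "'c pmf" and I :: "'x \<Rightarrow> 'c \<Rightarrow> bool" and q \<delta> :: real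
  assumes finM: "finite (set_pmf M)" and finA: "finite A" and q: "0 \<le> q" "q \<le> 1" and \<delta>: "\<delta> \<ge> 0"
    and ap: "\<And>B. B \<subseteq> A \<Longrightarrow> \<bar>prob M {c. \<forall>x\<in>B. I x c} - q ^ card B\<bar> \<le> \<delta>"
    and e: "\<And>x. x \<in> A \<Longrightarrow> e x > 0"
  shows "expect M (\<lambda>c. \<Prod>x\<in>A. (of_bool (I x c) - q) ^ e x)
     \<le> (if \<forall>x\<in>A. e x \<ge> 2 then q ^ card A else 0) + 2 ^ card A * \<delta>"
proof -
  note int = integrable_measure_pmf_finite[OF finM]
  let ?a = "\<lambda>x. moment_slope q (e x)" and ?b = "\<lambda>x. (- q) ^ e x"
  let ?c = "\<lambda>B. (\<Prod>x\<in>B. ?a x) * (\<Prod>x\<in>A - B. ?b x)"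
  let ?P = "\<lambda>B. prob M {c. \<forall>x\<in>B. I x c}"
  have "(\<Prod>x\<in>A. (of_bool (I x c) - q) ^ e x) = (\<Sum>B\<in>Pow A. ?c B * of_bool (\<forall>x\<in>B. I x c))" for c
  proof -
    have "(\<Prod>x\<in>A. (of_bool (I x c) - q) ^ e x) = (\<Prod>x\<in>A. ?a x * of_bool (I x c) + ?b x)"
      by (simp add: power_indicator_affine)
    also have "\<dots> = (\<Sum>B\<in>Pow A. (\<Prod>x\<in>B. ?a x * of_bool (I x c)) * (\<Prod>x\<in>A - B. ?b x))"
      by (rule prod_add[OF finA])
    also have "\<dots> = (\<Sum>B\<in>Pow A. ?c B * of_bool (\<forall>x\<in>B. I x c))"
    proof (rule sum.cong[OF refl])
      fix B assume "B \<in> Pow A"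
      then have finB: "finite B" using finA finite_subset by auto
      have "(\<Prod>x\<in>B. of_bool (I x c) :: real) = of_bool (\<forall>x\<in>B. I x c)"
        using finB by (induction B rule: finite_induct) auto
      then show "(\<Prod>x\<in>B. ?a x * of_bool (I x c)) * (\<Prod>x\<in>A - B. ?b x) = ?c B * of_bool (\<forall>x\<in>B. I x c)"
        by (simp add: prod.distrib)
    qed
    finally show ?thesis .
  qed
  then have "expect M (\<lambda>c. \<Prod>x\<in>A. (of_bool (I x c) - q) ^ e x)
      = (\<Sum>B\<in>Pow A. ?c B * expect M (\<lambda>c. of_bool (\<forall>x\<in>B. I x c)))"
    by (simp add: int)
  also have "\<dots> = (\<Sum>B\<in>Pow A. ?c B * ?P B)"
  proof (intro sum.cong refl arg_cong2[where f = "(*)"])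
    fix B
    have "(\<lambda>c. of_bool (\<forall>x\<in>B. I x c) :: real) = indicator {c. \<forall>x\<in>B. I x c}"
      by (auto simp: indicator_def)
    then show "expect M (\<lambda>c. of_bool (\<forall>x\<in>B. I x c)) = ?P B" by simp
  qed
  also have "\<dots> = (\<Sum>B\<in>Pow A. ?c B * q ^ card B) + (\<Sum>B\<in>Pow A. ?c B * (?P B - q ^ card B))"
    by (simp add: algebra_simps flip: sum.distrib)
  also have "(\<Sum>B\<in>Pow A. ?c B * q ^ card B) = (\<Prod>x\<in>A. ?a x * q + ?b x)"
    unfolding prod_add[OF finA] by (intro sum.cong) (auto simp: prod.distrib)
  also have "(\<Prod>x\<in>A. ?a x * q + ?b x) \<le> (if \<forall>x\<in>A. e x \<ge> 2 then q ^ card A else 0)"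
  proof (cases "\<forall>x\<in>A. e x \<ge> 2")
    case True
    have "\<bar>\<Prod>x\<in>A. ?a x * q + ?b x\<bar> \<le> (\<Prod>x\<in>A. q)"
      unfolding abs_prod using True q by (intro prod_mono) (auto simp: ideal_moment_abs)
    then show ?thesis using True by simp
  next
    case False
    then obtain x where "x \<in> A" "e x = 1" using e by (metis One_nat_def less_2_cases not_le less_irrefl)
    then have "\<exists>x\<in>A. ?a x * q + ?b x = 0" by (auto simp: moment_slope_def intro!: bexI[of _ x])
    then have "(\<Prod>x\<in>A. ?a x * q + ?b x) = 0" using finA by simp
    then show ?thesis using False q by simp
  qed
  also have "(\<Sum>B\<in>Pow A. ?c B * (?P B - q ^ card B)) \<le> (\<Sum>B\<in>Pow A. (\<Prod>x\<in>B. 1) * (\<Prod>x\<in>A - B. 1) * \<delta>)"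
  proof (rule sum_mono)
    fix B assume B: "B \<in> Pow A"
    have "\<bar>\<Prod>x\<in>B. ?a x\<bar> \<le> (\<Prod>x\<in>B. 1)"
      unfolding abs_prod using B q e by (intro prod_mono) (auto intro!: moment_slope_abs)
    moreover have "\<bar>\<Prod>x\<in>A - B. ?b x\<bar> \<le> (\<Prod>x\<in>A - B. 1)"
      unfolding abs_prod using q by (intro prod_mono) (auto simp: power_abs power_le_one)
    ultimately have "\<bar>?c B * (?P B - q ^ card B)\<bar> \<le> (\<Prod>x\<in>B. 1) * (\<Prod>x\<in>A - B. 1) * \<delta>"
      unfolding abs_mult using B ap[of B] by (intro mult_mono) auto
    then show "?c B * (?P B - q ^ card B) \<le> (\<Prod>x\<in>B. 1) * (\<Prod>x\<in>A - B. 1) * \<delta>" by linarith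
  qed
  also have "\<dots> = 2 ^ card A * \<delta>"
    using finA by (simp add: card_Pow)
  finally show ?thesis by linarith
qed

text \<open>The \<open>p\<close>-th power is a sum over words \<open>\<tau>\<close> of length
  \<open>p\<close>; \<open>e x\<close> is the multiplicity of \<open>x\<close> in the word.\<close>

lemma central_moment_bound:
  fixes M :: "'c pmf" and I :: "'x \<Rightarrow> 'c \<Rightarrow> bool" and q \<delta> \<mu> :: real
  assumes finM: "finite (set_pmf M)" and fin: "finite X" and q: "0 \<le> q" "q \<le> 1" and \<delta>: "\<delta> \<ge> 0"
    and ap: "\<And>B. B \<subseteq> X \<Longrightarrow> card B \<le> p \<Longrightarrow> \<bar>prob M {c. \<forall>x\<in>B. I x c} - q ^ card B\<bar> \<le> \<delta>"
    and \<mu>: "1 \<le> \<mu>" "card X * q \<le> \<mu>" and p: "p \<ge> 2"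
  shows "expect M (\<lambda>c. (\<Sum>x\<in>X. of_bool (I x c) - q) ^ p)
     \<le> real p ^ (p + 1) * \<mu> ^ (p div 2) + (2 * card X) ^ p * \<delta>"
proof -
  note int = integrable_measure_pmf_finite[OF finM]
  let ?F = "{..<p} \<rightarrow>\<^sub>E X"
  let ?E = "expect M"
  let ?Z = "\<lambda>c x. of_bool (I x c) - q"
  have "?E (\<lambda>c. (\<Sum>x\<in>X. ?Z c x) ^ p) = ?E (\<lambda>c. \<Sum>\<tau>\<in>?F. \<Prod>i<p. ?Z c (\<tau> i))"
    using prod_sum_PiE[of "{..<p}" "\<lambda>_. X" "\<lambda>i x. ?Z _ x"] fin by simp
  also have "\<dots> = (\<Sum>\<tau>\<in>?F. ?E (\<lambda>c. \<Prod>i<p. ?Z c (\<tau> i)))"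
    by (simp add: int)
  also have "\<dots> \<le> (\<Sum>\<tau>\<in>?F. (if 2 * card (\<tau> ` {..<p}) \<le> p then q ^ card (\<tau> ` {..<p}) else 0) + 2 ^ p * \<delta>)"
  proof (rule sum_mono)
    fix \<tau> assume \<tau>: "\<tau> \<in> ?F"
    let ?A = "\<tau> ` {..<p}"
    define e where "e x = card {i\<in>{..<p}. \<tau> i = x}" for x
    have AX: "?A \<subseteq> X" using \<tau> by auto
    have cA: "card ?A \<le> p" using card_image_le[of "{..<p}" \<tau>] by simp
    have e0: "e x > 0" if "x \<in> ?A" for x
      using that by (auto simp: e_def card_gt_0_iff)
    have "(\<Prod>i<p. ?Z c (\<tau> i)) = (\<Prod>x\<in>?A. ?Z c x ^ e x)" for c
    proof -
      have "(\<Prod>i<p. ?Z c (\<tau> i)) = (\<Prod>x\<in>?A. \<Prod>i\<in>{i\<in>{..<p}. \<tau> i = x}. ?Z c (\<tau> i))"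
        by (rule prod.image_gen) simp
      also have "\<dots> = (\<Prod>x\<in>?A. ?Z c x ^ e x)"
        by (intro prod.cong) (auto simp: e_def)
      finally show ?thesis .
    qed
    then have "?E (\<lambda>c. \<Prod>i<p. ?Z c (\<tau> i)) = ?E (\<lambda>c. \<Prod>x\<in>?A. ?Z c x ^ e x)"
      by simp
    also have "\<dots> \<le> (if \<forall>x\<in>?A. e x \<ge> 2 then q ^ card ?A else 0) + 2 ^ card ?A * \<delta>"
    proof (rule expectation_product_bound[OF finM _ q \<delta> _ e0])
      fix B assume "B \<subseteq> ?A"
      moreover from this have "card B \<le> p" using cA card_mono[of ?A B] by simp
      ultimately show "\<bar>prob M {c. \<forall>x\<in>B. I x c} - q ^ card B\<bar> \<le> \<delta>"
        using AX by (intro ap) auto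
    qed auto
    also have "\<dots> \<le> (if 2 * card ?A \<le> p then q ^ card ?A else 0) + 2 ^ p * \<delta>"
    proof (rule add_mono)
      have "2 * card ?A \<le> p" if "\<forall>x\<in>?A. e x \<ge> 2"
      proof -
        have "2 * card ?A = (\<Sum>x\<in>?A. 2)" by simp
        also have "\<dots> \<le> (\<Sum>x\<in>?A. e x)" using that by (intro sum_mono) auto
        also have "\<dots> = (\<Sum>i<p. 1)"
          unfolding e_def using sum.image_gen[of "{..<p}" "\<lambda>_. 1::nat" \<tau>] by simp
        finally show ?thesis by simp
      qed
      then show "(if \<forall>x\<in>?A. e x \<ge> 2 then q ^ card ?A else 0) \<le> (if 2 * card ?A \<le> p then q ^ card ?A else 0)"
        using q by auto
      show "2 ^ card ?A * \<delta> \<le> 2 ^ p * \<delta>"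
        using cA \<delta> by (intro mult_right_mono power_increasing) auto
    qed
    finally show "?E (\<lambda>c. \<Prod>i<p. ?Z c (\<tau> i)) \<le> (if 2 * card ?A \<le> p then q ^ card ?A else 0) + 2 ^ p * \<delta>" .
  qed
  also have "\<dots> = (\<Sum>\<tau>\<in>?F. if 2 * card (\<tau> ` {..<p}) \<le> p then q ^ card (\<tau> ` {..<p}) else 0) + (2 * card X) ^ p * \<delta>"
    by (simp add: sum.distrib card_PiE power_mult_distrib)
  also have "\<dots> \<le> real p ^ (p + 1) * \<mu> ^ (p div 2) + (2 * card X) ^ p * \<delta>"
    using sum_functions_small_image[OF fin q(1) \<mu> p] by simp
  finally show ?thesis .
qed

text \<open>Markov's inequality for the \<open>p\<close>-th power, which is nonnegative since
  \<open>p\<close> is even.\<close>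

lemma tail_bound:
  fixes M :: "'c pmf" and I :: "'x \<Rightarrow> 'c \<Rightarrow> bool" and q \<delta> \<mu> \<epsilon> :: real
  assumes finM: "finite (set_pmf M)" and fin: "finite X" and q: "0 \<le> q" "q \<le> 1" and \<delta>: "\<delta> \<ge> 0"
    and ap: "\<And>B. B \<subseteq> X \<Longrightarrow> card B \<le> p \<Longrightarrow> \<bar>prob M {c. \<forall>x\<in>B. I x c} - q ^ card B\<bar> \<le> \<delta>"
    and \<mu>: "1 \<le> \<mu>" "card X * q \<le> \<mu>" and p: "p \<ge> 2" "even p" and \<epsilon>: "\<epsilon> > 0"
  shows "prob M {c. real (card {x\<in>X. I x c}) > (1 + \<epsilon>) * \<mu>}
     \<le> (real p ^ (p + 1) * \<mu> ^ (p div 2) + (2 * card X) ^ p * \<delta>) / (\<epsilon> * \<mu>) ^ p"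
proof -
  let ?Y = "\<lambda>c. (\<Sum>x\<in>X. of_bool (I x c) - q)"
  have Y: "?Y c = real (card {x\<in>X. I x c}) - card X * q" for c
  proof -
    have "(\<Sum>x\<in>X. of_bool (I x c) :: real) = (\<Sum>x\<in>{x\<in>X. I x c}. 1)"
      using fin by (intro sum.mono_neutral_cong_right) auto
    then show ?thesis by (simp add: sum_subtractf)
  qed
  have "prob M {c. real (card {x\<in>X. I x c}) > (1 + \<epsilon>) * \<mu>}
      \<le> prob M {c \<in> space (measure_pmf M). ?Y c ^ p \<ge> (\<epsilon> * \<mu>) ^ p}"
  proof (rule measure_pmf.finite_measure_mono; safe?)
    fix c assume "real (card {x\<in>X. I x c}) > (1 + \<epsilon>) * \<mu>"
    then have "?Y c \<ge> \<epsilon> * \<mu>" using \<mu> unfolding Y by (simp add: algebra_simps)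
    then show "?Y c ^ p \<ge> (\<epsilon> * \<mu>) ^ p" using \<epsilon> \<mu> by (intro power_mono) auto
  qed auto
  also have "\<dots> \<le> expect M (\<lambda>c. ?Y c ^ p) / (\<epsilon> * \<mu>) ^ p"
    by (rule integral_Markov_inequality_measure[OF integrable_measure_pmf_finite[OF finM], of UNIV])
       (use p \<epsilon> \<mu> in auto)
  also have "\<dots> \<le> (real p ^ (p + 1) * \<mu> ^ (p div 2) + (2 * card X) ^ p * \<delta>) / (\<epsilon> * \<mu>) ^ p"
    using \<epsilon> \<mu> p by (intro divide_right_mono central_moment_bound[OF finM fin q \<delta> ap]) auto
  finally show ?thesis .
qed

section \<open>Witness trees\<close>

text \<open>The history of the process is turned into static data: the bin of each ball and its
  height, that is, the load of the bin just after the ball arrived. The greedy rule gives the height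
  inequality at the time of insertion; it persists because loads only grow.\<close>

lemma greedy_heights:
  assumes "uniform_greedy d h xs load" "distinct xs"
  shows "\<exists>alloc ht. (\<forall>x\<in>set xs. alloc x \<in> (\<lambda>i. h i x) ` {..<d} \<and> (\<forall>i<d. ht x \<le> load (h i x) + 1)) \<and>
    (\<forall>v t. 1 \<le> t \<and> t \<le> load v \<longrightarrow> (\<exists>x\<in>set xs. alloc x = v \<and> ht x = t))"
  using assms
proof (induction rule: uniform_greedy.induct)
  case empty
  then show ?case by auto
next
  case (insert xs load j x)
  then have "\<exists>alloc ht. (\<forall>x\<in>set xs. alloc x \<in> (\<lambda>i. h i x) ` {..<d} \<and> (\<forall>i<d. ht x \<le> load (h i x) + 1)) \<and>
    (\<forall>v t. 1 \<le> t \<and> t \<le> load v \<longrightarrow> (\<exists>x\<in>set xs. alloc x = v \<and> ht x = t))"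
    by simp
  then obtain alloc ht where *: "(\<forall>x\<in>set xs. alloc x \<in> (\<lambda>i. h i x) ` {..<d} \<and> (\<forall>i<d. ht x \<le> load (h i x) + 1)) \<and>
    (\<forall>v t. 1 \<le> t \<and> t \<le> load v \<longrightarrow> (\<exists>x\<in>set xs. alloc x = v \<and> ht x = t))"
    by blast
  then have
    a: "\<And>y. y \<in> set xs \<Longrightarrow> alloc y \<in> (\<lambda>i. h i y) ` {..<d}"
    and b: "\<And>y i. y \<in> set xs \<Longrightarrow> i < d \<Longrightarrow> ht y \<le> load (h i y) + 1"
    and c: "\<And>v t. 1 \<le> t \<Longrightarrow> t \<le> load v \<Longrightarrow> \<exists>y\<in>set xs. alloc y = v \<and> ht y = t"
    by blast+
  have x: "x \<notin> set xs" using insert.prems by simp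
  let ?load = "load(h j x := load (h j x) + 1)"
  let ?alloc = "alloc(x := h j x)" and ?ht = "ht(x := load (h j x) + 1)"
  show ?case
  proof (intro exI[of _ ?alloc] exI[of _ ?ht] conjI ballI allI impI)
    fix y assume y: "y \<in> set (xs @ [x])"
    show "?alloc y \<in> (\<lambda>i. h i y) ` {..<d}" using y a insert.hyps(2) by auto
    fix i assume i: "i < d"
    show "?ht y \<le> ?load (h i y) + 1"
    proof (cases "y = x")
      case True
      then show ?thesis using insert.hyps(3)[OF i] by simp
    next
      case False
      then show ?thesis using b[of y i] y i by auto
    qed
  next
    fix v t assume t: "1 \<le> t \<and> t \<le> ?load v"
    show "\<exists>y\<in>set (xs @ [x]). ?alloc y = v \<and> ?ht y = t"
    proof (cases "t \<le> load v")
      case True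
      then obtain y where "y \<in> set xs" "alloc y = v" "ht y = t" using c t by blast
      then show ?thesis using x by (auto intro!: bexI[of _ y])
    next
      case False
      then show ?thesis using t by (auto split: if_splits)
    qed
  qed
qed

text \<open>A tree of height \<open>j + 1\<close> at the bin \<open>v\<close> is a tree of height \<open>j\<close> at \<open>v\<close> together with a ball
  \<open>y\<close>, \<open>h\<^sub>i(y) = v\<close>, whose other \<open>d - 1\<close> bins carry trees of height \<open>j\<close>: if \<open>y\<close> raised the load of
  \<open>v\<close> from \<open>s + j\<close> to \<open>s + j + 1\<close>, then every bin of \<open>y\<close> had load at least \<open>s + j\<close>. A leaf is a bin
  with \<open>s\<close> balls. A tree is recorded as its set of constraints \<open>h\<^sub>i(y) = u\<close>; \<open>C\<close> will be the
  compatibility of such a constraint with the prefixes.\<close>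

primrec witnesses ::
    "nat \<Rightarrow> nat \<Rightarrow> 'a set \<Rightarrow> 'b set \<Rightarrow> (nat \<Rightarrow> 'a \<Rightarrow> 'b \<Rightarrow> bool) \<Rightarrow> nat \<Rightarrow> 'b \<Rightarrow> (nat \<times> 'a \<times> 'b) set set"
  where
    "witnesses d s X V C 0 = (\<lambda>v. {\<sigma>. \<sigma> \<subseteq> {(i, y, u). i < d \<and> y \<in> X \<and> C i y v \<and> u = v} \<and> card \<sigma> = s})"
  | "witnesses d s X V C (Suc j) = (\<lambda>v.
      \<Union>(i, y)\<in>{(i, y). i < d \<and> y \<in> X \<and> C i y v}.
      \<Union>u\<in>Pi\<^sub>E ({..<d} - {i}) (\<lambda>i'. {b \<in> V. C i' y b}).
        (\<lambda>(\<sigma>, \<tau>). insert (i, y, v) (\<sigma> \<union> (\<Union>i'\<in>{..<d} - {i}. insert (i', y, u i') (\<tau> i')))) `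
          (witnesses d s X V C j v \<times> Pi\<^sub>E ({..<d} - {i}) (\<lambda>i'. witnesses d s X V C j (u i'))))"

text \<open>One more level means \<open>d\<close> subtrees and the \<open>d\<close> constraints of
  the top ball. This is the size without repeated constraints, as the disjointness arguments below
  will ensure.\<close>

primrec witness_size :: "nat \<Rightarrow> nat \<Rightarrow> nat \<Rightarrow> nat" where
  "witness_size d s 0 = s"
| "witness_size d s (Suc j) = d * witness_size d s j + d"

section \<open>Deterministic part: a tree next to every overloaded bin\<close>

locale greedy_allocation =
  fixes d :: nat and h :: "nat \<Rightarrow> 'a \<Rightarrow> 'b" and X :: "'a set"
    and load :: "'b \<Rightarrow> nat" and alloc :: "'a \<Rightarrow> 'b" and ht :: "'a \<Rightarrow> nat"
  assumes fin: "finite X" and d2: "d \<ge> 2"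
    and alloc: "x \<in> X \<Longrightarrow> alloc x \<in> (\<lambda>i. h i x) ` {..<d}"
    and height: "x \<in> X \<Longrightarrow> i < d \<Longrightarrow> ht x \<le> load (h i x) + 1"
    and ball_ex: "1 \<le> t \<Longrightarrow> t \<le> load v \<Longrightarrow> \<exists>x\<in>X. alloc x = v \<and> ht x = t"
begin

definition bins :: "'a \<Rightarrow> 'b set" where
  "bins y = (\<lambda>i. h i y) ` {..<d}"

definition Bins :: "'a set \<Rightarrow> 'b set" where
  "Bins P = \<Union> (bins ` P)"

definition ball_at :: "'b \<Rightarrow> nat \<Rightarrow> 'a" where
  "ball_at v t = (SOME x. x \<in> X \<and> alloc x = v \<and> ht x = t)"

lemma ball_at:
  assumes "1 \<le> t" "t \<le> load v"
  shows "ball_at v t \<in> X" "alloc (ball_at v t) = v" "ht (ball_at v t) = t"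
  using someI_ex[of "\<lambda>x. x \<in> X \<and> alloc x = v \<and> ht x = t"] ball_ex[OF assms]
  unfolding ball_at_def by auto

lemma card_bins: "card (bins y) \<le> d" and fin_bins: "finite (bins y)"
  using card_image_le[of "{..<d}" "\<lambda>i. h i y"] by (auto simp: bins_def)

lemma alloc_in_bins: "x \<in> X \<Longrightarrow> alloc x \<in> bins x"
  using alloc by (simp add: bins_def)

lemma load_bins: "x \<in> X \<Longrightarrow> u \<in> bins x \<Longrightarrow> ht x \<le> load u + 1"
  using height by (auto simp: bins_def)

lemma fin_Bins: "finite P \<Longrightarrow> finite (Bins P)"
  by (auto simp: Bins_def fin_bins)

lemma Bins_insert: "Bins (insert y P) = bins y \<union> Bins P"
  by (auto simp: Bins_def)

lemma Bins_Un: "Bins (P \<union> Q) = Bins P \<union> Bins Q"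
  by (auto simp: Bins_def)

lemma bins_subset_Bins: "y \<in> P \<Longrightarrow> bins y \<subseteq> Bins P"
  by (auto simp: Bins_def)

text \<open>The roots of all subtrees of the tree of height \<open>j\<close> at \<open>v\<close>.
  Disjointness of trees is proved for these sets of bins, before any constraints are chosen.\<close>

primrec reach :: "nat \<Rightarrow> nat \<Rightarrow> 'b \<Rightarrow> 'b set" where
  "reach s 0 v = {v}"
| "reach s (Suc j) v = reach s j v \<union> (\<Union>u\<in>bins (ball_at v (s + Suc j)) - {v}. reach s j u)"

lemma in_reach: "v \<in> reach s j v"
  by (induction j) auto

end

text \<open>The hypotheses say that, outside a set \<open>A\<close> of balls and up to \<open>T\<close> balls, the hypergraph
  of bins is a hypertree hanging off the bin \<open>b0\<close> by the ball \<open>z\<close>.\<close>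

locale local_hypertree = greedy_allocation +
  fixes A :: "'a set" and b0 :: 'b and z :: 'a and T :: nat
  assumes expand: "P \<subseteq> X - A \<Longrightarrow> card P \<le> T \<Longrightarrow> card {y \<in> P. b0 \<in> bins y} \<le> 2 \<Longrightarrow>
    (d - 1) * card P \<le> card (Bins P - insert b0 (Bins A))"
begin

definition new :: "'a set \<Rightarrow> 'b set" where
  "new P = Bins P - insert b0 (Bins A)"

text \<open>Equality in the expansion bound means that each ball contributes exactly
  \<open>d - 1\<close> new bins, so \<open>P\<close> has no cycle, neither in itself nor through the
  old bins.\<close>

definition good :: "'a set \<Rightarrow> bool" where
  "good P \<longleftrightarrow> P \<subseteq> X - A \<and> card (new P) = (d - 1) * card P \<and> {y \<in> P. b0 \<in> bins y} \<subseteq> {z}"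

lemma good_finite: "good P \<Longrightarrow> finite P"
  using fin finite_subset unfolding good_def by blast

text \<open>A squeeze: \<open>expand\<close> forces at least \<open>d - 1\<close> further new bins,
  whereas \<open>y\<close> has at most \<open>d\<close> bins and one of them, \<open>u\<close>, is
  already counted. Hence \<open>y\<close> has \<open>d\<close> distinct bins and meets the old ones
  in \<open>u\<close> only.\<close>

lemma good_extend:
  assumes P: "good P" "card P < T" and y: "y \<in> X" "y \<notin> P" and u: "u \<in> bins y" "u \<in> new P"
  shows "good (insert y P)" "card (bins y) = d" "bins y \<inter> (insert b0 (Bins A) \<union> Bins P) = {u}"
proof -
  let ?Bd = "insert b0 (Bins A)"
  let ?K = "bins y - ?Bd - Bins P"
  have finP: "finite P" using good_finite[OF P(1)] .
  have "y \<notin> A" using u bins_subset_Bins[of y A] by (auto simp: new_def)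
  then have sub: "insert y P \<subseteq> X - A" using P y by (auto simp: good_def)
  \<comment> \<open>At this stage \<open>y\<close> might still hit \<open>b0\<close> in addition to
    \<open>z\<close>; this is why \<open>expand\<close> admits two balls at \<open>b0\<close>.
    Below, \<open>b0\<close> turns out not to be a bin of \<open>y\<close>.\<close>
  have "{y' \<in> insert y P. b0 \<in> bins y'} \<subseteq> {z, y}" using P by (auto simp: good_def)
  then have "card {y' \<in> insert y P. b0 \<in> bins y'} \<le> card {z, y}" by (intro card_mono) auto
  also have "\<dots> \<le> 2" by (simp add: card_insert_if)
  finally have inc: "card {y' \<in> insert y P. b0 \<in> bins y'} \<le> 2" .
  have ge: "(d - 1) * card (insert y P) \<le> card (new (insert y P))"
    unfolding new_def using P(2) y(2) finP by (intro expand[OF sub _ inc]) auto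
  have split: "new (insert y P) = new P \<union> ?K" "new P \<inter> ?K = {}"
    by (auto simp: new_def Bins_insert)
  have card_eq: "card (new (insert y P)) = (d - 1) * card P + card ?K"
    unfolding split(1) using P(1) finP split(2)
    by (subst card_Un_disjoint) (auto simp: new_def fin_Bins fin_bins good_def)
  then have K: "d - 1 \<le> card ?K" using ge y(2) finP by simp
  have Ksub: "?K \<subseteq> bins y - {u}" using u by (auto simp: new_def)
  have cu: "card (bins y - {u}) = card (bins y) - 1" using u fin_bins by simp
  have Kle: "card ?K \<le> card (bins y) - 1" using card_mono[OF _ Ksub] fin_bins cu by simp
  show cd: "card (bins y) = d" using K Kle card_bins[of y] d2 by linarith
  have Keq: "?K = bins y - {u}"
    using K Kle cu cd fin_bins by (intro card_subset_eq Ksub) auto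
  show "bins y \<inter> (?Bd \<union> Bins P) = {u}"
    using Keq u by (auto simp: new_def)
  have "b0 \<notin> bins y"
  proof
    assume "b0 \<in> bins y"
    then have "b0 = u" using Keq by blast
    moreover have "u \<noteq> b0" using u(2) unfolding new_def by blast
    ultimately show False by simp
  qed
  then show "good (insert y P)"
    using sub P(1) card_eq Keq cu cd y finP by (auto simp: good_def)
qed

text \<open>The at most \<open>j\<close> balls on the path from \<open>v\<close> to \<open>w\<close>
  are added to \<open>P\<close> one after the other. The height condition keeps the next ball at
  \<open>v\<close> out of \<open>P\<close>. By the last conjunct no added ball touches any other new
  bin of \<open>P\<close>, so a second path can later start at such a bin.\<close>

lemma reach_path:
  assumes "load v \<ge> s + j" "good P" "card P + j \<le> T" "v \<in> new P"
    "\<And>y. y \<in> P \<Longrightarrow> alloc y = v \<Longrightarrow> ht y > s + j" "w \<in> reach s j v"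
  shows "\<exists>Q. good Q \<and> P \<subseteq> Q \<and> card Q \<le> card P + j \<and> w \<in> new Q \<and> (w = v \<or> w \<notin> Bins P) \<and>
    (\<forall>u\<in>new P - {v}. {y \<in> Q. u \<in> bins y} = {y \<in> P. u \<in> bins y})"
  using assms
proof (induction j arbitrary: P v)
  case 0
  then show ?case by (intro exI[of _ P]) auto
next
  case (Suc j)
  define y where "y = ball_at v (s + Suc j)"
  have y: "y \<in> X" "alloc y = v" "ht y = s + Suc j"
    unfolding y_def using ball_at[of "s + Suc j" v] Suc.prems(1) by auto
  consider "w \<in> reach s j v" | u where "u \<in> bins y" "u \<noteq> v" "w \<in> reach s j u"
    using Suc.prems(6) by (auto simp: y_def)
  then show ?case
  proof cases
    \<comment> \<open>Here \<open>w\<close> already lies in the lower tree at the same root, so the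
      top ball is not added.\<close>
    case 1
    let ?ok = "\<lambda>Q. good Q \<and> P \<subseteq> Q \<and> card Q \<le> card P + j \<and> w \<in> new Q \<and> (w = v \<or> w \<notin> Bins P) \<and>
      (\<forall>u\<in>new P - {v}. {y \<in> Q. u \<in> bins y} = {y \<in> P. u \<in> bins y})"
    have "\<exists>Q. ?ok Q" using Suc.prems 1 by (intro Suc.IH) force+
    then obtain Q where Q: "?ok Q" by blast
    moreover from Q have "card Q \<le> card P + Suc j" by linarith
    ultimately show ?thesis by blast
  next
    case 2
    have yP: "y \<notin> P" using Suc.prems(5) y by force
    have v: "v \<in> bins y" using alloc_in_bins y by force
    note ext = good_extend[OF Suc.prems(2) _ y(1) yP v Suc.prems(4)]
    have P1: "good (insert y P)" and int: "bins y \<inter> (insert b0 (Bins A) \<union> Bins P) = {v}"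
      using ext Suc.prems(3) by auto
    have finP: "finite P" using good_finite[OF Suc.prems(2)] .
    have cP1: "card (insert y P) = Suc (card P)" using yP finP by simp
    have u: "u \<notin> insert b0 (Bins A)" "u \<notin> Bins P" using int 2 by blast+
    have uP1: "u \<in> new (insert y P)" using u 2 by (auto simp: new_def Bins_insert)
    have alloc_u: "alloc y' \<noteq> u" if "y' \<in> insert y P" for y'
    proof (cases "y' = y")
      case True
      then show ?thesis using y 2 by simp
    next
      case False
      then have y': "y' \<in> P" "y' \<in> X" using that Suc.prems(2) by (auto simp: good_def)
      then have "alloc y' \<in> Bins P" using alloc_in_bins bins_subset_Bins by blast
      then show ?thesis using u by auto
    qed
    have "load u \<ge> s + j" using load_bins[OF y(1) 2(1)] y(3) by simp
    then have "\<exists>Q. good Q \<and> insert y P \<subseteq> Q \<and> card Q \<le> card (insert y P) + j \<and> w \<in> new Q \<and>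
        (w = u \<or> w \<notin> Bins (insert y P)) \<and>
        (\<forall>u'\<in>new (insert y P) - {u}. {y' \<in> Q. u' \<in> bins y'} = {y' \<in> insert y P. u' \<in> bins y'})"
      using Suc.prems(3) cP1 alloc_u 2(3) by (intro Suc.IH P1 uP1) auto
    then obtain Q where Q: "good Q" "insert y P \<subseteq> Q" "card Q \<le> card P + Suc j" "w \<in> new Q"
        "w = u \<or> w \<notin> Bins (insert y P)"
        "\<forall>u'\<in>new (insert y P) - {u}. {y' \<in> Q. u' \<in> bins y'} = {y' \<in> insert y P. u' \<in> bins y'}"
      using cP1 by auto
    show ?thesis
    proof (intro exI[of _ Q] conjI ballI)
      show "w = v \<or> w \<notin> Bins P" using Q(5) u by (auto simp: Bins_insert)
      fix u' assume u': "u' \<in> new P - {v}"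
      have "u' \<in> new (insert y P) - {u}" using u' u by (auto simp: new_def Bins_insert)
      moreover have "u' \<notin> bins y" using int u' by (auto simp: new_def)
      ultimately show "{y \<in> Q. u' \<in> bins y} = {y \<in> P. u' \<in> bins y}" using Q(6) by auto
    qed (use Q in auto)
  qed
qed

text \<open>A common bin \<open>w\<close> would close a cycle. The path from \<open>v\<close> makes
  \<open>w\<close> a bin of \<open>Q\<close>; a second path from \<open>u\<close>, built on top of
  \<open>Q\<close>, ends either in \<open>u\<close> or outside the bins of \<open>Q\<close>, so
  \<open>w = u\<close>. But \<open>u\<close> belongs to \<open>Bins P\<close>, which the first path
  avoids except for \<open>v\<close>. Two paths explain the budget \<open>2 * j\<close>.\<close>

lemma reach_disjoint:
  assumes P: "good P" "card P + 2 * j \<le> T" and v: "v \<in> new P" and u: "u \<in> new P" "v \<noteq> u"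
    and load: "load v \<ge> s + j" "load u \<ge> s + j"
    and hv: "\<And>y. y \<in> P \<Longrightarrow> alloc y = v \<Longrightarrow> ht y > s + j"
    and hu: "\<And>y. y \<in> P \<Longrightarrow> alloc y = u \<Longrightarrow> ht y > s + j"
  shows "reach s j v \<inter> reach s j u = {}"
proof (rule ccontr)
  assume "reach s j v \<inter> reach s j u \<noteq> {}"
  then obtain w where w: "w \<in> reach s j v" "w \<in> reach s j u" by auto
  have cP: "card P + j \<le> T" using P(2) by simp
  obtain Q where Q: "good Q" "P \<subseteq> Q" "card Q \<le> card P + j" "w \<in> new Q" "w = v \<or> w \<notin> Bins P"
      "\<forall>u\<in>new P - {v}. {y \<in> Q. u \<in> bins y} = {y \<in> P. u \<in> bins y}"
    using reach_path[OF load(1) P(1) cP v hv w(1)] by blast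
  have uQ: "u \<in> new Q" using u Q(2) by (auto simp: new_def Bins_def)
  have huQ: "ht y > s + j" if y: "y \<in> Q" "alloc y = u" for y
  proof -
    have "y \<in> X" using y Q(1) by (auto simp: good_def)
    then have "u \<in> bins y" using alloc_in_bins y by blast
    then have "y \<in> P" using Q(6) u y by blast
    then show ?thesis using hu y by blast
  qed
  have "card Q + j \<le> T" using P(2) Q(3) by simp
  then have "w = u \<or> w \<notin> Bins Q"
    using reach_path[OF load(2) Q(1) _ uQ huQ w(2)] by blast
  then have "w = u" using Q(4) by (auto simp: new_def)
  then show False using Q(5) u by (auto simp: new_def)
qed

text \<open>Each bin of the ball at height \<open>s + j + 1\<close> has load at least
  \<open>s + j\<close> and carries a subtree. The conclusion also records where the balls of a tree
  are allocated and, at the root, how high they lie: this makes the constraint sets of different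
  subtrees disjoint, so that the size is exact.\<close>

lemma witness_exists:
  assumes s: "s \<ge> 1" and C: "\<And>i x. i < d \<Longrightarrow> x \<in> X \<Longrightarrow> C i x (h i x)"
    and V: "\<And>i x. i < d \<Longrightarrow> x \<in> X \<Longrightarrow> h i x \<in> V"
  assumes "load v \<ge> s + j" "good P" "card P + 2 * j \<le> T" "v \<in> new P"
    "\<And>y. y \<in> P \<Longrightarrow> alloc y = v \<Longrightarrow> ht y > s + j"
  shows "\<exists>\<sigma>\<in>witnesses d s X V C j v. card \<sigma> = witness_size d s j \<and>
    (\<forall>(i, y, u)\<in>\<sigma>. i < d \<and> y \<in> X \<and> h i y = u \<and> alloc y \<in> reach s j v \<and> (alloc y = v \<longrightarrow> ht y \<le> s + j))"
  using assms(4-8)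
proof (induction j arbitrary: P v)
  case 0
  have b: "ball_at v t \<in> X" "alloc (ball_at v t) = v" "ht (ball_at v t) = t" if "t \<in> {1..s}" for t
    using ball_at[of t v] that 0(1) by auto
  have "\<exists>i<d. h i (ball_at v t) = v" if "t \<in> {1..s}" for t
    using alloc[OF b(1)[OF that]] b(2)[OF that] by auto
  then obtain ix where ix: "\<And>t. t \<in> {1..s} \<Longrightarrow> ix t < d \<and> h (ix t) (ball_at v t) = v" by metis
  let ?f = "\<lambda>t. (ix t, ball_at v t, v)"
  have inj: "inj_on ?f {1..s}"
  proof (rule inj_onI)
    fix t t' assume t: "t \<in> {1..s}" "t' \<in> {1..s}" "?f t = ?f t'"
    then have "ht (ball_at v t) = ht (ball_at v t')" by simp
    then show "t = t'" using b(3)[OF t(1)] b(3)[OF t(2)] by simp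
  qed
  have "?f t \<in> {(i, y, u). i < d \<and> y \<in> X \<and> C i y v \<and> u = v}" if "t \<in> {1..s}" for t
    using ix[OF that] b[OF that] C[of "ix t" "ball_at v t"] by auto
  then have *: "?f ` {1..s} \<in> witnesses d s X V C 0 v"
    using inj by (simp add: card_image image_subset_iff)
  show ?case
    by (rule bexI[OF _ *]) (use ix b inj in \<open>auto simp: card_image\<close>)
next
  case (Suc j)
  define y where "y = ball_at v (s + Suc j)"
  have y: "y \<in> X" "alloc y = v" "ht y = s + Suc j"
    unfolding y_def using ball_at[of "s + Suc j" v] Suc.prems(1) by auto
  have yP: "y \<notin> P" using Suc.prems(5) y by force
  have vy: "v \<in> bins y" using alloc_in_bins y by force
  have P1: "good (insert y P)" and cb: "card (bins y) = d"
    and int: "bins y \<inter> (insert b0 (Bins A) \<union> Bins P) = {v}"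
    using good_extend[OF Suc.prems(2) _ y(1) yP vy Suc.prems(4)] Suc.prems(3) by auto
  have finP: "finite P" using good_finite[OF Suc.prems(2)] .
  have cP1: "card (insert y P) + 2 * j \<le> T" using yP finP Suc.prems(3) by simp
  have inj: "inj_on (\<lambda>i. h i y) {..<d}"
    using cb unfolding bins_def by (intro eq_card_imp_inj_on) auto
  obtain i where i: "i < d" "h i y = v" using vy by (auto simp: bins_def)
  define I where "I = {..<d} - {i}"
  have finI: "finite I" and cI: "card I = d - 1" using i by (auto simp: I_def)
  have load: "load u \<ge> s + j" if "u \<in> bins y" for u
    using load_bins[OF y(1) that] y(3) by simp
  have newP1: "u \<in> new (insert y P)" if "u \<in> bins y" for u
    using that int Suc.prems(4) by (cases "u = v") (auto simp: new_def Bins_insert)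
  have htP1: "ht y' > s + j" if y': "y' \<in> insert y P" "alloc y' = u" "u \<in> bins y" for y' u
  proof (cases "y' = y")
    case True
    then show ?thesis using y by simp
  next
    case False
    then have y'P: "y' \<in> P" "y' \<in> X" using y' Suc.prems(2) by (auto simp: good_def)
    then have "u \<in> Bins P" using alloc_in_bins bins_subset_Bins y' by blast
    then have "u = v" using int y' by blast
    then show ?thesis using Suc.prems(5) y' y'P by force
  qed
  have disj: "reach s j u \<inter> reach s j u' = {}" if "u \<in> bins y" "u' \<in> bins y" "u \<noteq> u'" for u u'
    using that by (intro reach_disjoint[OF P1 cP1]) (auto intro: newP1 load htP1)
  let ?R = "\<lambda>u \<sigma>. \<sigma> \<in> witnesses d s X V C j u \<and> card \<sigma> = witness_size d s j \<and>
    (\<forall>(i, y, u')\<in>\<sigma>. i < d \<and> y \<in> X \<and> h i y = u' \<and> alloc y \<in> reach s j u \<and> (alloc y = u \<longrightarrow> ht y \<le> s + j))"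
  have IH: "\<exists>\<sigma>. ?R u \<sigma>" if "u \<in> bins y" for u
    using Suc.IH[OF load[OF that] P1 cP1 newP1[OF that] htP1[OF _ _ that]] by blast
  define \<rho> where "\<rho> u = (SOME \<sigma>. ?R u \<sigma>)" for u
  have \<rho>: "?R u (\<rho> u)" if "u \<in> bins y" for u
    unfolding \<rho>_def using someI_ex[OF IH[OF that]] .
  \<comment> \<open>Positivity turns the known cardinality into finiteness, since infinite sets have
    \<open>card\<close> equal to 0.\<close>
  have N0: "witness_size d s j > 0" using s d2 by (induction j) auto
  have fin\<rho>: "finite (\<rho> u)" if "u \<in> bins y" for u
    using \<rho>[OF that] N0 card_ge_0_finite by force
  \<comment> \<open>The ball \<open>y\<close> lies in \<open>v\<close> at height
    \<open>s + j + 1\<close>: too high for the subtree at \<open>v\<close>, and outside the bins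
    reached by the other subtrees.\<close>
  have y_notin: "(a, y, b) \<notin> \<rho> u" if u: "u \<in> bins y" for a b u
  proof
    assume "(a, y, b) \<in> \<rho> u"
    then have "v \<in> reach s j u" "v = u \<longrightarrow> ht y \<le> s + j" using \<rho>[OF u] y by auto
    then show False using disj[OF vy u] in_reach[of v s j] y by auto
  qed
  have \<rho>_disj: "\<rho> u \<inter> \<rho> u' = {}" if u: "u \<in> bins y" "u' \<in> bins y" "u \<noteq> u'" for u u'
  proof (rule ccontr)
    assume "\<rho> u \<inter> \<rho> u' \<noteq> {}"
    then obtain a x b where "(a, x, b) \<in> \<rho> u" "(a, x, b) \<in> \<rho> u'" by auto
    then have "alloc x \<in> reach s j u" "alloc x \<in> reach s j u'" using \<rho> u by fast+
    then show False using disj[OF u] by auto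
  qed
  define u where "u = (\<lambda>i'\<in>I. h i' y)"
  define \<tau> where "\<tau> = (\<lambda>i'\<in>I. \<rho> (h i' y))"
  have hb: "h i' y \<in> bins y" if "i' \<in> I" for i' using that by (auto simp: I_def bins_def)
  have hv: "h i' y \<noteq> v" if "i' \<in> I" for i'
    using that inj i unfolding inj_on_def I_def by auto
  let ?U = "\<Union>i'\<in>I. insert (i', y, u i') (\<tau> i')"
  define \<sigma> where "\<sigma> = insert (i, y, v) (\<rho> v \<union> ?U)"
  have mem: "\<sigma> \<in> witnesses d s X V C (Suc j) v"
  proof -
    have 1: "(i, y) \<in> {(i, y). i < d \<and> y \<in> X \<and> C i y v}" using i y C by auto
    have 2: "u \<in> Pi\<^sub>E ({..<d} - {i}) (\<lambda>i'. {b \<in> V. C i' y b})"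
      using C V y by (auto simp: u_def I_def)
    have 3: "(\<rho> v, \<tau>) \<in> witnesses d s X V C j v \<times> Pi\<^sub>E ({..<d} - {i}) (\<lambda>i'. witnesses d s X V C j (u i'))"
      using \<rho>[OF vy] \<rho> hb by (auto simp: u_def \<tau>_def I_def)
    have 4: "\<sigma> = (\<lambda>(\<sigma>, \<tau>). insert (i, y, v) (\<sigma> \<union> (\<Union>i'\<in>{..<d} - {i}. insert (i', y, u i') (\<tau> i')))) (\<rho> v, \<tau>)"
      by (simp add: \<sigma>_def I_def)
    show ?thesis
      unfolding witnesses.simps
      by (rule UN_I[OF 1], unfold prod.case, rule UN_I[OF 2], unfold 4, rule imageI[OF 3])
  qed
  have card_ins: "card (insert (i', y, u i') (\<tau> i')) = Suc (witness_size d s j)"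
    and fin_ins: "finite (insert (i', y, u i') (\<tau> i'))" if "i' \<in> I" for i'
    using that \<rho>[OF hb[OF that]] y_notin[OF hb[OF that]] fin\<rho>[OF hb[OF that]]
    by (auto simp: \<tau>_def)
  have "card ?U = (\<Sum>i'\<in>I. card (insert (i', y, u i') (\<tau> i')))"
  proof (rule card_UN_disjoint)
    show "\<forall>i'\<in>I. \<forall>i''\<in>I. i' \<noteq> i'' \<longrightarrow> insert (i', y, u i') (\<tau> i') \<inter> insert (i'', y, u i'') (\<tau> i'') = {}"
    proof (intro ballI impI)
      fix i' i'' assume I': "i' \<in> I" "i'' \<in> I" "i' \<noteq> i''"
      then have "h i' y \<noteq> h i'' y" using inj by (auto simp: inj_on_def I_def)
      then have "\<tau> i' \<inter> \<tau> i'' = {}" using \<rho>_disj[OF hb hb] I' by (auto simp: \<tau>_def)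
      then show "insert (i', y, u i') (\<tau> i') \<inter> insert (i'', y, u i'') (\<tau> i'') = {}"
        using I' y_notin[OF hb] by (auto simp: \<tau>_def)
    qed
  qed (use finI fin_ins in auto)
  also have "\<dots> = (d - 1) * Suc (witness_size d s j)" using card_ins cI by simp
  finally have cU: "card ?U = (d - 1) * Suc (witness_size d s j)" .
  have disj0: "\<rho> v \<inter> ?U = {}"
  proof -
    have "\<rho> v \<inter> insert (i', y, u i') (\<tau> i') = {}" if "i' \<in> I" for i'
      using y_notin[OF vy] \<rho>_disj[OF vy hb[OF that]] hv[OF that] that by (auto simp: \<tau>_def)
    then show ?thesis by blast
  qed
  have cUn: "card (\<rho> v \<union> ?U) = witness_size d s j + (d - 1) * Suc (witness_size d s j)"
    using disj0 cU \<rho>[OF vy] fin\<rho>[OF vy] finI fin_ins by (subst card_Un_disjoint) auto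
  have notin: "(i, y, v) \<notin> \<rho> v \<union> ?U"
    using y_notin[OF vy] y_notin[OF hb] by (auto simp: \<tau>_def I_def)
  have "card \<sigma> = Suc (witness_size d s j + (d - 1) * Suc (witness_size d s j))"
    unfolding \<sigma>_def using notin cUn fin\<rho>[OF vy] finI fin_ins by (subst card_insert_disjoint) auto
  also have "\<dots> = witness_size d s (Suc j)"
  proof -
    obtain d' where "d = Suc d'" using d2 by (cases d) auto
    then show ?thesis by simp
  qed
  finally have card: "card \<sigma> = witness_size d s (Suc j)" .
  have props: "a < d \<and> x \<in> X \<and> h a x = b \<and> alloc x \<in> reach s (Suc j) v \<and> (alloc x = v \<longrightarrow> ht x \<le> s + Suc j)"
    if ax: "(a, x, b) \<in> \<sigma>" for a x b
  proof -
    consider "x = y" "a < d" "h a x = b" | "(a, x, b) \<in> \<rho> v" | i' where "i' \<in> I" "(a, x, b) \<in> \<rho> (h i' y)"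
      using ax i by (auto simp: \<sigma>_def u_def \<tau>_def I_def)
    then show ?thesis
    proof cases
      case 1
      then show ?thesis using y in_reach[of v s "Suc j"] by simp
    next
      case 2
      then show ?thesis using \<rho>[OF vy] by force
    next
      case 3
      then have p: "a < d \<and> x \<in> X \<and> h a x = b \<and> alloc x \<in> reach s j (h i' y)"
        using \<rho>[OF hb[OF 3(1)]] by force
      moreover have "alloc x \<noteq> v"
        using p disj[OF vy hb[OF 3(1)]] hv[OF 3(1)] in_reach[of v s j] by auto
      ultimately show ?thesis using hb[OF 3(1)] hv[OF 3(1)] by (auto simp: y_def)
    qed
  qed
  show ?case
    by (rule bexI[OF _ mem]) (use card props in auto)
qed

end

context greedy_allocation
begin

text \<open>Origin of the constants: \<open>sparse\<close> limits the excess to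
  \<open>r + 1\<close>, so a set \<open>A\<close> with at most \<open>2 * D + 2\<close> balls and
  two hits of \<open>b0\<close> per unit has at most \<open>2 * r + 2\<close> balls at
  \<open>b0\<close>. Of the \<open>2 * r + 3\<close> balls there above height \<open>s + D\<close>,
  one is therefore outside \<open>A\<close>. The bound \<open>R\<close> leaves room for
  \<open>A\<close> and one more set of \<open>2 * D + 2\<close> balls. The tree is rooted at another
  bin of that ball, because \<open>b0\<close> itself may be entangled with \<open>A\<close>.\<close>

lemma overloaded_bin_has_witness:
  assumes sparse: "\<And>A. A \<subseteq> X \<Longrightarrow> card A \<le> R \<Longrightarrow> (d - 1) * card A \<le> card (Bins A) + r"
    and R: "(r + 2) * (2 * D + 2) \<le> R" and load0: "load b0 \<ge> s + D + 2 * r + 3"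
    and s: "s \<ge> 1" and C: "\<And>i x. i < d \<Longrightarrow> x \<in> X \<Longrightarrow> C i x (h i x)"
    and V: "\<And>i x. i < d \<Longrightarrow> x \<in> X \<Longrightarrow> h i x \<in> V"
  shows "\<exists>v\<in>V. \<exists>\<sigma>\<in>witnesses d s X V C D v. card \<sigma> = witness_size d s D \<and>
    (\<forall>(i, y, u)\<in>\<sigma>. i < d \<and> y \<in> X \<and> h i y = u)"
proof -
  define T where "T = 2 * D + 2"
  txt \<open>\<open>f A\<close> is the excess of \<open>A\<close> over a hypertree that contains \<open>b0\<close>. Take \<open>A\<close> of maximal excess
    among the sets having, per unit of excess, at most \<open>T\<close> balls, of which at most two hit \<open>b0\<close>. No
    few balls outside \<open>A\<close> create further excess, and \<open>b0\<close> has too many balls for all to lie in \<open>A\<close>.\<close>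
  define f where "f A = int ((d - 1) * card A) + 1 - int (card (insert b0 (Bins A)))" for A
  define inc where "inc A = card {y \<in> A. b0 \<in> bins y}" for A
  define F where "F = {A. A \<subseteq> X \<and> card A \<le> R \<and> int (card A) \<le> int T * f A \<and> int (inc A) \<le> 2 * f A}"
  have "F \<subseteq> Pow X" by (auto simp: F_def)
  then have finF: "finite F" using fin finite_subset by auto
  have "{} \<in> F" by (simp add: F_def f_def inc_def Bins_def)
  then have "Max (f ` F) \<in> f ` F" using finF by (intro Max_in) auto
  then obtain A where A: "A \<in> F" "f A = Max (f ` F)" by auto
  have maxA: "f B \<le> f A" if "B \<in> F" for B using A(2) finF that by simp
  have AX: "A \<subseteq> X" and cA: "card A \<le> R" "int (card A) \<le> int T * f A" "int (inc A) \<le> 2 * f A"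
    using A(1) by (auto simp: F_def)
  have finA: "finite A" using AX fin finite_subset by blast
  have "card (Bins A) \<le> card (insert b0 (Bins A))" using finA by (intro card_mono) (auto simp: fin_Bins)
  then have "(d - 1) * card A \<le> card (insert b0 (Bins A)) + r" using sparse[OF AX cA(1)] by linarith
  then have fA: "f A \<le> int r + 1" unfolding f_def by linarith
  have "int T * f A \<le> int T * (int r + 1)" using fA by (intro mult_left_mono) auto
  then have "int (card A) \<le> int (T * (r + 1))" using cA(2) by (simp add: algebra_simps)
  then have cAT: "card A \<le> T * (r + 1)" by linarith
  have incA: "inc A \<le> 2 * r + 2" using cA(3) fA by linarith
  define J where "J = {s + D + 1..s + D + 2 * r + 3}"
  have b: "ball_at b0 t \<in> X" "alloc (ball_at b0 t) = b0" "ht (ball_at b0 t) = t" if "t \<in> J" for t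
    using ball_at[of t b0] that load0 by (auto simp: J_def)
  have "\<exists>t\<in>J. ball_at b0 t \<notin> A"
  proof (rule ccontr)
    assume "\<not> ?thesis"
    then have "ball_at b0 ` J \<subseteq> {y \<in> A. b0 \<in> bins y}"
      using b alloc_in_bins by force
    then have "card (ball_at b0 ` J) \<le> inc A"
      unfolding inc_def using finA by (intro card_mono) auto
    moreover have "inj_on (ball_at b0) J" using b(3) by (intro inj_onI) metis
    then have "card (ball_at b0 ` J) = 2 * r + 3" by (simp add: card_image J_def)
    ultimately show False using incA by simp
  qed
  then obtain t where t: "t \<in> J" "ball_at b0 t \<notin> A" by auto
  define z where "z = ball_at b0 t"
  have z: "z \<in> X" "alloc z = b0" "ht z \<ge> s + D + 1" "z \<notin> A" "b0 \<in> bins z"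
    using b[OF t(1)] t alloc_in_bins[of z] by (auto simp: z_def J_def)
  interpret local_hypertree d h X load alloc ht A b0 z T
  proof
    fix P assume P: "P \<subseteq> X - A" "card P \<le> T" "card {y \<in> P. b0 \<in> bins y} \<le> 2"
    show "(d - 1) * card P \<le> card (Bins P - insert b0 (Bins A))"
    proof (rule ccontr)
      \<comment> \<open>Such a \<open>P\<close> would raise the excess by at least one unit, which
        pays for its balls and its hits of \<open>b0\<close>; so \<open>A \<union> P\<close> would
        lie in \<open>F\<close> and contradict maximality.\<close>
      assume less: "\<not> ?thesis"
      have finP: "finite P" using P fin finite_subset by blast
      have cAP: "card (A \<union> P) = card A + card P" using P finA finP by (intro card_Un_disjoint) auto
      have "insert b0 (Bins (A \<union> P)) = insert b0 (Bins A) \<union> (Bins P - insert b0 (Bins A))"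
        by (auto simp: Bins_Un)
      then have "card (insert b0 (Bins (A \<union> P))) = card (insert b0 (Bins A)) + card (Bins P - insert b0 (Bins A))"
        using finA finP by (simp only:) (subst card_Un_disjoint, auto simp: fin_Bins)
      then have fAP: "f (A \<union> P) = f A + (int ((d - 1) * card P) - int (card (Bins P - insert b0 (Bins A))))"
        by (simp add: f_def cAP algebra_simps)
      then have f1: "f (A \<union> P) \<ge> f A + 1" using less by linarith
      have "{y \<in> A \<union> P. b0 \<in> bins y} = {y \<in> A. b0 \<in> bins y} \<union> {y \<in> P. b0 \<in> bins y}" by auto
      then have "inc (A \<union> P) \<le> inc A + 2"
        unfolding inc_def using P(3) card_Un_le[of "{y \<in> A. b0 \<in> bins y}" "{y \<in> P. b0 \<in> bins y}"] by simp
      then have 1: "int (inc (A \<union> P)) \<le> 2 * f (A \<union> P)" using cA(3) f1 by linarith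
      have "int (card (A \<union> P)) \<le> int T * (f A + 1)" using cAP P(2) cA(2) by (simp add: algebra_simps)
      also have "\<dots> \<le> int T * f (A \<union> P)" using f1 by (intro mult_left_mono) auto
      finally have 2: "int (card (A \<union> P)) \<le> int T * f (A \<union> P)" .
      have "card (A \<union> P) \<le> (r + 2) * T" using cAP cAT P(2) by (simp add: algebra_simps)
      then have 3: "card (A \<union> P) \<le> R" using R by (simp add: T_def)
      have "A \<union> P \<in> F" using 1 2 3 AX P(1) by (auto simp: F_def)
      then show False using maxA f1 by fastforce
    qed
  qed
  \<comment> \<open>Applied to \<open>z\<close> alone, the expansion shows that its
    \<open>d - 1\<close> bins other than \<open>b0\<close> are all new; any of them can be the
    root.\<close>
  have "(d - 1) * card {z} \<le> card (Bins {z} - insert b0 (Bins A))"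
    using z T_def by (intro expand) (auto intro: order_trans[OF card_mono[of "{z}"]])
  then have ge: "d - 1 \<le> card (new {z})" by (simp add: new_def)
  have "new {z} \<subseteq> bins z - {b0}" by (auto simp: new_def Bins_def)
  then have "card (new {z}) \<le> card (bins z - {b0})" using fin_bins by (intro card_mono) auto
  also have "\<dots> \<le> d - 1" using z card_bins[of z] fin_bins by simp
  finally have good: "good {z}" using ge z by (auto simp: good_def)
  have "new {z} \<noteq> {}" using ge d2 by auto
  then obtain v where v: "v \<in> new {z}" by auto
  then have vz: "v \<in> bins z" "v \<noteq> b0" by (auto simp: new_def Bins_def)
  have "load v \<ge> s + D" using load_bins[OF z(1) vz(1)] z(3) by simp
  then have "\<exists>\<sigma>\<in>witnesses d s X V C D v. card \<sigma> = witness_size d s D \<and>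
    (\<forall>(i, y, u)\<in>\<sigma>. i < d \<and> y \<in> X \<and> h i y = u \<and> alloc y \<in> reach s D v \<and> (alloc y = v \<longrightarrow> ht y \<le> s + D))"
    using good v z vz s by (intro witness_exists C V) (auto simp: T_def)
  moreover have "v \<in> V" using vz V z by (auto simp: bins_def)
  ultimately show ?thesis by fastforce
qed

end

section \<open>Union bounds\<close>

text \<open>For a fixed root. \<open>P\<close> stands for the number of pairs (hash index, ball)
  compatible with a bin, \<open>q\<close> for the number of bins compatible with such a
  pair.\<close>

primrec witness_count :: "nat \<Rightarrow> nat \<Rightarrow> nat \<Rightarrow> nat \<Rightarrow> nat \<Rightarrow> nat" where
  "witness_count P q d s 0 = P choose s"
| "witness_count P q d s (Suc j) = P * q ^ (d - 1) * witness_count P q d s j ^ d"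

lemma card_witnesses:
  assumes fin: "finite X" "finite V" and d: "d \<ge> 1"
    and P: "\<And>v. v \<in> V \<Longrightarrow> card {(i, y). i < d \<and> y \<in> X \<and> C i y v} \<le> P"
    and q: "\<And>i y. i < d \<Longrightarrow> y \<in> X \<Longrightarrow> card {b \<in> V. C i y b} \<le> q"
    and v: "v \<in> V"
  shows "finite (witnesses d s X V C j v) \<and> card (witnesses d s X V C j v) \<le> witness_count P q d s j"
  using v
proof (induction j arbitrary: v)
  case 0
  let ?B = "{(i, y, u). i < d \<and> y \<in> X \<and> C i y v \<and> u = v}"
  let ?B' = "{(i, y). i < d \<and> y \<in> X \<and> C i y v}"
  have eq: "?B = (\<lambda>(i, y). (i, y, v)) ` ?B'" by auto
  have "?B' \<subseteq> {..<d} \<times> X" by auto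
  then have finB': "finite ?B'" using fin finite_subset by blast
  have "card ?B \<le> card ?B'" unfolding eq by (rule card_image_le[OF finB'])
  then have cB: "card ?B \<le> P" using P[OF 0] by linarith
  have finB: "finite ?B" unfolding eq using finB' by (rule finite_imageI)
  have "witnesses d s X V C 0 v = {\<sigma>. \<sigma> \<subseteq> ?B \<and> card \<sigma> = s}" by simp
  moreover have "finite {\<sigma>. \<sigma> \<subseteq> ?B \<and> card \<sigma> = s}" using finB by simp
  moreover have "card {\<sigma>. \<sigma> \<subseteq> ?B \<and> card \<sigma> = s} = card ?B choose s"
    by (rule n_subsets[OF finB])
  ultimately show ?case using binomial_right_mono[OF cB, of s] by simp
next
  case (Suc j)
  let ?W = "witnesses d s X V C j" and ?c = "witness_count P q d s j"
  let ?B = "{(i, y). i < d \<and> y \<in> X \<and> C i y v}"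
  let ?I = "\<lambda>i. {..<d} - {i}"
  let ?U = "\<lambda>i y. Pi\<^sub>E (?I i) (\<lambda>i'. {b \<in> V. C i' y b})"
  let ?D = "\<lambda>i u. ?W v \<times> Pi\<^sub>E (?I i) (\<lambda>i'. ?W (u i'))"
  let ?f = "\<lambda>i y u (\<sigma>, \<tau>). insert (i, y, v) (\<sigma> \<union> (\<Union>i'\<in>?I i. insert (i', y, u i') (\<tau> i')))"
  have W: "witnesses d s X V C (Suc j) v = (\<Union>(i, y)\<in>?B. \<Union>u\<in>?U i y. ?f i y u ` ?D i u)"
    by simp
  have "?B \<subseteq> {..<d} \<times> X" by auto
  then have finB: "finite ?B" using fin finite_subset by blast
  have finU: "finite (?U i y)" for i y using fin by (intro finite_PiE) auto
  have cI: "card (?I i) = d - 1" if "i < d" for i using that by simp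
  have cU: "card (?U i y) \<le> q ^ (d - 1)" if "i < d" "y \<in> X" for i y
  proof -
    have "card (?U i y) = (\<Prod>i'\<in>?I i. card {b \<in> V. C i' y b})" by (simp add: card_PiE)
    also have "\<dots> \<le> (\<Prod>i'\<in>?I i. q)" using that by (intro prod_mono) (auto intro: q)
    finally show ?thesis using cI[OF that(1)] by simp
  qed
  have D: "finite (?D i u) \<and> card (?D i u) \<le> ?c ^ d" if "i < d" "u \<in> ?U i y" for i u y
  proof -
    have uV: "u i' \<in> V" if "i' \<in> ?I i" for i' using that \<open>u \<in> ?U i y\<close> by (auto simp: PiE_def Pi_def)
    have "card (Pi\<^sub>E (?I i) (\<lambda>i'. ?W (u i'))) = (\<Prod>i'\<in>?I i. card (?W (u i')))" by (simp add: card_PiE)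
    also have "\<dots> \<le> (\<Prod>i'\<in>?I i. ?c)" using Suc.IH uV by (intro prod_mono) auto
    also have "\<dots> = ?c ^ (d - 1)" using cI[OF that(1)] by simp
    finally have "card (?D i u) \<le> ?c * ?c ^ (d - 1)"
      using Suc.IH[OF Suc.prems] by (simp add: card_cartesian_product mult_mono)
    moreover have "finite (?D i u)"
      using Suc.IH[OF Suc.prems] Suc.IH uV by (intro finite_cartesian_product finite_PiE) auto
    ultimately show ?thesis using d by (simp add: power_eq_if)
  qed
  have inner: "finite (\<Union>u\<in>?U i y. ?f i y u ` ?D i u) \<and> card (\<Union>u\<in>?U i y. ?f i y u ` ?D i u) \<le> q ^ (d - 1) * ?c ^ d"
    if iy: "i < d" "y \<in> X" for i y
  proof
    show "finite (\<Union>u\<in>?U i y. ?f i y u ` ?D i u)"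
      by (intro finite_UN_I finU finite_imageI) (use D[OF iy(1)] in blast)
    have "card (\<Union>u\<in>?U i y. ?f i y u ` ?D i u) \<le> (\<Sum>u\<in>?U i y. card (?f i y u ` ?D i u))"
      by (rule card_UN_le[OF finU])
    also have "\<dots> \<le> (\<Sum>u\<in>?U i y. ?c ^ d)"
    proof (rule sum_mono)
      fix u assume "u \<in> ?U i y"
      then have "finite (?D i u)" "card (?D i u) \<le> ?c ^ d" using D[OF iy(1)] by blast+
      then show "card (?f i y u ` ?D i u) \<le> ?c ^ d" using card_image_le le_trans by blast
    qed
    also have "\<dots> \<le> q ^ (d - 1) * ?c ^ d" using cU[OF iy] by simp
    finally show "card (\<Union>u\<in>?U i y. ?f i y u ` ?D i u) \<le> q ^ (d - 1) * ?c ^ d" .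
  qed
  show ?case
  proof
    show "finite (witnesses d s X V C (Suc j) v)"
      unfolding W using inner by (intro finite_UN_I finB) auto
    have "card (witnesses d s X V C (Suc j) v) \<le> (\<Sum>(i, y)\<in>?B. card (\<Union>u\<in>?U i y. ?f i y u ` ?D i u))"
      unfolding W using card_UN_le[OF finB, of "\<lambda>(i, y). \<Union>u\<in>?U i y. ?f i y u ` ?D i u"]
      by (simp add: case_prod_unfold)
    also have "\<dots> \<le> (\<Sum>(i, y)\<in>?B. q ^ (d - 1) * ?c ^ d)"
      using inner by (intro sum_mono) auto
    also have "\<dots> = card ?B * (q ^ (d - 1) * ?c ^ d)" by (simp add: case_prod_unfold)
    also have "\<dots> \<le> P * (q ^ (d - 1) * ?c ^ d)" using P[OF Suc.prems] by (rule mult_right_mono) simp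
    finally show "card (witnesses d s X V C (Suc j) v) \<le> witness_count P q d s (Suc j)"
      by (simp add: mult.assoc)
  qed
qed

text \<open>The power of \<open>q\<close> is of the form that cancels against the probability that
  all constraints hold. What survives is one factor \<open>\<kappa> ^ (s + 1) / fact s\<close> for
  each of the \<open>d ^ j\<close> leaves.\<close>

lemma witness_count_bound:
  assumes q: "q \<ge> 1" and d: "d \<ge> 2" and \<kappa>: "\<kappa> \<ge> (1::real)" "real P \<le> \<kappa> * real q"
  shows "real (witness_count P q d s j) \<le> real q ^ witness_size d s j * (\<kappa> ^ (s + 1) / fact s) ^ (d ^ j)"
proof -
  let ?\<eta> = "\<kappa> ^ (s + 1) / fact s"
  \<comment> \<open>The induction carries an extra \<open>\<kappa>\<close>: a step produces
    \<open>\<kappa> ^ 2\<close>, which is at most the \<open>\<kappa> ^ d\<close> supplied by the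
    \<open>d\<close> subtrees. This is why a leaf has exponent \<open>s + 1\<close>.\<close>
  have "\<kappa> * real (witness_count P q d s j) \<le> real q ^ witness_size d s j * ?\<eta> ^ (d ^ j)"
  proof (induction j)
    case 0
    have "real (P choose s) * fact s \<le> real P ^ s"
      using binomial_fact_pow[of P s] by (metis of_nat_fact of_nat_le_iff of_nat_mult of_nat_power)
    also have "\<dots> \<le> (\<kappa> * real q) ^ s" using \<kappa> by (intro power_mono) auto
    finally have "real (P choose s) \<le> (\<kappa> * real q) ^ s / fact s" by (simp add: field_simps)
    then have "\<kappa> * real (P choose s) \<le> \<kappa> * ((\<kappa> * real q) ^ s / fact s)"
      using \<kappa> by (intro mult_left_mono) auto
    then show ?case by (simp add: power_mult_distrib mult_ac)
  next
    case (Suc j)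
    let ?c = "real (witness_count P q d s j)" and ?N = "witness_size d s j"
    obtain d' where d': "d = Suc (Suc d')" using d by (metis add_2_eq_Suc le_Suc_ex)
    have "\<kappa> * real (witness_count P q d s (Suc j)) = \<kappa> * (real P * real q ^ (d - 1) * ?c ^ d)" by simp
    also have "\<dots> \<le> \<kappa> * ((\<kappa> * real q) * real q ^ (d - 1) * ?c ^ d)"
      using \<kappa> by (intro mult_left_mono mult_right_mono) auto
    also have "\<dots> = \<kappa> ^ 2 * real q ^ d * ?c ^ d" by (simp add: d' power2_eq_square)
    also have "\<dots> \<le> \<kappa> ^ d * real q ^ d * ?c ^ d"
      using \<kappa> d by (intro mult_right_mono power_increasing) auto
    also have "\<dots> = real q ^ d * (\<kappa> * ?c) ^ d" by (simp add: power_mult_distrib)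
    also have "\<dots> \<le> real q ^ d * (real q ^ ?N * ?\<eta> ^ (d ^ j)) ^ d"
      using Suc \<kappa> by (intro mult_left_mono power_mono) auto
    also have "\<dots> = real q ^ witness_size d s (Suc j) * ?\<eta> ^ (d ^ Suc j)"
      by (simp add: power_mult_distrib power_add flip: power_mult) (simp add: mult.commute)
    finally show ?case .
  qed
  moreover have "real (witness_count P q d s j) \<le> \<kappa> * real (witness_count P q d s j)"
    using \<kappa> by (simp add: mult_le_cancel_right1)
  ultimately show ?thesis by linarith
qed

text \<open>The summand 2 makes the recursion multiplicative:
  \<open>d * N + d + 2 \<le> d * (N + 2)\<close> for \<open>d \<ge> 2\<close>.\<close>

lemma witness_size_bound:
  assumes "d \<ge> 2"
  shows "witness_size d s j + 2 \<le> (s + 2) * d ^ j"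
proof (induction j)
  case (Suc j)
  have "witness_size d s (Suc j) + 2 \<le> d * (witness_size d s j + 2)"
    using assms by simp
  also have "\<dots> \<le> d * ((s + 2) * d ^ j)" by (intro mult_left_mono Suc) simp
  finally show ?case by (simp add: mult_ac)
qed simp

text \<open>The constraints are split by hash index, and independence multiplies the
  \<open>d\<close> bounds, hence \<open>\<gamma> ^ d\<close>. Constraints that send one ball to two
  bins under the same index describe the empty event.\<close>

lemma realised_prob:
  fixes p :: "nat \<Rightarrow> ('a \<Rightarrow> 'b) pmf" and \<gamma> \<beta> :: real
  assumes \<sigma>: "finite \<sigma>" "card \<sigma> \<le> w" "\<And>i y u. (i, y, u) \<in> \<sigma> \<Longrightarrow> i < d \<and> y \<in> X"
    and p: "\<And>i B f. i < d \<Longrightarrow> B \<subseteq> X \<Longrightarrow> card B \<le> w \<Longrightarrow> prob (p i) {g. \<forall>y\<in>B. g y = f y} \<le> \<gamma> * \<beta> ^ card B"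
    and \<gamma>: "\<gamma> \<ge> 0" "\<beta> \<ge> 0"
  shows "prob (Pi_pmf {..<d} dflt p) {h. \<forall>(i, y, u)\<in>\<sigma>. h i y = u} \<le> \<gamma> ^ d * \<beta> ^ card \<sigma>"
proof -
  define S where "S i = {(y, u). (i, y, u) \<in> \<sigma>}" for i
  have S_eq: "S i = snd ` {e \<in> \<sigma>. fst e = i}" for i by (force simp: S_def)
  have finS: "finite (S i)" for i unfolding S_eq using \<sigma> by simp
  have inj: "inj_on snd {e \<in> \<sigma>. fst e = i}" for i by (auto simp: inj_on_def)
  have cS: "card (S i) = card {e \<in> \<sigma>. fst e = i}" for i unfolding S_eq by (rule card_image[OF inj])
  have "\<sigma> = (\<Union>i<d. {e \<in> \<sigma>. fst e = i})" using \<sigma>(3) by fastforce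
  then have "card \<sigma> = card (\<Union>i<d. {e \<in> \<sigma>. fst e = i})" by simp
  also have "\<dots> = (\<Sum>i<d. card (S i))"
    unfolding cS using \<sigma>(1) by (intro card_UN_disjoint) auto
  finally have card: "card \<sigma> = (\<Sum>i<d. card (S i))" .
  have single: "prob (p i) {g. \<forall>(y, u)\<in>S i. g y = u} \<le> \<gamma> * \<beta> ^ card (S i)" if i: "i < d" for i
  proof (cases "inj_on fst (S i)")
    case True
    define f where "f y = (THE u. (y, u) \<in> S i)" for y
    have f: "f y = u" if "(y, u) \<in> S i" for y u
      unfolding f_def
    proof (rule the_equality)
      show "(y, u) \<in> S i" by (rule that)
      fix u' assume "(y, u') \<in> S i"
      then have "(y, u') = (y, u)" using that by (intro inj_onD[OF True]) auto
      then show "u' = u" by simp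
    qed
    have cB: "card (fst ` S i) = card (S i)" by (rule card_image[OF True])
    have "card (S i) \<le> card \<sigma>" unfolding cS using \<sigma>(1) by (intro card_mono) auto
    then have le: "card (fst ` S i) \<le> w" using \<sigma>(2) cB by simp
    have "{g. \<forall>(y, u)\<in>S i. g y = u} = {g. \<forall>y\<in>fst ` S i. g y = f y}"
      using f by (fastforce simp: image_iff)
    moreover have "fst ` S i \<subseteq> X" using \<sigma>(3) by (auto simp: S_def)
    ultimately show ?thesis using p[OF i _ le, of f] cB by simp
  next
    case False
    then obtain a b where ab: "a \<in> S i" "b \<in> S i" "fst a = fst b" "a \<noteq> b"
      unfolding inj_on_def by blast
    have "\<not> (\<forall>(y, u)\<in>S i. g y = u)" for g
    proof
      assume g: "\<forall>(y, u)\<in>S i. g y = u"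
      then have "g (fst a) = snd a" "g (fst b) = snd b" using ab(1,2) by (auto simp: case_prod_unfold)
      then show False using ab(3,4) by (simp add: prod_eq_iff)
    qed
    then have empty: "{g. \<forall>(y, u)\<in>S i. g y = u} = {}" by blast
    show ?thesis unfolding empty using \<gamma> by simp
  qed
  have "{h. \<forall>(i, y, u)\<in>\<sigma>. h i y = u} = Pi {..<d} (\<lambda>i. {g. \<forall>(y, u)\<in>S i. g y = u})"
  proof (intro set_eqI iffI)
    fix h assume "h \<in> {h. \<forall>(i, y, u)\<in>\<sigma>. h i y = u}"
    then show "h \<in> Pi {..<d} (\<lambda>i. {g. \<forall>(y, u)\<in>S i. g y = u})" by (auto simp: S_def)
  next
    fix h assume h: "h \<in> Pi {..<d} (\<lambda>i. {g. \<forall>(y, u)\<in>S i. g y = u})"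
    have "h i y = u" if "(i, y, u) \<in> \<sigma>" for i y u
    proof -
      have "h i \<in> {g. \<forall>(y, u)\<in>S i. g y = u}" using h \<sigma>(3)[OF that] by auto
      then show ?thesis using that by (auto simp: S_def)
    qed
    then show "h \<in> {h. \<forall>(i, y, u)\<in>\<sigma>. h i y = u}" by auto
  qed
  then have "prob (Pi_pmf {..<d} dflt p) {h. \<forall>(i, y, u)\<in>\<sigma>. h i y = u}
      = (\<Prod>i<d. prob (p i) {g. \<forall>(y, u)\<in>S i. g y = u})"
    by (simp add: measure_Pi_pmf_Pi)
  also have "\<dots> \<le> (\<Prod>i<d. \<gamma> * \<beta> ^ card (S i))"
    using single by (intro prod_mono) auto
  also have "\<dots> = \<gamma> ^ d * \<beta> ^ card \<sigma>"
    by (simp add: prod.distrib card power_sum)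
  finally show ?thesis .
qed

text \<open>A list of \<open>q\<close> values of \<open>V\<close> is chosen first, padded with a
  repeated value if fewer occur, and then a function into that list.\<close>

lemma card_functions_few_values:
  assumes fin: "finite Y" "finite V" and ne: "Y \<noteq> {}"
  shows "card {F \<in> Y \<rightarrow>\<^sub>E V. card (F ` Y) \<le> q} \<le> card V ^ q * q ^ card Y"
proof -
  let ?L = "{l. set l \<subseteq> V \<and> length l = q}"
  have sub: "{F \<in> Y \<rightarrow>\<^sub>E V. card (F ` Y) \<le> q} \<subseteq> (\<Union>l\<in>?L. Y \<rightarrow>\<^sub>E set l)"
  proof
    fix F assume F: "F \<in> {F \<in> Y \<rightarrow>\<^sub>E V. card (F ` Y) \<le> q}"
    obtain l0 where l0: "set l0 = F ` Y" "distinct l0" using finite_distinct_list[of "F ` Y"] fin(1) by auto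
    then have len: "length l0 \<le> q" using F distinct_card[OF l0(2)] by simp
    obtain y where y: "y \<in> Y" using ne by auto
    let ?l = "l0 @ replicate (q - length l0) (F y)"
    have "?l \<in> ?L" using F len l0 y by auto
    moreover have "F \<in> Y \<rightarrow>\<^sub>E set ?l" using F l0 y by (auto simp: PiE_def Pi_def)
    ultimately show "F \<in> (\<Union>l\<in>?L. Y \<rightarrow>\<^sub>E set l)" by blast
  qed
  have finL: "finite ?L" using finite_lists_length_eq[OF fin(2)] .
  have "card {F \<in> Y \<rightarrow>\<^sub>E V. card (F ` Y) \<le> q} \<le> card (\<Union>l\<in>?L. Y \<rightarrow>\<^sub>E set l)"
    using finL fin by (intro card_mono[OF _ sub] finite_UN_I finite_PiE) auto
  also have "\<dots> \<le> (\<Sum>l\<in>?L. card (Y \<rightarrow>\<^sub>E set l))" by (rule card_UN_le[OF finL])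
  also have "\<dots> \<le> (\<Sum>l\<in>?L. q ^ card Y)"
    using fin card_length by (intro sum_mono) (auto simp: card_PiE intro!: power_mono)
  also have "\<dots> = card V ^ q * q ^ card Y"
    using card_lists_length_eq[OF fin(2)] by simp
  finally show ?thesis .
qed

text \<open>The \<open>d * card A\<close> hash values would take at most
  \<open>q = (d - 1) * card A - r - 1\<close> values. There are about \<open>n ^ q\<close> choices
  for these, with \<open>n = card V\<close>, against probability \<open>n ^ (- d * card A)\<close>
  for each pattern.\<close>

lemma crowded_set_prob:
  fixes p :: "nat \<Rightarrow> ('a \<Rightarrow> 'b) pmf"
  assumes finA: "finite A" and V: "finite V" "card V > 0"
    and supp: "\<And>i g y. i < d \<Longrightarrow> g \<in> set_pmf (p i) \<Longrightarrow> y \<in> A \<Longrightarrow> g y \<in> V"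
    and p: "\<And>i f. i < d \<Longrightarrow> prob (p i) {g. \<forall>y\<in>A. g y = f y} \<le> 1 / real (card V) ^ card A"
  shows "prob (Pi_pmf {..<d} dflt p)
      {h. card (\<Union>y\<in>A. (\<lambda>i. h i y) ` {..<d}) + r < (d - 1) * card A}
    \<le> real (d * card A) ^ (d * card A) / real (card V) ^ (card A + r + 1)"
    (is "prob ?M ?S \<le> _")
proof (cases "(d - 1) * card A > r")
  case False
  then have "?S = {}" by auto
  then have "prob ?M ?S = 0" by simp
  then show ?thesis by (metis divide_nonneg_nonneg of_nat_0_le_iff zero_le_power)
next
  case True
  let ?Y = "{..<d} \<times> A" and ?t = "card A" and ?n = "card V"
  define q where "q = (d - 1) * ?t - r - 1"
  have d0: "d \<ge> 1" using True by (cases d) auto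
  have q: "q + (?t + r + 1) = d * ?t" using True d0 by (cases d) (auto simp: q_def)
  have cY: "card ?Y = d * ?t" by (simp add: card_cartesian_product)
  have ne: "?Y \<noteq> {}" using True d0 by (auto simp: lessThan_empty_iff)
  let ?Fam = "{F \<in> ?Y \<rightarrow>\<^sub>E V. card (F ` ?Y) \<le> q}"
  let ?ev = "\<lambda>F. {h. \<forall>i<d. \<forall>y\<in>A. h i y = F (i, y)}"
  have finFam: "finite ?Fam" using finA V by (auto intro!: finite_subset[of ?Fam "?Y \<rightarrow>\<^sub>E V"] finite_PiE)
  have "prob ?M ?S = prob ?M (?S \<inter> set_pmf ?M)"
    by (rule measure_Int_set_pmf[symmetric])
  also have "\<dots> \<le> prob ?M (\<Union>F\<in>?Fam. ?ev F)"
  proof (rule measure_pmf.finite_measure_mono; safe?)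
    fix h assume h: "card (\<Union>y\<in>A. (\<lambda>i. h i y) ` {..<d}) + r < (d - 1) * card A" and hM: "h \<in> set_pmf ?M"
    define F where "F = (\<lambda>(i, y)\<in>?Y. h i y)"
    have hp: "h i \<in> set_pmf (p i)" if "i < d" for i
      using hM that by (simp add: set_Pi_pmf PiE_dflt_def)
    have img: "F ` ?Y = (\<Union>y\<in>A. (\<lambda>i. h i y) ` {..<d})" by (force simp: F_def)
    have "card (F ` ?Y) \<le> q" using h unfolding img q_def by linarith
    moreover have "F \<in> ?Y \<rightarrow>\<^sub>E V" using hp supp by (auto simp: F_def)
    ultimately have "F \<in> ?Fam" by simp
    moreover have "h \<in> ?ev F" by (auto simp: F_def)
    ultimately show "h \<in> (\<Union>F\<in>?Fam. ?ev F)" by blast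
  qed auto
  also have "\<dots> \<le> (\<Sum>F\<in>?Fam. prob ?M (?ev F))"
    by (intro measure_pmf.finite_measure_subadditive_finite finFam) auto
  also have "\<dots> \<le> (\<Sum>F\<in>?Fam. 1 / real ?n ^ (d * ?t))"
  proof (rule sum_mono)
    fix F :: "nat \<times> 'a \<Rightarrow> 'b"
    have "?ev F = Pi {..<d} (\<lambda>i. {g. \<forall>y\<in>A. g y = F (i, y)})" by (auto simp: Pi_def)
    then have "prob ?M (?ev F) = (\<Prod>i<d. prob (p i) {g. \<forall>y\<in>A. g y = F (i, y)})"
      by (simp add: measure_Pi_pmf_Pi)
    also have "\<dots> \<le> (\<Prod>i<d. 1 / real ?n ^ ?t)" using p by (intro prod_mono) auto
    also have "\<dots> = 1 / real ?n ^ (d * ?t)" by (simp add: power_divide mult.commute flip: power_mult)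
    finally show "prob ?M (?ev F) \<le> 1 / real ?n ^ (d * ?t)" .
  qed
  also have "\<dots> = real (card ?Fam) / real ?n ^ (d * ?t)" by simp
  also have "\<dots> \<le> real (?n ^ q * q ^ (d * ?t)) / real ?n ^ (d * ?t)"
    using card_functions_few_values[of ?Y V q] finA V ne cY
    by (intro divide_right_mono) (auto simp del: of_nat_mult of_nat_power)
  also have "\<dots> = real q ^ (d * ?t) / real ?n ^ (?t + r + 1)"
    unfolding q[symmetric] using V by (simp add: power_add field_simps)
  also have "\<dots> \<le> real (d * ?t) ^ (d * ?t) / real ?n ^ (?t + r + 1)"
  proof (intro divide_right_mono power_mono)
    have "q \<le> d * ?t" using q by linarith
    then show "real q \<le> real (d * ?t)" by (simp only: of_nat_le_iff)
  qed auto
  finally show ?thesis .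
qed

text \<open>Of the \<open>n ^ (t + r + 1)\<close> in the bound for a set of \<open>t\<close> balls,
  \<open>n ^ t\<close> pays for choosing the set and \<open>n ^ (r + 1)\<close> remains. The
  leftover factor grows like \<open>R ^ O(R)\<close>, which is small for
  \<open>R = O(log log n)\<close>.\<close>

lemma crowded_prob:
  fixes p :: "nat \<Rightarrow> ('a \<Rightarrow> 'b) pmf" and \<rho> :: real
  assumes finX: "finite X" and V: "finite V" "card V > 0" and d: "d \<ge> 1" and R: "R \<ge> 1"
    and supp: "\<And>i g y. i < d \<Longrightarrow> g \<in> set_pmf (p i) \<Longrightarrow> y \<in> X \<Longrightarrow> g y \<in> V"
    and p: "\<And>i A f. i < d \<Longrightarrow> A \<subseteq> X \<Longrightarrow> card A \<le> R \<Longrightarrow>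
      prob (p i) {g. \<forall>y\<in>A. g y = f y} \<le> 1 / real (card V) ^ card A"
    and \<rho>: "\<rho> \<ge> 1" "real (card X) \<le> \<rho> * real (card V)"
  shows "prob (Pi_pmf {..<d} dflt p)
      {h. \<exists>A\<subseteq>X. card A \<le> R \<and> card (\<Union>y\<in>A. (\<lambda>i. h i y) ` {..<d}) + r < (d - 1) * card A}
    \<le> (real R + 1) * (\<rho> * real (d * R) ^ d) ^ R / real (card V) ^ (r + 1)"
    (is "prob ?M ?S \<le> _")
proof -
  let ?n = "real (card V)"
  let ?ev = "\<lambda>A. {h. card (\<Union>y\<in>A. (\<lambda>i. h i y) ` {..<d}) + r < (d - 1) * card A}"
  let ?sub = "\<lambda>t. {A. A \<subseteq> X \<and> card A = t}"
  have finsub: "finite (?sub t)" for t using finX by simp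
  have "?S \<subseteq> (\<Union>t\<le>R. \<Union>A\<in>?sub t. ?ev A)" by auto
  then have "prob ?M ?S \<le> prob ?M (\<Union>t\<le>R. \<Union>A\<in>?sub t. ?ev A)"
    by (intro measure_pmf.finite_measure_mono) auto
  also have "\<dots> \<le> (\<Sum>t\<le>R. prob ?M (\<Union>A\<in>?sub t. ?ev A))"
    by (intro measure_pmf.finite_measure_subadditive_finite) auto
  also have "\<dots> \<le> (\<Sum>t\<le>R. (\<rho> * real (d * R) ^ d) ^ R / ?n ^ (r + 1))"
  proof (rule sum_mono)
    fix t assume "t \<in> {..R}"
    then have t: "t \<le> R" by simp
    have "prob ?M (\<Union>A\<in>?sub t. ?ev A) \<le> (\<Sum>A\<in>?sub t. prob ?M (?ev A))"
      by (intro measure_pmf.finite_measure_subadditive_finite finsub) auto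
    also have "\<dots> \<le> (\<Sum>A\<in>?sub t. real (d * t) ^ (d * t) / ?n ^ (t + r + 1))"
    proof (rule sum_mono)
      fix A assume A: "A \<in> ?sub t"
      then have "finite A" using finX finite_subset by auto
      then show "prob ?M (?ev A) \<le> real (d * t) ^ (d * t) / ?n ^ (t + r + 1)"
        using crowded_set_prob[of A V d p dflt r] A V supp p t by blast
    qed
    also have "\<dots> = real (card X choose t) * (real (d * t) ^ (d * t) / ?n ^ (t + r + 1))"
      using n_subsets[OF finX, of t] by simp
    also have "\<dots> \<le> real (card X) ^ t * (real (d * R) ^ (d * t) / ?n ^ (t + r + 1))"
    proof (intro mult_mono divide_right_mono power_mono)
      show "real (card X choose t) \<le> real (card X) ^ t"
        using binomial_le_pow[of t "card X"]
        by (cases "t \<le> card X") (auto simp: binomial_eq_0 simp flip: of_nat_power)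
      show "real (d * t) \<le> real (d * R)" using t by (simp add: mult_left_mono)
    qed auto
    also have "\<dots> \<le> (\<rho> * ?n) ^ t * (real (d * R) ^ (d * t) / ?n ^ (t + r + 1))"
      using \<rho> by (intro mult_right_mono power_mono) auto
    also have "\<dots> = (\<rho> * real (d * R) ^ d) ^ t / ?n ^ (r + 1)"
    proof -
      have "?n ^ (t + r + 1) = ?n ^ t * ?n ^ (r + 1)" by (simp add: power_add)
      then show ?thesis
        using V by (simp only: power_mult power_mult_distrib) simp
    qed
    also have "\<dots> \<le> (\<rho> * real (d * R) ^ d) ^ R / ?n ^ (r + 1)"
    proof (intro divide_right_mono power_increasing t)
      have "1 * 1 \<le> \<rho> * real (d * R) ^ d" using \<rho> d R by (intro mult_mono one_le_power) (auto simp flip: of_nat_mult)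
      then show "1 \<le> \<rho> * real (d * R) ^ d" by simp
    qed auto
    finally show "prob ?M (\<Union>A\<in>?sub t. ?ev A) \<le> (\<rho> * real (d * R) ^ d) ^ R / ?n ^ (r + 1)" .
  qed
  also have "\<dots> = (real R + 1) * (\<rho> * real (d * R) ^ d) ^ R / ?n ^ (r + 1)" by simp
  finally show ?thesis .
qed

section \<open>Existence of biased and independent distributions\<close>

text \<open>The indices of the non-trivial characters whose support has at most \<open>w\<close>
  balls.\<close>

definition small_sets :: "nat \<Rightarrow> nat \<Rightarrow> 'a set \<Rightarrow> ('a \<times> nat) set set" where
  "small_sets w l U = {S. S \<subseteq> U \<times> {..<l} \<and> S \<noteq> {} \<and> card (fst ` S) \<le> w}"

lemma finite_small_sets:
  assumes "finite U"
  shows "finite (small_sets w l U)"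
proof (rule finite_subset)
  show "small_sets w l U \<subseteq> Pow (U \<times> {..<l})" by (auto simp: small_sets_def)
qed (use assms in simp)

text \<open>Such a set is a union of \<open>w\<close> pieces, each either empty or a ball together
  with a set of bits; this gives the base \<open>card U * 2 ^ l + 1\<close>.\<close>

lemma card_small_sets:
  assumes fin: "finite U"
  shows "card (small_sets w l U) \<le> (card U * 2 ^ l + 1) ^ w"
proof -
  define Z where "Z = insert {} ((\<lambda>(u, T). {u} \<times> T) ` (U \<times> Pow {..<l}))"
  have finZ: "finite Z" using fin by (simp add: Z_def)
  have "card Z \<le> Suc (card ((\<lambda>(u, T). {u} \<times> T) ` (U \<times> Pow {..<l})))"
    unfolding Z_def by (rule card_insert_le_m1) auto
  also have "\<dots> \<le> Suc (card (U \<times> Pow {..<l}))"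
    using fin by (intro Suc_le_mono[THEN iffD2] card_image_le) auto
  also have "\<dots> = card U * 2 ^ l + 1" by (simp add: card_cartesian_product card_Pow)
  finally have cZ: "card Z \<le> card U * 2 ^ l + 1" .
  let ?L = "{xs. set xs \<subseteq> Z \<and> length xs = w}"
  have finL: "finite ?L" using finite_lists_length_eq[OF finZ] .
  have "small_sets w l U \<subseteq> (\<lambda>xs. \<Union> (set xs)) ` ?L"
  proof
    fix S assume "S \<in> small_sets w l U"
    then have S: "S \<subseteq> U \<times> {..<l}" "card (fst ` S) \<le> w" by (auto simp: small_sets_def)
    have "finite S" using S(1) fin finite_subset by blast
    then obtain us where us: "set us = fst ` S" "distinct us"
      using finite_distinct_list[of "fst ` S"] by auto
    have len: "length us \<le> w" using distinct_card[OF us(2)] us(1) S(2) by simp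
    define part where "part u = {u} \<times> {b. (u, b) \<in> S}" for u
    let ?xs = "map part us @ replicate (w - length us) {}"
    have part: "part u \<in> Z" if "u \<in> fst ` S" for u
    proof -
      have "(u, {b. (u, b) \<in> S}) \<in> U \<times> Pow {..<l}" using that S(1) by auto
      then show ?thesis unfolding Z_def part_def by (intro insertI2 image_eqI[rotated]) auto
    qed
    have "?xs \<in> ?L" using part us(1) len by (auto simp: Z_def)
    moreover have "S = \<Union> (set ?xs)"
      using us(1) by (force simp: part_def)
    ultimately show "S \<in> (\<lambda>xs. \<Union> (set xs)) ` ?L" by blast
  qed
  then have "card (small_sets w l U) \<le> card ?L" by (rule surj_card_le[OF finL])
  also have "\<dots> = card Z ^ w" by (rule card_lists_length_eq[OF finZ])
  also have "\<dots> \<le> (card U * 2 ^ l + 1) ^ w" by (rule power_mono[OF cZ]) simp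
  finally show ?thesis .
qed

lemma small_sets_finite_elem: "finite U \<Longrightarrow> S \<in> small_sets w l U \<Longrightarrow> finite S"
  using finite_subset[of S "U \<times> {..<l}"] by (simp add: small_sets_def)

text \<open>Adding the unit vector of some position in \<open>S\<close> is an involution that flips
  the sign of every term.\<close>

lemma sum_chi_vecs:
  assumes fin: "finite U" and S: "S \<subseteq> U \<times> {..<l}" "S \<noteq> {}"
  shows "(\<Sum>x\<in>vecs l U. chi S x) = 0"
proof -
  have finS: "finite S" using S fin finite_subset[of S "U \<times> {..<l}"] by simp
  obtain e where e: "e \<in> S" using S by auto
  define y where "y = vec_of l U {e}"
  have y: "y \<in> vecs l U" by (simp add: y_def vec_of_in_vecs)
  have chi_y: "chi S y = - 1" using chi_unit[OF finS S(1)] e by (simp add: y_def bit_sign_def)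
  define t where "t x = (\<lambda>u\<in>U. x u \<oplus>\<^sub>b y u)" for x
  have t: "t x \<in> vecs l U" if "x \<in> vecs l U" for x
    using that y by (auto simp: t_def vecs_def bitstrings_def length_bxor PiE_def Pi_def)
  have tt: "t (t x) = x" if "x \<in> vecs l U" for x
  proof
    fix u show "t (t x) u = x u"
    proof (cases "u \<in> U")
      case True
      then show ?thesis
        using vecs_length[OF that True] vecs_length[OF y True]
        by (auto simp: t_def nth_bxor[of _ l] length_bxor[of _ l] intro!: nth_equalityI)
    next
      case False
      then show ?thesis using that by (auto simp: t_def vecs_def PiE_def extensional_def)
    qed
  qed
  have "(\<Sum>x\<in>vecs l U. chi S x) = (\<Sum>x\<in>vecs l U. chi S (t x))"
    by (rule sum.reindex_bij_witness[of _ t t]) (auto simp: t tt)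
  also have "\<dots> = (\<Sum>x\<in>vecs l U. - chi S x)"
    by (intro sum.cong refl) (simp add: t_def chi_mult[OF S(1) _ y] chi_y)
  also have "\<dots> = - (\<Sum>x\<in>vecs l U. chi S x)" by (rule sum_negf)
  finally show ?thesis by simp
qed

text \<open>Hoeffding's lemma for a fair sign, that is, its auxiliary inequality for mean
  \<open>1 / 2\<close> and width \<open>2 * \<delta>\<close>, exponentiated.\<close>

lemma cosh_le_exp_square: "\<delta> \<ge> 0 \<Longrightarrow> cosh \<delta> \<le> exp (\<delta>\<^sup>2 / 2 :: real)"
proof -
  assume \<delta>: "\<delta> \<ge> 0"
  have "- (2 * \<delta>) * (1 / 2) + ln (1 + 1 / 2 * (exp (2 * \<delta>) - 1)) \<le> (2 * \<delta>)\<^sup>2 / 8"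
    using Hoeffdings_lemma_aux[of "2 * \<delta>" "1 / 2"] \<delta> by simp
  then have "exp (- \<delta> + ln (1 + 1 / 2 * (exp (2 * \<delta>) - 1))) \<le> exp (\<delta>\<^sup>2 / 2)"
    by (simp add: power2_eq_square)
  moreover have "exp (- \<delta> + ln (1 + 1 / 2 * (exp (2 * \<delta>) - 1))) = exp (- \<delta>) * (1 + 1 / 2 * (exp (2 * \<delta>) - 1))"
  proof -
    have "1 + 1 / 2 * (exp (2 * \<delta>) - 1) = (1 + exp (2 * \<delta>)) / 2" by (simp add: field_simps)
    moreover have "0 < (1 + exp (2 * \<delta>)) / 2" by (simp add: add_pos_pos)
    ultimately have "0 < 1 + 1 / 2 * (exp (2 * \<delta>) - 1)" by (simp only:)
    then show ?thesis by (simp only: exp_add exp_ln)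
  qed
  moreover have "\<dots> = cosh \<delta>"
    by (simp add: cosh_def algebra_simps flip: exp_add)
  ultimately show ?thesis by (simp only:)
qed

lemma exp_pm_one: "\<bar>c\<bar> = 1 \<Longrightarrow> exp (\<delta> * c) = cosh \<delta> + c * sinh (\<delta> :: real)"
  by (auto simp: abs_if cosh_def sinh_def field_simps split: if_splits) 

text \<open>The \<open>2 ^ s\<close> points of the space are independent uniform samples: an exponential moment and a
  union bound over the characters of small support show that some choice of them works.\<close>

lemma exists_kwise_biased:
  fixes U :: "'a set" and \<delta> :: real
  assumes fin: "finite U" and \<delta>: "\<delta> > 0"
    and many: "2 * real ((card U * 2 ^ l + 1) ^ w) < exp (2 ^ s * \<delta>\<^sup>2 / 2)"
  shows "\<exists>D. kwise_biased w \<delta> l U D \<and> sampled_with_bits s D"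
proof -
  let ?N = "2 ^ s :: nat" and ?Z = "bitstrings s" and ?X = "vecs l U" and ?\<S> = "small_sets w l U"
  let ?\<Omega> = "?Z \<rightarrow>\<^sub>E ?X"
  have finX: "finite ?X" by (rule finite_vecs[OF fin])
  have neX: "?X \<noteq> {}" using vec_of_in_vecs by blast
  have fin\<Omega>: "finite ?\<Omega>" using finX by (intro finite_PiE) auto
  have ne\<Omega>: "?\<Omega> \<noteq> {}" using neX by (simp add: PiE_eq_empty_iff)
  have fin\<S>: "finite ?\<S>" by (rule finite_small_sets[OF fin])
  let ?T = "\<lambda>S F. \<Sum>z\<in>?Z. chi S (F z)"
  let ?e = "\<lambda>a S F. exp (a * ?T S F)"
  \<comment> \<open>Averaging factors over the seeds. For a sign, \<open>exp (a * chi)\<close> is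
    \<open>cosh a\<close> plus a multiple of the sign, and the sign sums to zero.\<close>
  have avg: "(\<Sum>F\<in>?\<Omega>. ?e a S F) = real (card ?\<Omega>) * cosh \<delta> ^ ?N"
    if S: "S \<in> ?\<S>" and a: "\<bar>a\<bar> = \<delta>" for S a
  proof -
    have "(\<Sum>F\<in>?\<Omega>. ?e a S F) = (\<Sum>F\<in>?\<Omega>. \<Prod>z\<in>?Z. exp (a * chi S (F z)))"
      by (simp add: sum_distrib_left exp_sum)
    also have "\<dots> = (\<Prod>z\<in>?Z. \<Sum>x\<in>?X. exp (a * chi S x))"
      by (rule prod_sum_PiE[symmetric]) (use finX in auto)
    also have "(\<Sum>x\<in>?X. exp (a * chi S x)) = (\<Sum>x\<in>?X. cosh a + chi S x * sinh a)"
      by (intro sum.cong refl exp_pm_one) simp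
    also have "\<dots> = real (card ?X) * cosh a + (\<Sum>x\<in>?X. chi S x) * sinh a"
      by (simp add: sum.distrib sum_distrib_right)
    also have "\<dots> = real (card ?X) * cosh \<delta>"
      using a S sum_chi_vecs[OF fin, of S l] by (auto simp: small_sets_def abs_if split: if_splits)
    finally show ?thesis
      by (simp add: card_PiE power_mult_distrib)
  qed
  have "\<exists>F\<in>?\<Omega>. \<forall>S\<in>?\<S>. \<bar>?T S F\<bar> \<le> \<delta> * ?N"
  proof (rule ccontr)
    assume contra: "\<not> ?thesis"
    have "real (card ?\<Omega>) * exp (?N * \<delta>\<^sup>2) = (\<Sum>F\<in>?\<Omega>. exp (?N * \<delta>\<^sup>2))" by simp
    also have "\<dots> \<le> (\<Sum>F\<in>?\<Omega>. \<Sum>S\<in>?\<S>. ?e \<delta> S F + ?e (- \<delta>) S F)"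
    proof (rule sum_mono)
      fix F assume "F \<in> ?\<Omega>"
      then obtain S where S: "S \<in> ?\<S>" "\<bar>?T S F\<bar> > \<delta> * ?N" using contra by force
      \<comment> \<open>With parameter \<open>\<delta>\<close> a violated bound yields
        \<open>exp (N * \<delta>\<^sup>2)\<close>, while the average is at most
        \<open>exp (N * \<delta>\<^sup>2 / 2)\<close>; the gap absorbs the number of characters and
        both signs.\<close>
      have "\<delta> * (\<delta> * ?N) \<le> \<delta> * \<bar>?T S F\<bar>" using S \<delta> by (intro mult_left_mono) auto
      then have "exp (?N * \<delta>\<^sup>2) \<le> exp (\<delta> * \<bar>?T S F\<bar>)" by (simp add: power2_eq_square mult_ac)
      also have "\<dots> \<le> ?e \<delta> S F + ?e (- \<delta>) S F" by (simp add: abs_if)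
      also have "\<dots> \<le> (\<Sum>S\<in>?\<S>. ?e \<delta> S F + ?e (- \<delta>) S F)"
        using fin\<S> S(1) by (intro member_le_sum) auto
      finally show "exp (?N * \<delta>\<^sup>2) \<le> (\<Sum>S\<in>?\<S>. ?e \<delta> S F + ?e (- \<delta>) S F)" .
    qed
    also have "\<dots> = (\<Sum>S\<in>?\<S>. (\<Sum>F\<in>?\<Omega>. ?e \<delta> S F) + (\<Sum>F\<in>?\<Omega>. ?e (- \<delta>) S F))"
      by (subst sum.swap) (simp add: sum.distrib)
    also have "\<dots> = (\<Sum>S\<in>?\<S>. 2 * (real (card ?\<Omega>) * cosh \<delta> ^ ?N))"
    proof (intro sum.cong refl)
      fix S assume S: "S \<in> ?\<S>"
      show "(\<Sum>F\<in>?\<Omega>. ?e \<delta> S F) + (\<Sum>F\<in>?\<Omega>. ?e (- \<delta>) S F) = 2 * (real (card ?\<Omega>) * cosh \<delta> ^ ?N)"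
        using avg[OF S, of \<delta>] avg[OF S, of "- \<delta>"] \<delta> by simp
    qed
    also have "\<dots> = real (card ?\<Omega>) * (2 * real (card ?\<S>) * cosh \<delta> ^ ?N)" by simp
    also have "\<dots> \<le> real (card ?\<Omega>) * (2 * real ((card U * 2 ^ l + 1) ^ w) * exp (\<delta>\<^sup>2 / 2) ^ ?N)"
      using card_small_sets[OF fin, of w l] cosh_le_exp_square[of \<delta>] \<delta>
      by (intro mult_left_mono mult_mono power_mono) (auto simp del: of_nat_power)
    also have "\<dots> < real (card ?\<Omega>) * (exp (?N * \<delta>\<^sup>2 / 2) * exp (\<delta>\<^sup>2 / 2) ^ ?N)"
      using many ne\<Omega> fin\<Omega>
      by (intro mult_strict_left_mono mult_strict_right_mono) (auto simp: card_gt_0_iff)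
    also have "\<dots> = real (card ?\<Omega>) * exp (?N * \<delta>\<^sup>2)"
      by (simp flip: exp_of_nat_mult exp_add)
    finally show False by simp
  qed
  then obtain F where F: "F \<in> ?\<Omega>" "\<And>S. S \<in> ?\<S> \<Longrightarrow> \<bar>?T S F\<bar> \<le> \<delta> * ?N" by blast
  define D where "D = map_pmf F (pmf_of_set ?Z)"
  have D: "set_pmf D \<subseteq> ?X" using F(1) by (auto simp: D_def set_pmf_of_set)
  have "kwise_biased w \<delta> l U D"
    unfolding kwise_biased_def
  proof (intro conjI D allI impI)
    fix \<psi> assume \<psi>: "nontrivial_character l U \<psi> \<and> card (character_support l U \<psi>) \<le> w"
    define S where "S = {e \<in> U \<times> {..<l}. \<psi> (vec_of l U {e}) \<noteq> 1}"
    have eq: "\<psi> x = complex_of_real (chi S x)" if "x \<in> ?X" for x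
      unfolding S_def using character_eq_chi[OF fin _ that] \<psi> by (simp add: nontrivial_character_def)
    have "S \<noteq> {}"
    proof
      assume "S = {}"
      then have "\<psi> x = 1" if "x \<in> ?X" for x using eq[OF that] by (simp add: chi_def)
      then show False using \<psi> by (auto simp: nontrivial_character_def)
    qed
    moreover have "fst ` S \<subseteq> character_support l U \<psi>"
    proof
      fix u assume "u \<in> fst ` S"
      then obtain b where b: "u \<in> U" "\<psi> (vec_of l U {(u, b)}) \<noteq> 1" by (auto simp: S_def)
      have "vec_of l U {(u, b)} v = replicate l False" if "v \<in> U - {u}" for v
        using that by (auto simp: vec_of_def intro!: nth_equalityI)
      then show "u \<in> character_support l U \<psi>"
        using b vec_of_in_vecs unfolding character_support_def by blast
    qed
    then have "card (fst ` S) \<le> w"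
      using \<psi> card_mono[of "character_support l U \<psi>" "fst ` S"] fin
      by (auto simp: character_support_def intro: le_trans)
    ultimately have "S \<in> ?\<S>" by (auto simp: small_sets_def S_def)
    have "expect D \<psi> = expect D (\<lambda>x. complex_of_real (chi S x))"
      using D eq by (intro integral_cong_AE) (auto intro!: AE_pmfI)
    also have "\<dots> = complex_of_real (?T S F / ?N)"
      by (simp add: D_def integral_pmf_of_set sum_divide_distrib)
    finally have "cmod (expect D \<psi>) = \<bar>?T S F\<bar> / ?N"
      by (simp add: norm_divide del: of_real_sum of_real_divide)
    also have "\<dots> \<le> \<delta>"
      using F(2)[OF \<open>S \<in> ?\<S>\<close>] by (subst pos_divide_le_eq) auto
    finally show "cmod (expect D \<psi>) \<le> \<delta>" .
  qed
  moreover have "sampled_with_bits s D" unfolding sampled_with_bits_def D_def by blast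
  ultimately show ?thesis by blast
qed

text \<open>Toggling a fixed element of \<open>S\<close> is an involution that changes the
  parity.\<close>

lemma card_even_subsets:
  assumes fin: "finite E" and S: "S \<subseteq> E" "S \<noteq> {}"
  shows "2 * card {T \<in> Pow E. even (card (T \<inter> S))} = 2 ^ card E"
proof -
  obtain e where e: "e \<in> S" using S by auto
  let ?A = "{T \<in> Pow E. even (card (T \<inter> S))}" and ?B = "{T \<in> Pow E. odd (card (T \<inter> S))}"
  define t where "t T = (if e \<in> T then T - {e} else insert e T)" for T
  have finS: "finite (T \<inter> S)" for T using S fin finite_subset by blast
  have par: "even (card (t T \<inter> S)) \<longleftrightarrow> odd (card (T \<inter> S))" for T
  proof (cases "e \<in> T")
    case True
    have "T \<inter> S = insert e (t T \<inter> S)" "e \<notin> t T \<inter> S" using True e by (auto simp: t_def)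
    then have "card (T \<inter> S) = Suc (card (t T \<inter> S))" using finS by (metis card_insert_disjoint)
    then show ?thesis by simp
  next
    case False
    have "t T \<inter> S = insert e (T \<inter> S)" "e \<notin> T \<inter> S" using False e by (auto simp: t_def)
    then have "card (t T \<inter> S) = Suc (card (T \<inter> S))" using finS by (metis card_insert_disjoint)
    then show ?thesis by simp
  qed
  have tt: "t (t T) = T" for T by (auto simp: t_def)
  have tE: "t T \<subseteq> E" if "T \<subseteq> E" for T using that e S by (auto simp: t_def)
  have "t ` ?A \<subseteq> ?B" "t ` ?B \<subseteq> ?A" using par tE by (simp_all add: image_subset_iff)
  then have "bij_betw t ?A ?B"
    by (intro bij_betw_byWitness[of _ t]) (simp_all add: tt)
  then have "card ?A = card ?B" by (rule bij_betw_same_card)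
  moreover have "card (Pow E) = card ?A + card ?B"
    using fin by (subst card_Un_disjoint[symmetric]) (auto intro!: arg_cong[where f = card])
  ultimately show ?thesis using fin by (simp add: card_Pow)
qed

text \<open>A random linear map is applied to the seed: \<open>W j\<close> is the set of output positions that depend on
  seed bit \<open>j\<close>, so the character indexed by \<open>S\<close> is constant on the seeds only if all sets
  \<open>W j \<inter> S\<close> have even size, which has probability \<open>2 ^ (- s)\<close>.\<close>

lemma exists_kwise_independent:
  fixes U :: "'a set"
  assumes fin: "finite U" and many: "(card U * 2 ^ l + 1) ^ k < 2 ^ s"
  shows "\<exists>G. kwise_independent k l U G \<and> sampled_with_bits s G"
proof -
  let ?E = "U \<times> {..<l}" and ?\<S> = "small_sets k l U"
  let ?\<Omega> = "{..<s} \<rightarrow>\<^sub>E Pow ?E"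
  let ?bad = "\<lambda>S. {..<s} \<rightarrow>\<^sub>E {T \<in> Pow ?E. even (card (T \<inter> S))}"
  have finE: "finite ?E" using fin by simp
  have fin\<Omega>: "finite ?\<Omega>" using finE by (intro finite_PiE) auto
  have fin\<S>: "finite ?\<S>" by (rule finite_small_sets[OF fin])
  have bad: "2 ^ s * card (?bad S) = card ?\<Omega>" if "S \<in> ?\<S>" for S
  proof -
    have "2 ^ s * card (?bad S) = (2 * card {T \<in> Pow ?E. even (card (T \<inter> S))}) ^ s"
      by (simp add: card_PiE power_mult_distrib)
    also have "\<dots> = card ?\<Omega>"
      using card_even_subsets[OF finE, of S] that finE by (simp add: small_sets_def card_PiE card_Pow)
    finally show ?thesis .
  qed
  have uncovered: "\<exists>x\<in>A. \<forall>S\<in>B. x \<notin> b S" if "\<not> A \<subseteq> (\<Union>S\<in>B. b S)" for A :: "'c set" and B :: "'d set" and b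
    using that by blast
  have "\<exists>W\<in>?\<Omega>. \<forall>S\<in>?\<S>. W \<notin> ?bad S"
  proof (rule uncovered, rule notI)
    assume "?\<Omega> \<subseteq> (\<Union>S\<in>?\<S>. ?bad S)"
    then have "card ?\<Omega> \<le> card (\<Union>S\<in>?\<S>. ?bad S)"
      using fin\<S> finE by (intro card_mono finite_UN_I finite_PiE) auto
    also have "\<dots> \<le> (\<Sum>S\<in>?\<S>. card (?bad S))" by (rule card_UN_le[OF fin\<S>])
    finally have "2 ^ s * card ?\<Omega> \<le> 2 ^ s * (\<Sum>S\<in>?\<S>. card (?bad S))" by simp
    also have "\<dots> = (\<Sum>S\<in>?\<S>. card ?\<Omega>)"
      unfolding sum_distrib_left by (rule sum.cong[OF refl bad])
    also have "\<dots> = card ?\<S> * card ?\<Omega>" by simp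
    finally have "2 ^ s * card ?\<Omega> \<le> card ?\<S> * card ?\<Omega>" .
    moreover have "card ?\<Omega> > 0" using fin\<Omega> by (auto simp: card_gt_0_iff PiE_eq_empty_iff)
    ultimately have "2 ^ s \<le> card ?\<S>" by simp
    then show False using card_small_sets[OF fin, of k l] many by linarith
  qed
  then obtain W where W: "W \<in> ?\<Omega>" "\<forall>S\<in>?\<S>. W \<notin> ?bad S" by (rule bexE)
  define F where "F z = (\<lambda>u\<in>U. map (\<lambda>b. odd (card {j\<in>{..<s}. z ! j \<and> (u, b) \<in> W j})) [0..<l])" for z :: "bool list"
  define G where "G = map_pmf F (pmf_of_set (bitstrings s))"
  have F: "F z \<in> vecs l U" for z by (auto simp: F_def vecs_def bitstrings_def)
  then have G: "set_pmf G \<subseteq> vecs l U" by (auto simp: G_def)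
  have chi_F: "chi S (F z) = (\<Prod>j<s. if z ! j then (- 1) ^ card (W j \<inter> S) else 1)"
    if S: "S \<in> ?\<S>" for S z
  proof -
    have finS: "finite S" by (rule small_sets_finite_elem[OF fin S])
    have "chi S (F z) = (\<Prod>e\<in>S. \<Prod>j<s. if z ! j \<and> e \<in> W j then - 1 else 1)"
      unfolding chi_def
    proof (intro prod.cong refl, clarify)
      fix u b assume ub: "(u, b) \<in> S"
      have "bit_sign (odd (card {j\<in>{..<s}. z ! j \<and> (u, b) \<in> W j})) = (- 1) ^ card {j\<in>{..<s}. z ! j \<and> (u, b) \<in> W j}"
        by (simp add: bit_sign_def)
      also have "\<dots> = (\<Prod>j\<in>{j\<in>{..<s}. z ! j \<and> (u, b) \<in> W j}. - 1)" by simp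
      also have "\<dots> = (\<Prod>j<s. if z ! j \<and> (u, b) \<in> W j then - 1 else 1)"
        by (intro prod.mono_neutral_cong_left) auto
      finally show "bit_sign (F z u ! b) = (\<Prod>j<s. if z ! j \<and> (u, b) \<in> W j then - 1 else 1)"
        using S ub by (auto simp: F_def small_sets_def)
    qed
    also have "\<dots> = (\<Prod>j<s. \<Prod>e\<in>S. if z ! j \<and> e \<in> W j then - 1 else 1)" by (rule prod.swap)
    also have "\<dots> = (\<Prod>j<s. if z ! j then (- 1) ^ card (W j \<inter> S) else 1)"
    proof (intro prod.cong refl)
      fix j
      have "(\<Prod>e\<in>S. if e \<in> W j then - 1 else 1 :: real) = (\<Prod>e\<in>W j \<inter> S. - 1)"
        using finS by (intro prod.mono_neutral_cong_right) auto
      then show "(\<Prod>e\<in>S. if z ! j \<and> e \<in> W j then - 1 else 1 :: real) = (if z ! j then (- 1) ^ card (W j \<inter> S) else 1)"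
        by simp
    qed
    finally show ?thesis .
  qed
  have zero: "expect G (chi S) = 0" if S: "S \<in> ?\<S>" for S
  proof -
    \<comment> \<open>As \<open>W\<close> is not bad for \<open>S\<close>, some seed bit enters the
      character an odd number of times; flipping it pairs the seeds with opposite signs.\<close>
    obtain j where j: "j < s" "odd (card (W j \<inter> S))"
      using bspec[OF W(2) S] W(1) by (auto simp: PiE_def Pi_def)
    let ?g = "\<lambda>z j. if z ! j then (- 1) ^ card (W j \<inter> S) else 1 :: real"
    define t where "t z = z[j := \<not> z ! j]" for z :: "bool list"
    have t: "t z \<in> bitstrings s" "t (t z) = z" if "z \<in> bitstrings s" for z
      using that j by (auto simp: t_def bitstrings_def)
    have neg: "chi S (F (t z)) = - chi S (F z)" if "z \<in> bitstrings s" for z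
    proof -
      have 1: "?g (t z) j = - ?g z j" using j that by (auto simp: t_def bitstrings_def)
      have 2: "(\<Prod>i\<in>{..<s} - {j}. ?g (t z) i) = (\<Prod>i\<in>{..<s} - {j}. ?g z i)"
        by (intro prod.cong refl) (auto simp: t_def)
      have "chi S (F y) = ?g y j * (\<Prod>i\<in>{..<s} - {j}. ?g y i)" for y
        unfolding chi_F[OF S] using j(1) by (intro prod.remove) auto
      then show ?thesis using 1 2 by simp
    qed
    have "(\<Sum>z\<in>bitstrings s. chi S (F z)) = (\<Sum>z\<in>bitstrings s. chi S (F (t z)))"
      by (rule sum.reindex_bij_witness[of _ t t]) (auto simp: t)
    also have "\<dots> = - (\<Sum>z\<in>bitstrings s. chi S (F z))"
      unfolding sum_negf[symmetric] by (intro sum.cong refl neg)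
    finally have "(\<Sum>z\<in>bitstrings s. chi S (F z)) = 0" by simp
    then show ?thesis by (simp add: G_def integral_pmf_of_set)
  qed
  have "kwise_independent k l U G"
    unfolding kwise_independent_def
  proof (intro conjI G allI impI)
    fix A assume A: "A \<subseteq> U \<and> card A = k"
    have finA: "finite A" using A fin finite_subset by blast
    show "map_pmf (\<lambda>f. restrict f A) G = pmf_of_set (A \<rightarrow>\<^sub>E bitstrings l)"
    proof (rule pmf_eqI)
      fix f
      have ne: "A \<rightarrow>\<^sub>E bitstrings l \<noteq> {}" by (simp add: PiE_eq_empty_iff)
      have finP: "finite (A \<rightarrow>\<^sub>E bitstrings l)" using finA by (intro finite_PiE) auto
      show "pmf (map_pmf (\<lambda>f. restrict f A) G) f = pmf (pmf_of_set (A \<rightarrow>\<^sub>E bitstrings l)) f"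
      proof (cases "f \<in> A \<rightarrow>\<^sub>E bitstrings l")
        case False
        have "f \<notin> set_pmf (map_pmf (\<lambda>f. restrict f A) G)"
        proof
          assume "f \<in> set_pmf (map_pmf (\<lambda>f. restrict f A) G)"
          then obtain g where "g \<in> vecs l U" "f = restrict g A" using G by auto
          then show False using False A by (auto simp: vecs_def PiE_def Pi_def)
        qed
        then have "pmf (map_pmf (\<lambda>f. restrict f A) G) f = 0" by (simp add: pmf_eq_0_set_pmf)
        then show ?thesis using False ne finP by (simp add: pmf_of_set)
      next
        case True
        \<comment> \<open>Bias exactly zero makes the Fourier bound an equality with the uniform
          probability.\<close>
        have "\<bar>prob G {x. \<forall>u\<in>A. x u = f u} - 1 / 2 ^ (l * card A)\<bar> \<le> 0"
        proof (rule prob_values_bound[OF fin G])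
          show "A \<subseteq> U" using A by simp
          show "length (f u) = l" if "u \<in> A" for u using True that by (auto simp: bitstrings_def PiE_def Pi_def)
          fix S assume S: "S \<subseteq> A \<times> {..<l}" "S \<noteq> {}"
          then have "fst ` S \<subseteq> A" by auto
          then have "card (fst ` S) \<le> k" using card_mono[OF finA] A by blast
          then have "S \<in> ?\<S>" using S A by (auto simp: small_sets_def)
          then show "\<bar>expect G (chi S)\<bar> \<le> 0" using zero by simp
        qed simp
        then have "prob G {x. \<forall>u\<in>A. x u = f u} = 1 / 2 ^ (l * card A)" by simp
        moreover have "(\<lambda>f. restrict f A) -` {f} = {x. \<forall>u\<in>A. x u = f u}"
        proof (intro set_eqI iffI)
          fix x assume "x \<in> {x. \<forall>u\<in>A. x u = f u}"
          then have "restrict x A = restrict f A" by (intro restrict_ext) auto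
          then show "x \<in> (\<lambda>f. restrict f A) -` {f}"
            using PiE_restrict[OF True] by simp
        qed (auto simp: restrict_def)
        ultimately have "pmf (map_pmf (\<lambda>f. restrict f A) G) f = 1 / 2 ^ (l * card A)"
          by (simp add: pmf_map)
        moreover have "card (A \<rightarrow>\<^sub>E bitstrings l) = 2 ^ (l * card A)"
          using finA by (simp add: card_PiE power_mult)
        ultimately show ?thesis using True ne finP by (simp add: pmf_of_set)
      qed
    qed
  qed
  moreover have "sampled_with_bits s G" unfolding sampled_with_bits_def G_def by blast
  ultimately show ?thesis by blast
qed

lemma sampled_with_bits_map: "sampled_with_bits s A \<Longrightarrow> sampled_with_bits s (map_pmf f A)"
  by (auto simp: sampled_with_bits_def map_pmf_comp)

lemma sampled_with_bits_pair:
  assumes "sampled_with_bits s A" "sampled_with_bits t B"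
  shows "sampled_with_bits (s + t) (pair_pmf A B)"
proof -
  obtain f g where f: "A = map_pmf f (pmf_of_set (bitstrings s))" and g: "B = map_pmf g (pmf_of_set (bitstrings t))"
    using assms by (auto simp: sampled_with_bits_def)
  have pair: "pair_pmf (pmf_of_set (bitstrings s)) (pmf_of_set (bitstrings t)) = pmf_of_set (bitstrings s \<times> bitstrings t)"
  proof (rule pmf_eqI)
    fix x :: "bool list \<times> bool list"
    show "pmf (pair_pmf (pmf_of_set (bitstrings s)) (pmf_of_set (bitstrings t))) x = pmf (pmf_of_set (bitstrings s \<times> bitstrings t)) x"
      by (cases x) (auto simp: pmf_pair pmf_of_set indicator_def card_cartesian_product)
  qed
  have "bij_betw (\<lambda>z. (take s z, drop s z)) (bitstrings (s + t)) (bitstrings s \<times> bitstrings t)"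
    by (rule bij_betw_byWitness[of _ "\<lambda>(x, y). x @ y"]) (auto simp: bitstrings_def)
  then have "pmf_of_set (bitstrings s \<times> bitstrings t) = map_pmf (\<lambda>z. (take s z, drop s z)) (pmf_of_set (bitstrings (s + t)))"
    by (intro map_pmf_of_set_bij_betw[symmetric]) auto
  then have "pair_pmf A B = map_pmf (\<lambda>(a, b). (f a, g b)) (map_pmf (\<lambda>z. (take s z, drop s z)) (pmf_of_set (bitstrings (s + t))))"
    unfolding f g map_pair[symmetric] pair by simp
  then show ?thesis unfolding sampled_with_bits_def map_pmf_comp by blast
qed

lemma sampled_with_bits_Pi:
  assumes "finite I" "\<And>i. i \<in> I \<Longrightarrow> sampled_with_bits (s i) (D i)"
  shows "sampled_with_bits (\<Sum>i\<in>I. s i) (Pi_pmf I dflt D)"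
  using assms
proof (induction I rule: finite_induct)
  case empty
  have "return_pmf (\<lambda>_. dflt) = map_pmf (\<lambda>_ _. dflt) (pmf_of_set (bitstrings 0))"
    by (simp add: map_pmf_const)
  then show ?case unfolding sampled_with_bits_def sum.empty pmf_Pi_empty by blast
next
  case (insert i I)
  then show ?case
    by (auto simp: Pi_pmf_insert intro!: sampled_with_bits_map sampled_with_bits_pair)
qed

section \<open>The hash family\<close>

text \<open>The form in which conditioning is used: \<open>B\<close> collects the outcomes of the
  first stage for which the second stage has no bound.\<close>

lemma prob_bind_le:
  assumes "c \<ge> 0" and "\<And>a. a \<in> set_pmf A \<Longrightarrow> a \<notin> B \<Longrightarrow> prob (f a) E \<le> c"
  shows "prob (bind_pmf A f) E \<le> prob A B + c"
proof -
  have "ennreal (prob (bind_pmf A f) E) = (\<integral>\<^sup>+a. emeasure (f a) E \<partial>A)"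
    by (simp flip: measure_pmf.emeasure_eq_measure)
  also have "\<dots> \<le> (\<integral>\<^sup>+a. indicator B a + ennreal c \<partial>A)"
  proof (intro nn_integral_mono_AE AE_pmfI)
    fix a assume a: "a \<in> set_pmf A"
    show "emeasure (f a) E \<le> indicator B a + ennreal c"
    proof (cases "a \<in> B")
      case True
      then show ?thesis using measure_pmf.emeasure_le_1[of "f a" E]
        by (simp add: add_increasing2)
    next
      case False
      then show ?thesis
        using assms(2)[OF a False] by (simp add: measure_pmf.emeasure_eq_measure ennreal_leI)
    qed
  qed
  also have "\<dots> = emeasure A B + ennreal c"
    by (subst nn_integral_add) auto
  also have "\<dots> = ennreal (prob A B + c)"
    using assms(1) by (simp add: measure_pmf.emeasure_eq_measure ennreal_plus)
  finally show ?thesis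
    using assms(1) by (subst (asm) ennreal_le_iff) (auto intro: add_nonneg_nonneg)
qed

lemma prob_bind_le_const:
  assumes "c \<ge> 0" and "\<And>a. a \<in> set_pmf A \<Longrightarrow> prob (f a) E \<le> c"
  shows "prob (bind_pmf A f) E \<le> c"
  using prob_bind_le[of c A "{}" f E] assms by simp

section \<open>Blocks and prefixes of bit strings\<close>

definition block_off :: "nat \<Rightarrow> nat \<Rightarrow> nat \<Rightarrow> nat" where
  "block_off L k i = (\<Sum>j = 1..i. block_len L k j)"

definition block :: "nat \<Rightarrow> nat \<Rightarrow> nat \<Rightarrow> bool list \<Rightarrow> bool list" where
  "block L k j v = take (block_len L k j) (drop (block_off L k (j - 1)) v)"

lemma block_off_Suc: "block_off L k (Suc i) = block_off L k i + block_len L k (Suc i)"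
  by (simp add: block_off_def)

lemma block_off_full: "block_off L k (k + 1) = L"
  using sum_block_len[of L k] by (simp add: block_off_def)

lemma block_off_le: "i \<le> k + 1 \<Longrightarrow> block_off L k i \<le> L"
  using sum_mono2[of "{1..k + 1}" "{1..i}" "block_len L k"] sum_block_len[of L k]
  by (simp add: block_off_def)

lemma length_block:
  assumes "length v = L" "1 \<le> j" "j \<le> k + 1"
  shows "length (block L k j v) = block_len L k j"
proof -
  have "block_off L k (j - 1) + block_len L k j = block_off L k j"
    using assms block_off_Suc[of L k "j - 1"] by simp
  moreover have "block_off L k j \<le> L" using assms by (intro block_off_le) simp
  moreover have "length (block L k j v) = min (block_len L k j) (L - block_off L k (j - 1))"
    using assms(1) by (simp add: block_def min.commute)
  ultimately show ?thesis by linarith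
qed

lemma length_concat_blocks:
  assumes "\<And>j. j \<in> {1..i} \<Longrightarrow> length (f j) = block_len L k j"
  shows "length (concat (map f [1..<Suc i])) = block_off L k i"
  using assms
proof (induction i)
  case 0
  then show ?case by (simp add: block_off_def)
next
  case (Suc i)
  then show ?case by (simp add: block_off_Suc)
qed

lemma concat_blocks_eq:
  assumes "\<And>j. j \<in> {1..i} \<Longrightarrow> length (f j) = block_len L k j" "length t = L" "i \<le> k + 1"
  shows "concat (map f [1..<Suc i]) = take (block_off L k i) t \<longleftrightarrow> (\<forall>j\<in>{1..i}. f j = block L k j t)"
  using assms
proof (induction i)
  case 0
  then show ?case by (simp add: block_off_def)
next
  case (Suc i)
  have len: "length (concat (map f [1..<Suc i])) = block_off L k i"
    using Suc.prems by (intro length_concat_blocks) auto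
  have IH: "concat (map f [1..<Suc i]) = take (block_off L k i) t \<longleftrightarrow> (\<forall>j\<in>{1..i}. f j = block L k j t)"
    using Suc.prems by (intro Suc.IH) auto
  have tk: "take (block_off L k (Suc i)) t = take (block_off L k i) t @ block L k (Suc i) t"
    by (simp add: block_off_Suc block_def take_add)
  have lt: "length (take (block_off L k i) t) = block_off L k i"
    using Suc.prems block_off_le[of i k L] by simp
  have "concat (map f [1..<Suc (Suc i)]) = concat (map f [1..<Suc i]) @ f (Suc i)" by simp
  then have "concat (map f [1..<Suc (Suc i)]) = take (block_off L k (Suc i)) t \<longleftrightarrow>
      concat (map f [1..<Suc i]) = take (block_off L k i) t \<and> f (Suc i) = block L k (Suc i) t"
    unfolding tk using len lt
    by (simp only:) (rule append_eq_append_conv, rule disjI1, simp only: len lt)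
  then show ?case unfolding IH by (auto simp: atLeastAtMostSuc_conv)
qed

lemma bxor_eq_iff:
  assumes "length a = l" "length b = l" "length v = l"
  shows "a \<oplus>\<^sub>b b = v \<longleftrightarrow> a = v \<oplus>\<^sub>b b" "a \<oplus>\<^sub>b b = v \<longleftrightarrow> b = v \<oplus>\<^sub>b a"
proof -
  have "(a \<oplus>\<^sub>b b = v) = (\<forall>i<l. (a ! i \<noteq> b ! i) = v ! i)"
    using assms by (auto simp: list_eq_iff_nth_eq length_bxor[of _ l] nth_bxor[of _ l])
  moreover have "(a = v \<oplus>\<^sub>b b) = (\<forall>i<l. a ! i = (v ! i \<noteq> b ! i))"
    using assms by (auto simp: list_eq_iff_nth_eq length_bxor[of _ l] nth_bxor[of _ l])
  moreover have "(b = v \<oplus>\<^sub>b a) = (\<forall>i<l. b ! i = (v ! i \<noteq> a ! i))"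
    using assms by (auto simp: list_eq_iff_nth_eq length_bxor[of _ l] nth_bxor[of _ l])
  ultimately show "a \<oplus>\<^sub>b b = v \<longleftrightarrow> a = v \<oplus>\<^sub>b b" "a \<oplus>\<^sub>b b = v \<longleftrightarrow> b = v \<oplus>\<^sub>b a" by blast+
qed

lemma take_bxor: "take m (a \<oplus>\<^sub>b b) = take m a \<oplus>\<^sub>b take m b"
  by (simp add: bxor_def take_map take_zip)

definition prefix_bits :: "nat \<Rightarrow> (nat \<Rightarrow> 'a \<Rightarrow> bool list) \<Rightarrow> 'a \<Rightarrow> bool list" where
  "prefix_bits m hs y = concat (map (\<lambda>i. hs i y) [1..<Suc m])"

lemma hash_fun_eq: "hash_fun k (hs, g) y = prefix_bits (k + 1) hs y \<oplus>\<^sub>b g y"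
  by (simp add: hash_fun_def prefix_bits_def)

lemma prefix_bits_upd: "prefix_bits (k + 1) (hs(k + 1 := q)) y = prefix_bits k hs y @ q y"
proof -
  have "map (\<lambda>i. (hs(k + 1 := q)) i y) [1..<Suc k] = map (\<lambda>i. hs i y) [1..<Suc k]"
    by (rule map_cong) auto
  moreover have "[1..<Suc (k + 1)] = [1..<Suc k] @ [Suc k]" by simp
  ultimately have "map (\<lambda>i. (hs(k + 1 := q)) i y) [1..<Suc (k + 1)] = map (\<lambda>i. hs i y) [1..<Suc k] @ [q y]"
    by (simp only: map_append list.map) simp
  then show ?thesis
    unfolding prefix_bits_def by (simp only: concat_append concat.simps append_Nil2)
qed

lemma length_prefix_bits:
  assumes "\<And>j. j \<in> {1..i} \<Longrightarrow> length (hs j y) = block_len L k j"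
  shows "length (prefix_bits i hs y) = block_off L k i"
  unfolding prefix_bits_def using assms by (rule length_concat_blocks)

section \<open>One hash function, conditioned on everything but its last block\<close>

locale hash_components =
  fixes L :: nat and U :: "'a set" and w :: nat and \<delta>1 \<delta>2 :: real and k kg :: nat
    and D :: "nat \<Rightarrow> ('a \<Rightarrow> bool list) pmf" and G :: "('a \<Rightarrow> bool list) pmf"
  assumes finU: "finite U"
    and D1: "i \<in> {1..k} \<Longrightarrow> kwise_biased w \<delta>1 (block_len L k i) U (D i)"
    and D2: "kwise_biased w \<delta>2 (block_len L k (k + 1)) U (D (k + 1))"
    and G: "kwise_independent kg L U G"
    and \<delta>: "\<delta>1 > 0" "\<delta>2 > 0"
begin

abbreviation last_len :: nat where "last_len \<equiv> block_len L k (k + 1)"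

lemma D_supp:
  assumes "i \<in> {1..k + 1}"
  shows "set_pmf (D i) \<subseteq> vecs (block_len L k i) U"
proof -
  have "\<exists>w' \<delta>'. kwise_biased w' \<delta>' (block_len L k i) U (D i)"
    using assms D1[of i] D2 by (cases "i = k + 1") force+
  then show ?thesis unfolding kwise_biased_def by blast
qed

lemma G_supp: "set_pmf G \<subseteq> vecs L U"
  using G unfolding kwise_independent_def by (rule conjunct1)

lemma off_plus: "block_off L k k + last_len = L"
  using block_off_full[of L k] block_off_Suc[of L k k] unfolding Suc_eq_plus1 by linarith

definition hash :: "('a \<Rightarrow> bool list) pmf" where
  "hash = map_pmf (hash_fun k) (pair_pmf (Pi_pmf {1..k + 1} undefined D) G)"

definition prefix_part :: "((nat \<Rightarrow> 'a \<Rightarrow> bool list) \<times> ('a \<Rightarrow> bool list)) pmf" where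
  "prefix_part = pair_pmf (Pi_pmf {1..k} undefined D) G"

text \<open>The conditional distribution of the hash function once \<open>g\<close> and all blocks
  except the last are known.\<close>

definition completion :: "(nat \<Rightarrow> 'a \<Rightarrow> bool list) \<times> ('a \<Rightarrow> bool list) \<Rightarrow> ('a \<Rightarrow> bool list) pmf" where
  "completion a = map_pmf (\<lambda>q. hash_fun k ((fst a)(k + 1 := q), snd a)) (D (k + 1))"

definition prefix_value :: "(nat \<Rightarrow> 'a \<Rightarrow> bool list) \<times> ('a \<Rightarrow> bool list) \<Rightarrow> 'a \<Rightarrow> bool list" where
  "prefix_value a y = prefix_bits k (fst a) y \<oplus>\<^sub>b take (block_off L k k) (snd a y)"

text \<open>By independence the sampling can be reordered so that the last block comes at the
  end.\<close>

lemma hash_eq_bind: "hash = bind_pmf prefix_part completion"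
proof -
  have eq: "{1..k + 1} = insert (k + 1) {1..k}" by auto
  have "hash = bind_pmf (Pi_pmf {1..k + 1} undefined D) (\<lambda>hs. bind_pmf G (\<lambda>g. return_pmf (hash_fun k (hs, g))))"
    by (simp add: hash_def pair_pmf_def map_bind_pmf)
  also have "\<dots> = bind_pmf (D (k + 1)) (\<lambda>q. bind_pmf (Pi_pmf {1..k} undefined D)
      (\<lambda>f. bind_pmf G (\<lambda>g. return_pmf (hash_fun k (f(k + 1 := q), g)))))"
    unfolding eq by (subst Pi_pmf_insert') (auto simp: bind_assoc_pmf bind_return_pmf)
  also have "\<dots> = bind_pmf (Pi_pmf {1..k} undefined D) (\<lambda>f. bind_pmf (D (k + 1))
      (\<lambda>q. bind_pmf G (\<lambda>g. return_pmf (hash_fun k (f(k + 1 := q), g)))))"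
    by (rule bind_commute_pmf)
  also have "\<dots> = bind_pmf (Pi_pmf {1..k} undefined D) (\<lambda>f. bind_pmf G
      (\<lambda>g. bind_pmf (D (k + 1)) (\<lambda>q. return_pmf (hash_fun k (f(k + 1 := q), g)))))"
    by (rule bind_pmf_cong[OF refl], rule bind_commute_pmf)
  also have "\<dots> = bind_pmf prefix_part completion"
    by (simp add: prefix_part_def completion_def pair_pmf_def bind_assoc_pmf bind_return_pmf map_pmf_def)
  finally show ?thesis .
qed

lemma hs_length:
  assumes "hs \<in> set_pmf (Pi_pmf I undefined D)" "finite I" "I \<subseteq> {1..k + 1}" "i \<in> I" "y \<in> U"
  shows "length (hs i y) = block_len L k i"
proof -
  have "hs i \<in> set_pmf (D i)" using assms by (simp add: set_Pi_pmf PiE_dflt_def)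
  then have "hs i \<in> vecs (block_len L k i) U" using D_supp[of i] assms by blast
  then show ?thesis by (rule vecs_length) (rule assms)
qed

text \<open>For fixed blocks the hash function is \<open>g\<close> shifted by a fixed vector, so it
  inherits the independence of \<open>g\<close> whatever the blocks are.\<close>

lemma hash_independent:
  assumes kg: "kg \<le> card U" and A: "A \<subseteq> U" "card A \<le> kg"
  shows "prob hash {h. \<forall>y\<in>A. h y = f y} \<le> 1 / 2 ^ (L * card A)"
proof -
  have "hash = bind_pmf (Pi_pmf {1..k + 1} undefined D) (\<lambda>hs. map_pmf (\<lambda>g. hash_fun k (hs, g)) G)"
    by (simp add: hash_def pair_pmf_def map_pmf_def bind_assoc_pmf bind_return_pmf)
  moreover have "prob (map_pmf (\<lambda>g. hash_fun k (hs, g)) G) {h. \<forall>y\<in>A. h y = f y} \<le> 1 / 2 ^ (L * card A)"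
    if hs: "hs \<in> set_pmf (Pi_pmf {1..k + 1} undefined D)" for hs
  proof (cases "\<forall>y\<in>A. length (f y) = L")
    case True
    let ?c = "prefix_bits (k + 1) hs"
    have lc: "length (?c y) = L" if "y \<in> A" for y
      using length_prefix_bits[of "k + 1" hs y L k] hs_length[OF hs] that A block_off_full[of L k] by auto
    have "prob (map_pmf (\<lambda>g. hash_fun k (hs, g)) G) {h. \<forall>y\<in>A. h y = f y}
        = prob G ({g. \<forall>y\<in>A. hash_fun k (hs, g) y = f y} \<inter> set_pmf G)"
      by (simp add: measure_Int_set_pmf vimage_def)
    also have "\<dots> \<le> prob G {g. \<forall>y\<in>A. g y = f y \<oplus>\<^sub>b ?c y}"
    proof (rule measure_pmf.finite_measure_mono; safe?)
      fix g y assume g: "\<forall>y\<in>A. hash_fun k (hs, g) y = f y" "g \<in> set_pmf G" and y: "y \<in> A"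
      have "length (g y) = L" using vecs_length[OF subsetD[OF G_supp g(2)]] y A by blast
      moreover have "?c y \<oplus>\<^sub>b g y = f y" using g(1) y by (simp add: hash_fun_eq)
      ultimately show "g y = f y \<oplus>\<^sub>b ?c y" using lc[OF y] True y bxor_eq_iff(2)[of "?c y" L "g y" "f y"] by blast
    qed auto
    also have "\<dots> = 1 / 2 ^ (L * card A)"
      using kg A True lc by (intro kwise_independent_prob[OF finU G]) (auto simp: length_bxor)
    finally show ?thesis .
  next
    case False
    then obtain y where y: "y \<in> A" "length (f y) \<noteq> L" by auto
    have "prob (map_pmf (\<lambda>g. hash_fun k (hs, g)) G) {h. \<forall>y\<in>A. h y = f y}
        = prob G ({g. \<forall>y\<in>A. hash_fun k (hs, g) y = f y} \<inter> set_pmf G)"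
      by (simp add: measure_Int_set_pmf vimage_def)
    also have "{g. \<forall>y\<in>A. hash_fun k (hs, g) y = f y} \<inter> set_pmf G = {}"
    proof (rule ccontr)
      assume "\<not> ?thesis"
      then obtain g where g: "hash_fun k (hs, g) y = f y" "g \<in> set_pmf G" using y by blast
      have "length (g y) = L" using vecs_length[OF subsetD[OF G_supp g(2)]] y A by blast
      moreover have "length (prefix_bits (k + 1) hs y) = L"
        using length_prefix_bits[of "k + 1" hs y L k] hs_length[OF hs] y A block_off_full[of L k] by auto
      ultimately have "length (hash_fun k (hs, g) y) = L"
        unfolding hash_fun_eq by (rule length_bxor[rotated])
      then show False using g y by simp
    qed
    finally show ?thesis by simp
  qed
  ultimately show ?thesis by (simp add: prob_bind_le_const)
qed

lemma prefix_part_lengths: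
  assumes "a \<in> set_pmf prefix_part" "y \<in> U"
  shows "length (prefix_bits k (fst a) y) = block_off L k k" "length (snd a y) = L"
proof -
  obtain hs g where a: "a = (hs, g)" by (cases a)
  have hs: "hs \<in> set_pmf (Pi_pmf {1..k} undefined D)" and g: "g \<in> set_pmf G"
    using assms(1) by (auto simp: a prefix_part_def)
  show "length (snd a y) = L" using vecs_length[OF subsetD[OF G_supp g] assms(2)] by (simp add: a)
  show "length (prefix_bits k (fst a) y) = block_off L k k"
    using hs_length[OF hs] assms(2) by (intro length_prefix_bits) (auto simp: a)
qed

lemma completion_length_prefix:
  assumes a: "a \<in> set_pmf prefix_part" and h: "h \<in> set_pmf (completion a)" and y: "y \<in> U"
  shows "length (h y) = L" "take (block_off L k k) (h y) = prefix_value a y"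
proof -
  obtain q where q: "q \<in> set_pmf (D (k + 1))" "h = hash_fun k ((fst a)(k + 1 := q), snd a)"
    using h by (auto simp: completion_def)
  have lq: "length (q y) = last_len" using vecs_length[OF subsetD[OF D_supp q(1)] y] by simp
  let ?c = "prefix_bits k (fst a) y"
  have hy: "h y = (?c @ q y) \<oplus>\<^sub>b snd a y"
    unfolding q(2) hash_fun_eq prefix_bits_upd by (rule refl)
  note len = prefix_part_lengths[OF a y]
  show "length (h y) = L" unfolding hy using len lq off_plus by (intro length_bxor) auto
  show "take (block_off L k k) (h y) = prefix_value a y"
    unfolding hy take_bxor prefix_value_def using len by simp
qed

text \<open>Given the prefix part, prescribed hash values force prescribed values of the last block
  alone; a prescribed string of wrong length has probability zero.\<close>

lemma completion_prob:
  assumes a: "a \<in> set_pmf prefix_part" and B: "B \<subseteq> U" "card B \<le> w"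
  shows "prob (completion a) {h. \<forall>y\<in>B. h y = f y} \<le> 1 / 2 ^ (last_len * card B) + \<delta>2"
proof (cases "\<forall>y\<in>B. length (f y) = L")
  case False
  then obtain y where y: "y \<in> B" "length (f y) \<noteq> L" by auto
  have "prob (completion a) {h. \<forall>y\<in>B. h y = f y} = prob (completion a) ({h. \<forall>y\<in>B. h y = f y} \<inter> set_pmf (completion a))"
    by (simp add: measure_Int_set_pmf)
  also have "{h. \<forall>y\<in>B. h y = f y} \<inter> set_pmf (completion a) = {}"
    using completion_length_prefix(1)[OF a] y B by fastforce
  finally show ?thesis using \<delta> by simp
next
  case True
  let ?t = "\<lambda>y. drop (block_off L k k) (f y \<oplus>\<^sub>b snd a y)"
  have "prob (completion a) {h. \<forall>y\<in>B. h y = f y}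
      = prob (D (k + 1)) ({q. \<forall>y\<in>B. hash_fun k ((fst a)(k + 1 := q), snd a) y = f y} \<inter> set_pmf (D (k + 1)))"
    by (simp add: completion_def measure_Int_set_pmf vimage_def)
  also have "\<dots> \<le> prob (D (k + 1)) {q. \<forall>y\<in>B. q y = ?t y}"
  proof (rule measure_pmf.finite_measure_mono; safe?)
    fix q y assume q: "\<forall>y\<in>B. hash_fun k ((fst a)(k + 1 := q), snd a) y = f y" "q \<in> set_pmf (D (k + 1))" and y: "y \<in> B"
    have yU: "y \<in> U" using y B by auto
    have lq: "length (q y) = last_len" using vecs_length[OF subsetD[OF D_supp q(2)] yU] by simp
    let ?c = "prefix_bits k (fst a) y"
    note len = prefix_part_lengths[OF a yU]
    have "(?c @ q y) \<oplus>\<^sub>b snd a y = f y"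
      using bspec[OF q(1) y] unfolding hash_fun_eq prefix_bits_upd .
    then have "?c @ q y = f y \<oplus>\<^sub>b snd a y"
      using bxor_eq_iff(1)[of "?c @ q y" L "snd a y" "f y"] len lq off_plus True y by simp
    then have "drop (block_off L k k) (?c @ q y) = ?t y" by simp
    then show "q y = ?t y" using len by simp
  qed auto
  also have "\<dots> \<le> 1 / 2 ^ (last_len * card B) + \<delta>2"
  proof -
    have "length (?t y) = last_len" if "y \<in> B" for y
      using that B True prefix_part_lengths(2)[OF a, of y] off_plus length_bxor[of "f y" L "snd a y"] by auto
    then have "\<bar>prob (D (k + 1)) {q. \<forall>y\<in>B. q y = ?t y} - 1 / 2 ^ (last_len * card B)\<bar> \<le> \<delta>2"
      using \<delta> by (intro kwise_biased_prob[OF finU D2 B]) auto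
    then show ?thesis by linarith
  qed
  finally show ?thesis .
qed

text \<open>With \<open>g\<close> fixed, a ball shares the prefix of \<open>v\<close> iff each of
  its blocks equals that block of \<open>v \<oplus>\<^sub>b g y\<close>; the target depends on the
  ball, hence the function \<open>t\<close> in \<open>step\<close>. Level by level, the next block
  thins out the surviving balls, and a union over all \<open>2 ^ L\<close> strings \<open>v\<close>
  is affordable.\<close>

lemma prefix_load:
  fixes lam :: "nat \<Rightarrow> real" and \<eta> :: real
  assumes X: "X \<subseteq> U" and \<eta>: "\<eta> \<ge> 0" and lam0: "real (card X) \<le> lam 0"
    and step: "\<And>i Y t. i \<in> {1..k} \<Longrightarrow> Y \<subseteq> X \<Longrightarrow> real (card Y) \<le> lam (i - 1) \<Longrightarrow>
      (\<And>y. y \<in> Y \<Longrightarrow> length (t y) = block_len L k i) \<Longrightarrow>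
      prob (D i) {q. real (card {y \<in> Y. q y = t y}) > lam i} \<le> \<eta>"
  shows "prob prefix_part
      {a. \<exists>v\<in>bitstrings L. real (card {y \<in> X. take (block_off L k k) v = prefix_value a y}) > lam k}
    \<le> real k * 2 ^ L * \<eta>"
proof -
  have finX: "finite X" using X finU finite_subset by blast
  define N where "N g i hs v = card {y \<in> X. \<forall>j\<in>{1..i}. hs j y = block L k j (v \<oplus>\<^sub>b g y)}" for g i v and hs :: "nat \<Rightarrow> 'a \<Rightarrow> bool list"
  have levels: "prob (Pi_pmf {1..i} undefined D) {hs. \<exists>v\<in>bitstrings L. real (N g i hs v) > lam i}
      \<le> real i * 2 ^ L * \<eta>" if g: "g \<in> set_pmf G" and i: "i \<le> k" for i g
    using i
  proof (induction i)
    case 0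
    have "N g 0 hs v = card X" for hs v by (simp add: N_def)
    then show ?case using lam0 by (simp add: not_less[symmetric])
  next
    case (Suc i)
    have ins: "{1..Suc i} = insert (Suc i) {1..i}" by auto
    have eq: "Pi_pmf {1..Suc i} undefined D
        = bind_pmf (Pi_pmf {1..i} undefined D) (\<lambda>hs. map_pmf (\<lambda>q. hs(Suc i := q)) (D (Suc i)))"
      unfolding ins by (subst Pi_pmf_insert', simp, simp, subst bind_commute_pmf) (simp add: map_pmf_def)
    let ?E = "{hs. \<exists>v\<in>bitstrings L. real (N g (Suc i) hs v) > lam (Suc i)}"
    let ?B = "{hs. \<exists>v\<in>bitstrings L. real (N g i hs v) > lam i}"
    have "prob (Pi_pmf {1..Suc i} undefined D) ?E \<le> prob (Pi_pmf {1..i} undefined D) ?B + 2 ^ L * \<eta>"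
      unfolding eq
    proof (rule prob_bind_le)
      show "0 \<le> 2 ^ L * \<eta>" using \<eta> by simp
      fix hs assume hs: "hs \<notin> ?B"
      \<comment> \<open>The survivors depend only on earlier blocks, so they are fixed while the
        next, independent block is drawn.\<close>
      define Y where "Y v = {y \<in> X. \<forall>j\<in>{1..i}. hs j y = block L k j (v \<oplus>\<^sub>b g y)}" for v
      let ?t = "\<lambda>v y. block L k (Suc i) (v \<oplus>\<^sub>b g y)"
      have NY: "N g (Suc i) (hs(Suc i := q)) v = card {y \<in> Y v. q y = ?t v y}" for q v
        unfolding N_def Y_def ins by (intro arg_cong[where f = card]) auto
      have "prob (map_pmf (\<lambda>q. hs(Suc i := q)) (D (Suc i))) ?E
          = prob (D (Suc i)) (\<Union>v\<in>bitstrings L. {q. real (card {y \<in> Y v. q y = ?t v y}) > lam (Suc i)})"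
        by (auto simp: NY vimage_def intro!: arg_cong[where f = "prob (D (Suc i))"])
      also have "\<dots> \<le> (\<Sum>v\<in>bitstrings L. prob (D (Suc i)) {q. real (card {y \<in> Y v. q y = ?t v y}) > lam (Suc i)})"
        by (intro measure_pmf.finite_measure_subadditive_finite) auto
      also have "\<dots> \<le> (\<Sum>v\<in>(bitstrings L :: bool list set). \<eta>)"
      proof (rule sum_mono)
        fix v :: "bool list" assume v: "v \<in> bitstrings L"
        show "prob (D (Suc i)) {q. real (card {y \<in> Y v. q y = ?t v y}) > lam (Suc i)} \<le> \<eta>"
        proof (rule step)
          show "Suc i \<in> {1..k}" using Suc.prems by simp
          show "Y v \<subseteq> X" by (auto simp: Y_def)
          have "real (N g i hs v) \<le> lam i" using hs v by auto
          then show "real (card (Y v)) \<le> lam (Suc i - 1)" by (simp add: N_def Y_def)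
          fix y assume "y \<in> Y v"
          then have "length (g y) = L" using X vecs_length[OF subsetD[OF G_supp g], of y] by (auto simp: Y_def)
          then show "length (?t v y) = block_len L k (Suc i)"
            using v Suc.prems by (intro length_block length_bxor) (auto simp: bitstrings_def)
        qed
      qed
      also have "\<dots> = 2 ^ L * \<eta>" by simp
      finally show "prob (map_pmf (\<lambda>q. hs(Suc i := q)) (D (Suc i))) ?E \<le> 2 ^ L * \<eta>" .
    qed
    also have "\<dots> \<le> real i * 2 ^ L * \<eta> + 2 ^ L * \<eta>" using Suc by simp
    finally show ?case by (simp add: algebra_simps)
  qed
  have "prefix_part = bind_pmf G (\<lambda>g. map_pmf (\<lambda>hs. (hs, g)) (Pi_pmf {1..k} undefined D))"
    unfolding prefix_part_def pair_pmf_def map_pmf_def by (subst bind_commute_pmf) simp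
  moreover have "prob (map_pmf (\<lambda>hs. (hs, g)) (Pi_pmf {1..k} undefined D))
      {a. \<exists>v\<in>bitstrings L. real (card {y \<in> X. take (block_off L k k) v = prefix_value a y}) > lam k} \<le> real k * 2 ^ L * \<eta>"
    (is "prob _ ?S \<le> _")
    if g: "g \<in> set_pmf G" for g
  proof -
    let ?P = "Pi_pmf {1..k} undefined D"
    have "prob (map_pmf (\<lambda>hs. (hs, g)) ?P) ?S = prob ?P ({hs. (hs, g) \<in> ?S} \<inter> set_pmf ?P)"
      by (simp add: measure_Int_set_pmf vimage_def)
    also have "\<dots> \<le> prob ?P {hs. \<exists>v\<in>bitstrings L. real (N g k hs v) > lam k}"
    proof (rule measure_pmf.finite_measure_mono; safe?)
      fix hs v assume hs: "hs \<in> set_pmf ?P" and v: "v \<in> bitstrings L"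
        and gt: "lam k < real (card {y \<in> X. take (block_off L k k) v = prefix_value (hs, g) y})"
      have a: "(hs, g) \<in> set_pmf prefix_part" using hs g by (simp add: prefix_part_def)
      have "take (block_off L k k) v = prefix_value (hs, g) y \<longleftrightarrow> (\<forall>j\<in>{1..k}. hs j y = block L k j (v \<oplus>\<^sub>b g y))"
        if y: "y \<in> X" for y
      proof -
        have yU: "y \<in> U" using y X by auto
        let ?c = "prefix_bits k hs y" and ?o = "block_off L k k"
        have len: "length ?c = ?o" "length (g y) = L" using prefix_part_lengths[OF a yU] by simp_all
        have lv: "length v = L" using v by (simp add: bitstrings_def)
        have oL: "?o \<le> L" by (rule block_off_le) simp
        have "take ?o v = prefix_value (hs, g) y \<longleftrightarrow> ?c \<oplus>\<^sub>b take ?o (g y) = take ?o v" by (auto simp: prefix_value_def)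
        also have "\<dots> \<longleftrightarrow> ?c = take ?o v \<oplus>\<^sub>b take ?o (g y)"
          using len lv oL by (intro bxor_eq_iff(1)) auto
        also have "\<dots> \<longleftrightarrow> ?c = take ?o (v \<oplus>\<^sub>b g y)" by (simp only: take_bxor)
        also have "\<dots> \<longleftrightarrow> (\<forall>j\<in>{1..k}. hs j y = block L k j (v \<oplus>\<^sub>b g y))"
          unfolding prefix_bits_def using hs_length[OF hs] yU len lv by (intro concat_blocks_eq) (auto simp: length_bxor)
        finally show ?thesis .
      qed
      then have "{y \<in> X. take (block_off L k k) v = prefix_value (hs, g) y} = {y \<in> X. \<forall>j\<in>{1..k}. hs j y = block L k j (v \<oplus>\<^sub>b g y)}"
        by blast
      then show "\<exists>v\<in>bitstrings L. real (N g k hs v) > lam k" using gt v unfolding N_def by auto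
    qed auto
    also have "\<dots> \<le> real k * 2 ^ L * \<eta>" by (rule levels[OF g]) simp
    finally show ?thesis .
  qed
  ultimately show ?thesis using \<eta> by (simp add: prob_bind_le_const)
qed

end

context hash_components
begin

lemma hash_supp:
  assumes "h \<in> set_pmf hash" "y \<in> U"
  shows "h y \<in> bitstrings L"
proof -
  obtain a where "a \<in> set_pmf prefix_part" "h \<in> set_pmf (completion a)"
    using assms(1) by (auto simp: hash_eq_bind)
  then show ?thesis using completion_length_prefix(1) assms(2) by (auto simp: bitstrings_def)
qed

lemma card_same_prefix:
  "card {b \<in> bitstrings L. take (block_off L k k) b = u} \<le> 2 ^ last_len"
proof -
  let ?o = "block_off L k k"
  have "inj_on (drop ?o) {b \<in> bitstrings L. take ?o b = u}"
    by (rule inj_onI) (metis (mono_tags, lifting) append_take_drop_id mem_Collect_eq)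
  moreover have "drop ?o ` {b \<in> bitstrings L. take ?o b = u} \<subseteq> bitstrings last_len"
    using off_plus by (auto simp: bitstrings_def)
  ultimately have "card {b \<in> bitstrings L. take ?o b = u} \<le> card (bitstrings last_len)"
    by (intro card_inj_on_le) auto
  then show ?thesis by simp
qed

text \<open>Given the prefix parts, a bin is compatible with at most \<open>d * lam\<close> pairs
  and a pair with at most \<open>2 ^ last_len\<close> bins. So \<open>2 ^ (last_len * N)\<close>,
  with \<open>N\<close> the size of a tree, counts possible trees up to the leaf weights and cancels
  against the probability of each; \<open>2 ^ L\<close> counts the roots.\<close>

lemma witness_prob:
  fixes lam \<kappa> :: real
  assumes d: "d \<ge> 2" and X: "X \<subseteq> U" and size: "witness_size d s t \<le> w"
    and \<delta>2: "\<delta>2 \<le> 1 / 2 ^ (last_len * w)" and \<kappa>: "\<kappa> \<ge> 1" "real d * lam \<le> \<kappa> * 2 ^ last_len"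
    and f: "\<And>i. i < d \<Longrightarrow> f i \<in> set_pmf prefix_part"
    and light: "\<And>i v. i < d \<Longrightarrow> v \<in> bitstrings L \<Longrightarrow>
      real (card {y \<in> X. take (block_off L k k) v = prefix_value (f i) y}) \<le> lam"
  defines "C \<equiv> \<lambda>h i y v. i < d \<and> y \<in> X \<and> take (block_off L k k) v = take (block_off L k k) (h i y)"
  shows "prob (Pi_pmf {..<d} dflt (\<lambda>i. completion (f i)))
      {h. \<exists>v\<in>bitstrings L. \<exists>\<sigma>\<in>witnesses d s X (bitstrings L) (C h) t v.
         card \<sigma> = witness_size d s t \<and> (\<forall>(i, y, u)\<in>\<sigma>. i < d \<and> y \<in> X \<and> h i y = u)}
    \<le> 2 ^ L * (2 ^ d * (\<kappa> ^ (s + 1) / fact s) ^ (d ^ t))"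
    (is "prob ?M ?E \<le> _")
proof -
  have finX: "finite X" using X finU finite_subset by blast
  let ?V = "bitstrings L" and ?o = "block_off L k k"
  let ?N = "witness_size d s t"
  let ?real = "\<lambda>\<sigma>. {h. \<forall>(i, y, u)\<in>\<sigma>. h i y = u}"
  let ?\<eta> = "(\<kappa> ^ (s + 1) / fact s) ^ (d ^ t)"
  let ?Y = "\<lambda>i v. {y \<in> X. take ?o v = prefix_value (f i) y}"
  define Cf where "Cf i y v \<longleftrightarrow> i < d \<and> y \<in> X \<and> take ?o v = prefix_value (f i) y" for i y v
  let ?S = "\<lambda>v. {(i, y). i < d \<and> y \<in> X \<and> Cf i y v}"
  define P where "P = nat \<lfloor>real d * lam\<rfloor>"
  define W where "W v = {\<sigma> \<in> witnesses d s X ?V Cf t v. card \<sigma> = ?N \<and> (\<forall>(i, y, u)\<in>\<sigma>. i < d \<and> y \<in> X)}" for v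
  let ?all = "\<Union>v\<in>?V. \<Union>\<sigma>\<in>W v. (?real \<sigma>)"
  have lam0: "lam \<ge> 0"
  proof -
    have "replicate L False \<in> ?V" by (simp add: bitstrings_def)
    then have "real (card {y \<in> X. take ?o (replicate L False) = prefix_value (f 0) y}) \<le> lam"
      using d by (intro light) auto
    moreover have "0 \<le> real (card {y \<in> X. take ?o (replicate L False) = prefix_value (f 0) y})" by simp
    ultimately show ?thesis by linarith
  qed
  have P: "card (?S v) \<le> P" if v: "v \<in> ?V" for v
  proof -
    have "(?S v) = (SIGMA i:{..<d}. (?Y i v))"
      by (auto simp: Cf_def)
    then have "card (?S v) = (\<Sum>i<d. card (?Y i v))"
      using finX by simp
    then have "real (card (?S v)) = (\<Sum>i<d. real (card (?Y i v)))"
      by simp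
    also have "\<dots> \<le> (\<Sum>i<d. lam)" using light[OF _ v] by (intro sum_mono) auto
    finally have "real (card (?S v)) \<le> real d * lam" by simp
    then show ?thesis unfolding P_def by linarith
  qed
  have q: "card {b \<in> ?V. Cf i y b} \<le> 2 ^ last_len" for i y
  proof -
    have "card {b \<in> ?V. Cf i y b} \<le> card {b \<in> ?V. take ?o b = prefix_value (f i) y}"
      by (intro card_mono) (auto simp: Cf_def)
    then show ?thesis using card_same_prefix[of "prefix_value (f i) y"] by linarith
  qed
  have "real P \<le> real d * lam" unfolding P_def using lam0 by (simp add: of_nat_nat)
  then have P\<kappa>: "real P \<le> \<kappa> * real (2 ^ last_len)" using \<kappa> by simp
  have wit: "finite (witnesses d s X ?V Cf t v) \<and> card (witnesses d s X ?V Cf t v) \<le> witness_count P (2 ^ last_len) d s t"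
    if "v \<in> ?V" for v
    using that d finX P q by (intro card_witnesses) auto
  have cW: "finite (W v)" "real (card (W v)) \<le> 2 ^ (last_len * ?N) * ?\<eta>" if v: "v \<in> ?V" for v
  proof -
    have sub: "W v \<subseteq> witnesses d s X ?V Cf t v" by (auto simp: W_def)
    show "finite (W v)" using sub wit[OF v] finite_subset by blast
    have "card (W v) \<le> witness_count P (2 ^ last_len) d s t"
      using card_mono[OF _ sub] wit[OF v] by (meson le_trans)
    then have "real (card (W v)) \<le> real (witness_count P (2 ^ last_len) d s t)" by simp
    also have "\<dots> \<le> real (2 ^ last_len) ^ ?N * ?\<eta>"
      using d \<kappa> P\<kappa> by (intro witness_count_bound) auto
    finally show "real (card (W v)) \<le> 2 ^ (last_len * ?N) * ?\<eta>" by (simp add: power_mult)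
  qed
  have real: "prob ?M (?real \<sigma>) \<le> 2 ^ d * (1 / 2 ^ (last_len * ?N))"
    if \<sigma>: "\<sigma> \<in> W v" for \<sigma> v
  proof (cases "?N = 0")
    case True
    then show ?thesis
      using measure_pmf.prob_le_1[of ?M "(?real \<sigma>)"]
      by (simp add: order_trans[OF _ one_le_power])
  next
    case False
    have c\<sigma>: "card \<sigma> = ?N" using \<sigma> by (simp add: W_def)
    then have fin\<sigma>: "finite \<sigma>" using False card_ge_0_finite by force
    have "prob ?M (?real \<sigma>) \<le> 2 ^ d * (1 / 2 ^ last_len) ^ card \<sigma>"
    proof (rule realised_prob[where X = X and w = w])
      fix i B g assume i: "i < d" and B: "B \<subseteq> X" "card B \<le> w"
      have "prob (completion (f i)) {h. \<forall>y\<in>B. h y = g y} \<le> 1 / 2 ^ (last_len * card B) + \<delta>2"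
        using B X by (intro completion_prob f i) auto
      \<comment> \<open>The bias does not exceed the uniform probability of the event, so it costs a
        factor 2 per hash function and \<open>2 ^ d\<close> in total.\<close>
      also have "\<delta>2 \<le> 1 / 2 ^ (last_len * card B)"
        using B(2) by (intro order_trans[OF \<delta>2] divide_left_mono power_increasing) auto
      finally show "prob (completion (f i)) {h. \<forall>y\<in>B. h y = g y} \<le> 2 * (1 / 2 ^ last_len) ^ card B"
        by (simp add: power_divide power_mult)
    qed (use \<sigma> fin\<sigma> c\<sigma> size in \<open>auto simp: W_def\<close>)
    then show ?thesis by (simp add: c\<sigma> power_divide power_mult)
  qed
  have "prob ?M ?E = prob ?M (?E \<inter> set_pmf ?M)"
    by (simp add: measure_Int_set_pmf)
  also have "\<dots> \<le> prob ?M ?all"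
  proof (rule measure_pmf.finite_measure_mono)
    show "?E \<inter> set_pmf ?M \<subseteq> ?all"
    proof
      fix h assume h: "h \<in> ?E \<inter> set_pmf ?M"
      have "take ?o (h i y) = prefix_value (f i) y" if "i < d" "y \<in> X" for i y
      proof -
        have "h i \<in> set_pmf (completion (f i))" using h that by (simp add: set_Pi_pmf PiE_dflt_def)
        then show ?thesis using completion_length_prefix(2)[OF f[OF that(1)]] that X by blast
      qed
      \<comment> \<open>Compatibility sees only prefixes, which are already fixed: the family of
        candidate trees does not depend on the remaining randomness.\<close>
      then have CC: "C h = Cf" unfolding C_def Cf_def by (intro ext) auto
      obtain v \<sigma> where v: "v \<in> ?V" and \<sigma>: "\<sigma> \<in> witnesses d s X ?V Cf t v" "card \<sigma> = ?N"
          "\<forall>(i, y, u)\<in>\<sigma>. i < d \<and> y \<in> X \<and> h i y = u"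
        using h unfolding CC[symmetric] by blast
      have "\<sigma> \<in> W v" using \<sigma> unfolding W_def by auto
      moreover have "h \<in> (?real \<sigma>)" using \<sigma>(3) by auto
      ultimately show "h \<in> ?all" using v by blast
    qed
  qed simp
  also have "\<dots> \<le> (\<Sum>v\<in>?V. prob ?M (\<Union>\<sigma>\<in>W v. (?real \<sigma>)))"
    by (intro measure_pmf.finite_measure_subadditive_finite) auto
  also have "\<dots> \<le> (\<Sum>v\<in>?V. 2 ^ d * ?\<eta>)"
  proof (rule sum_mono)
    fix v assume v: "v \<in> ?V"
    have "prob ?M (\<Union>\<sigma>\<in>W v. (?real \<sigma>))
        \<le> (\<Sum>\<sigma>\<in>W v. prob ?M (?real \<sigma>))"
      by (intro measure_pmf.finite_measure_subadditive_finite cW(1) v) auto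
    also have "\<dots> \<le> (\<Sum>\<sigma>\<in>W v. 2 ^ d * (1 / 2 ^ (last_len * ?N)))" by (intro sum_mono real)
    also have "\<dots> = real (card (W v)) * (2 ^ d * (1 / 2 ^ (last_len * ?N)))" by simp
    also have "\<dots> \<le> 2 ^ (last_len * ?N) * ?\<eta> * (2 ^ d * (1 / 2 ^ (last_len * ?N)))"
      by (intro mult_right_mono cW(2) v) simp
    finally show "prob ?M (\<Union>\<sigma>\<in>W v. (?real \<sigma>)) \<le> 2 ^ d * ?\<eta>"
      by (simp add: mult.commute)
  qed
  finally show ?thesis by simp
qed

text \<open>A large load forces either a crowded small set of balls or a realised tree. The three
  terms are the crowded sets, handled by \<open>g\<close>; the overfull prefixes, handled by the
  first \<open>k\<close> blocks; and the trees, handled by the last block.\<close>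

lemma max_load_tail:
  fixes lam :: "nat \<Rightarrow> real" and \<kappa> \<rho> \<eta> :: real
  assumes d: "d \<ge> 2" and xs: "distinct xs" "set xs \<subseteq> U" and kg: "kg \<le> card U"
    and R: "1 \<le> R" "R \<le> kg" "(r + 2) * (2 * t + 2) \<le> R" and s: "s \<ge> 1"
    and size: "witness_size d s t \<le> w" and \<delta>2: "\<delta>2 \<le> 1 / 2 ^ (last_len * w)"
    and \<kappa>: "\<kappa> \<ge> 1" "real d * lam k \<le> \<kappa> * 2 ^ last_len"
    and \<rho>: "\<rho> \<ge> 1" "real (length xs) \<le> \<rho> * 2 ^ L"
    and \<eta>: "\<eta> \<ge> 0" and lam0: "real (length xs) \<le> lam 0"
    and step: "\<And>i Y tg. i \<in> {1..k} \<Longrightarrow> Y \<subseteq> set xs \<Longrightarrow> real (card Y) \<le> lam (i - 1) \<Longrightarrow>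
      (\<And>y. y \<in> Y \<Longrightarrow> length (tg y) = block_len L k i) \<Longrightarrow>
      prob (D i) {q. real (card {y \<in> Y. q y = tg y}) > lam i} \<le> \<eta>"
  shows "prob (Pi_pmf {..<d} undefined (\<lambda>_. hash))
      {h. \<exists>load. uniform_greedy d h xs load \<and> max_load L load > s + t + 2 * r + 2}
    \<le> (real R + 1) * (\<rho> * real (d * R) ^ d) ^ R / 2 ^ (L * (r + 1))
      + (real d * (real k * 2 ^ L * \<eta>) + 2 ^ L * (2 ^ d * (\<kappa> ^ (s + 1) / fact s) ^ (d ^ t)))"
    (is "prob ?M ?bad \<le> _")
proof -
  let ?V = "bitstrings L" and ?o = "block_off L k k"
  define X where "X = set xs"
  have X: "X \<subseteq> U" "finite X" and cX: "card X = length xs"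
    using xs by (auto simp: X_def distinct_card)
  define C where "C h i y v \<longleftrightarrow> i < d \<and> y \<in> X \<and> take ?o v = take ?o (h i y)"
    for h :: "nat \<Rightarrow> 'a \<Rightarrow> bool list" and i y v
  let ?E1 = "{h. \<exists>A\<subseteq>X. card A \<le> R \<and> card (\<Union>y\<in>A. (\<lambda>i. h i y) ` {..<d}) + r < (d - 1) * card A}"
  let ?E2 = "{h. \<exists>v\<in>?V. \<exists>\<sigma>\<in>witnesses d s X ?V (C h) t v.
         card \<sigma> = witness_size d s t \<and> (\<forall>(i, y, u)\<in>\<sigma>. i < d \<and> y \<in> X \<and> h i y = u)}"
  have "?bad \<inter> set_pmf ?M \<subseteq> ?E1 \<union> ?E2"
  proof
    fix h assume h: "h \<in> ?bad \<inter> set_pmf ?M"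
    then obtain load where load: "uniform_greedy d h xs load" "max_load L load > s + t + 2 * r + 2" by auto
    have hV: "h i x \<in> ?V" if "i < d" "x \<in> X" for i x
    proof -
      have "h i \<in> set_pmf hash" using h that by (simp add: set_Pi_pmf PiE_dflt_def)
      then show ?thesis using hash_supp X that by blast
    qed
    obtain alloc ht where ah: "\<forall>x\<in>set xs. alloc x \<in> (\<lambda>i. h i x) ` {..<d} \<and> (\<forall>i<d. ht x \<le> load (h i x) + 1)"
        "\<forall>v t. 1 \<le> t \<and> t \<le> load v \<longrightarrow> (\<exists>x\<in>set xs. alloc x = v \<and> ht x = t)"
      using greedy_heights[OF load(1) xs(1)] by blast
    interpret ga: greedy_allocation d h X load alloc ht
      by unfold_locales (use ah d X in \<open>simp_all add: X_def\<close>)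
    have "max_load L load \<in> load ` ?V" unfolding max_load_def by (intro Max_in) auto
    then obtain b0 where "max_load L load = load b0" by blast
    then have b0: "load b0 \<ge> s + t + 2 * r + 3" using load(2) by linarith
    show "h \<in> ?E1 \<union> ?E2"
    proof (cases "h \<in> ?E1")
      case False
      have sparse: "(d - 1) * card A \<le> card (ga.Bins A) + r" if "A \<subseteq> X" "card A \<le> R" for A
        using False that by (auto simp: ga.Bins_def ga.bins_def not_less)
      have "\<exists>v\<in>?V. \<exists>\<sigma>\<in>witnesses d s X ?V (C h) t v. card \<sigma> = witness_size d s t \<and>
          (\<forall>(i, y, u)\<in>\<sigma>. i < d \<and> y \<in> X \<and> h i y = u)"
        by (rule ga.overloaded_bin_has_witness[OF sparse R(3) b0 s _ hV]) (auto simp: C_def)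
      then show ?thesis by blast
    qed blast
  qed
  then have "prob ?M (?bad \<inter> set_pmf ?M) \<le> prob ?M (?E1 \<union> ?E2)"
    by (intro measure_pmf.finite_measure_mono) auto
  then have "prob ?M ?bad \<le> prob ?M (?E1 \<union> ?E2)"
    by (simp add: measure_Int_set_pmf)
  also have "\<dots> \<le> prob ?M ?E1 + prob ?M ?E2"
    by (rule measure_Un_le) auto
  also have "prob ?M ?E1 \<le> (real R + 1) * (\<rho> * real (d * R) ^ d) ^ R / real (card ?V) ^ (r + 1)"
  proof (rule crowded_prob)
    fix i A f assume A: "A \<subseteq> X" "card A \<le> R"
    show "prob hash {g. \<forall>y\<in>A. g y = f y} \<le> 1 / real (card ?V) ^ card A"
      using hash_independent[OF kg, of A f] A X R by (simp add: power_mult)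
  qed (use X d R \<rho> hash_supp cX in auto)
  also have "real (card ?V) ^ (r + 1) = 2 ^ (L * (r + 1))" by (simp add: power_add power_mult)
  also have "prob ?M ?E2 \<le> real d * (real k * 2 ^ L * \<eta>) + 2 ^ L * (2 ^ d * (\<kappa> ^ (s + 1) / fact s) ^ (d ^ t))"
  proof -
    let ?Q = "Pi_pmf {..<d} undefined (\<lambda>_::nat. prefix_part)"
    let ?over = "{a. \<exists>v\<in>bitstrings L. real (card {y \<in> X. take ?o v = prefix_value a y}) > lam k}"
    let ?B = "{f :: nat \<Rightarrow> _. \<exists>i<d. f i \<in> ?over}"
    \<comment> \<open>The prefix parts of all \<open>d\<close> functions are drawn first, since a
      tree mixes constraints on all of them.\<close>
    have "?M = bind_pmf ?Q (\<lambda>f. Pi_pmf {..<d} undefined (\<lambda>i. completion (f i)))"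
      unfolding hash_eq_bind by (rule Pi_pmf_bind) simp
    moreover have "prob (bind_pmf ?Q (\<lambda>f. Pi_pmf {..<d} undefined (\<lambda>i. completion (f i)))) ?E2
        \<le> prob ?Q ?B + 2 ^ L * (2 ^ d * (\<kappa> ^ (s + 1) / fact s) ^ (d ^ t))"
    proof (rule prob_bind_le)
      show "0 \<le> 2 ^ L * (2 ^ d * (\<kappa> ^ (s + 1) / fact s) ^ (d ^ t))" using \<kappa> by simp
      fix f assume f: "f \<in> set_pmf ?Q" "f \<notin> ?B"
      have fi: "f i \<in> set_pmf prefix_part" if "i < d" for i
        using f(1) that by (simp add: set_Pi_pmf PiE_dflt_def)
      have light: "real (card {y \<in> X. take ?o v = prefix_value (f i) y}) \<le> lam k" if "i < d" "v \<in> ?V" for i v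
      proof -
        have "f i \<notin> ?over" using f(2) that(1) by blast
        then show ?thesis using that(2) by (simp add: not_less)
      qed
      show "prob (Pi_pmf {..<d} undefined (\<lambda>i. completion (f i))) ?E2
          \<le> 2 ^ L * (2 ^ d * (\<kappa> ^ (s + 1) / fact s) ^ (d ^ t))"
        using witness_prob[OF d X(1) size \<delta>2 \<kappa> fi light] unfolding C_def by simp
    qed
    moreover have "prob ?Q ?B \<le> real d * (real k * 2 ^ L * \<eta>)"
    proof -
      have "?B = (\<Union>i<d. {f. f i \<in> ?over})" by auto
      then have "prob ?Q ?B \<le> (\<Sum>i<d. prob ?Q {f. f i \<in> ?over})"
        by (simp only:) (rule measure_pmf.finite_measure_subadditive_finite, auto)
      also have "\<dots> \<le> (\<Sum>i<d. real k * 2 ^ L * \<eta>)"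
      proof (rule sum_mono)
        fix i assume i: "i \<in> {..<d}"
        have "prob ?Q {f. f i \<in> ?over} = prob (map_pmf (\<lambda>f. f i) ?Q) ?over"
          by (simp add: vimage_def)
        also have "map_pmf (\<lambda>f. f i) ?Q = prefix_part" using i by (subst Pi_pmf_component) auto
        also have "prob prefix_part ?over \<le> real k * 2 ^ L * \<eta>"
          using X \<eta> lam0 step cX by (intro prefix_load) (auto simp: X_def)
        finally show "prob ?Q {f. f i \<in> ?over} \<le> real k * 2 ^ L * \<eta>" .
      qed
      finally show ?thesis by simp
    qed
    ultimately show ?thesis by simp
  qed
  finally show ?thesis by simp
qed

end

section \<open>Choice of the parameters\<close>

lemma eventually_large:
  fixes A :: real
  shows "\<exists>N. \<forall>L\<ge>N. A \<le> real L \<and> A * (log 2 (real L))\<^sup>2 \<le> real L \<and> A * (real L)\<^sup>2 < 2 ^ L"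
proof -
  define A' where "A' = max A 1"
  have A': "A' > 0" "A \<le> A'" by (auto simp: A'_def)
  have "(\<lambda>L. (log 2 (real L))\<^sup>2 / real L) \<longlonglongrightarrow> 0" by real_asymp
  then have 1: "eventually (\<lambda>L. (log 2 (real L))\<^sup>2 / real L < 1 / A') sequentially"
    using A' by (intro order_tendstoD(2)) auto
  have "(\<lambda>L. (real L)\<^sup>2 / 2 ^ L) \<longlonglongrightarrow> 0" by real_asymp
  then have 2: "eventually (\<lambda>L. (real L)\<^sup>2 / 2 ^ L < 1 / A') sequentially"
    using A' by (intro order_tendstoD(2)) auto
  have 3: "eventually (\<lambda>L. L \<ge> nat \<lceil>A'\<rceil>) sequentially" by (rule eventually_ge_at_top)
  have "eventually (\<lambda>L. A \<le> real L \<and> A * (log 2 (real L))\<^sup>2 \<le> real L \<and> A * (real L)\<^sup>2 < 2 ^ L) sequentially"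
    using 1 2 3
  proof eventually_elim
    case (elim L)
    then have L: "A' \<le> real L" by linarith
    then have L0: "real L > 0" using A' by linarith
    have "A * (log 2 (real L))\<^sup>2 \<le> A' * (log 2 (real L))\<^sup>2" using A' by (intro mult_right_mono) auto
    also have "\<dots> < real L" using elim(1) A' L0 by (simp add: field_simps)
    finally have a: "A * (log 2 (real L))\<^sup>2 \<le> real L" by simp
    have "A * (real L)\<^sup>2 \<le> A' * (real L)\<^sup>2" using A' by (intro mult_right_mono) auto
    also have "\<dots> < 2 ^ L" using elim(2) A' by (simp add: field_simps)
    finally show ?case using a L A' by linarith
  qed
  then show ?thesis by (simp add: eventually_sequentially)
qed

lemma power_over_fact_le_exp: "x \<ge> 0 \<Longrightarrow> x ^ n / fact n \<le> exp (x :: real)"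
proof -
  assume x: "x \<ge> 0"
  have "(\<lambda>n. x ^ n /\<^sub>R fact n) sums exp x" by (rule exp_converges)
  then have "(\<Sum>i\<in>{n}. x ^ i /\<^sub>R fact i) \<le> exp x"
    using x by (intro sum_le_suminf[of _ "{n}", THEN order_trans]) (auto simp: sums_iff)
  then show ?thesis by (simp add: divide_inverse mult.commute)
qed

text \<open>One term of the exponential series gives \<open>(4 * \<kappa>) ^ s / fact s \<le> exp (4
  * \<kappa>) \<le> 2 powr (8 * \<kappa>)\<close>, and the spare \<open>\<kappa>\<close> is at most
  \<open>2 powr (2 * \<kappa>)\<close>; together \<open>2 powr (10 * \<kappa>) \<le> 2 ^ s\<close>,
  which uses up half of the \<open>4 ^ s\<close>.\<close>

lemma witness_weight:
  fixes \<kappa> :: real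
  assumes \<kappa>: "\<kappa> \<ge> 1" and s: "real s \<ge> 10 * \<kappa>"
  shows "\<kappa> ^ (s + 1) / fact s \<le> 1 / 2 ^ s"
proof -
  have ln2: "ln 2 \<ge> (1 / 2 :: real)" using ln2_ge_two_thirds by simp
  have e: "exp x \<le> 2 powr (2 * x)" if "x \<ge> 0" for x :: real
  proof -
    have "x * 1 \<le> x * (2 * ln 2)" using that ln2 by (intro mult_left_mono) auto
    then show ?thesis by (simp add: powr_def mult_ac)
  qed
  have "4 ^ s * (\<kappa> ^ s / fact s) = (4 * \<kappa>) ^ s / fact s" by (simp add: power_mult_distrib)
  also have "\<dots> \<le> exp (4 * \<kappa>)" using \<kappa> by (intro power_over_fact_le_exp) simp
  also have "\<dots> \<le> 2 powr (8 * \<kappa>)" using e[of "4 * \<kappa>"] \<kappa> by simp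
  finally have 1: "4 ^ s * (\<kappa> ^ s / fact s) \<le> 2 powr (8 * \<kappa>)" .
  have "\<kappa> \<le> exp \<kappa>" using exp_ge_add_one_self[of \<kappa>] by linarith
  also have "\<dots> \<le> 2 powr (2 * \<kappa>)" using e[of \<kappa>] \<kappa> by simp
  finally have "\<kappa> * (4 ^ s * (\<kappa> ^ s / fact s)) \<le> 2 powr (2 * \<kappa>) * 2 powr (8 * \<kappa>)"
    using 1 \<kappa> by (intro mult_mono) auto
  also have "\<dots> = 2 powr (10 * \<kappa>)" by (simp flip: powr_add)
  also have "\<dots> \<le> 2 powr real s" using s by (intro powr_mono) auto
  also have "\<dots> = 2 ^ s" by (simp add: powr_realpow)
  finally have "4 ^ s * (\<kappa> ^ (s + 1) / fact s) \<le> 2 ^ s" by (simp add: mult_ac)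
  then have "2 ^ s * (2 ^ s * (\<kappa> ^ (s + 1) / fact s)) \<le> 2 ^ s * 1"
    by (simp add: power_mult_distrib[symmetric] mult.assoc[symmetric])
  then have "2 ^ s * (\<kappa> ^ (s + 1) / fact s) \<le> 1" by (rule mult_left_le_imp_le) simp
  then show ?thesis by (simp add: field_simps)
qed

text \<open>\<open>k\<close> is the last level at which at least \<open>r\<close> bits remain;
  halving once more falls below \<open>r\<close>, so fewer than \<open>2 * r\<close> remain.\<close>

lemma exists_cutoff:
  fixes L r :: nat
  assumes "1 \<le> r" "r \<le> L"
  shows "\<exists>k. r \<le> L div 2 ^ k \<and> L div 2 ^ k < 2 * r \<and> 2 ^ k \<le> L"
proof -
  have ex: "r \<le> L div 2 ^ 0" using assms by simp
  have bound: "y \<le> L" if "r \<le> L div 2 ^ y" for y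
  proof -
    from that have "L div 2 ^ y > 0" using assms(1) by linarith
    then have "2 ^ y \<le> L" by (simp add: div_greater_zero_iff)
    then show "y \<le> L" using less_exp[of y] by linarith
  qed
  define k where "k = (GREATEST k. r \<le> L div 2 ^ k)"
  have k: "r \<le> L div 2 ^ k" unfolding k_def using ex bound by (rule GreatestI_nat)
  have "\<not> r \<le> L div 2 ^ Suc k"
  proof
    assume "r \<le> L div 2 ^ Suc k"
    then have "Suc k \<le> k" unfolding k_def using bound by (rule Greatest_le_nat)
    then show False by simp
  qed
  moreover have "L div 2 ^ Suc k = L div 2 ^ k div 2"
    by (simp add: div_mult2_eq mult.commute[of 2])
  ultimately have "L div 2 ^ k < 2 * r" by linarith
  moreover have "2 ^ k \<le> L" proof -
    have "0 < L div 2 ^ k" using k assms(1) by linarith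
    then show ?thesis by (simp add: div_greater_zero_iff)
  qed
  ultimately show ?thesis using k by blast
qed

text \<open>The tail bound with exponent \<open>2 * h\<close>, hit probability
  \<open>2 ^ (- b)\<close> and deviation \<open>1 / k\<close>. By \<open>hk\<close>, the moment term
  is about \<open>2 ^ (- r * h / 2)\<close>. In the bias term, the ratio
  \<open>2 * card Y * k / (x * 2 ^ r)\<close> is at most \<open>2 ^ (4 * r)\<close>, so the bias has
  to beat \<open>2 ^ (8 * h * r)\<close>.\<close>

lemma biased_level_tail:
  fixes x :: real
  assumes finU: "finite U" and D: "kwise_biased w (1 / 2 ^ e) b U D" and Y: "Y \<subseteq> U"
    and tg: "\<And>y. y \<in> Y \<Longrightarrow> length (tg y) = b"
    and cY: "real (card Y) \<le> x * 2 ^ (b + r)" and x: "x \<ge> 1" and b: "b \<le> r + 1" and r: "r \<ge> 1"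
    and k: "k \<ge> 1" "k \<le> 2 ^ r" and h: "h \<ge> 1" "2 * h \<le> w" "2 * u \<le> h * r"
    and hk: "(2 * h * k) ^ 2 \<le> 2 ^ (r div 2)" and e: "8 * h * r + u \<le> e"
  shows "prob D {q. real (card {y \<in> Y. q y = tg y}) > (1 + 1 / real k) * (x * 2 ^ r)}
    \<le> (2 * real h + 1) / 2 ^ u"
proof -
  let ?p = "2 * h" and ?\<mu> = "x * 2 ^ r" and ?\<delta> = "1 / 2 ^ e :: real" and ?q = "1 / 2 ^ b :: real"
  have finY: "finite Y" using Y finU finite_subset by blast
  have "set_pmf D \<subseteq> vecs b U" using D by (simp add: kwise_biased_def)
  then have finD: "finite (set_pmf D)" using finite_vecs[OF finU] finite_subset by blast
  have \<mu>r: "?\<mu> \<ge> 2 ^ r" using x mult_right_mono[of 1 x "2 ^ r"] by simp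
  have one: "(2::real) ^ r \<ge> 1" by simp
  have \<mu>1: "?\<mu> \<ge> 1" using \<mu>r one by linarith
  have cq: "real (card Y) * ?q \<le> ?\<mu>" using cY by (simp add: power_add field_simps)
  have "prob D {q. real (card {y \<in> Y. q y = tg y}) > (1 + 1 / real k) * ?\<mu>}
      \<le> (real ?p ^ (?p + 1) * ?\<mu> ^ (?p div 2) + real ((2 * card Y) ^ ?p) * ?\<delta>) / (1 / real k * ?\<mu>) ^ ?p"
  proof (rule tail_bound[where q = ?q])
    fix B assume B: "B \<subseteq> Y" "card B \<le> ?p"
    have "\<bar>prob D {q. \<forall>y\<in>B. q y = tg y} - 1 / 2 ^ (b * card B)\<bar> \<le> ?\<delta>"
      using B Y tg h by (intro kwise_biased_prob[OF finU D]) auto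
    then show "\<bar>prob D {q. \<forall>y\<in>B. q y = tg y} - ?q ^ card B\<bar> \<le> ?\<delta>"
      by (simp add: power_divide power_mult)
  qed (use finD finY \<mu>1 cq h k in auto)
  also have "\<dots> = real ?p * ((real (2 * h * k)) ^ 2 / ?\<mu>) ^ h + (2 * real (card Y) * real k / ?\<mu>) ^ ?p * ?\<delta>"
  proof -
    have p0: "real ?p > 0" "?\<mu> > 0" "real k > 0" using h k \<mu>1 by auto
    have "real ?p ^ (?p + 1) * ?\<mu> ^ (?p div 2) / (1 / real k * ?\<mu>) ^ ?p
        = real ?p * (real ?p ^ ?p * real k ^ ?p * ?\<mu> ^ h / (?\<mu> ^ h * ?\<mu> ^ h))"
    proof -
      have "?\<mu> ^ ?p = ?\<mu> ^ h * ?\<mu> ^ h" by (simp only: mult_2 power_add)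
      then show ?thesis by (simp add: power_mult_distrib power_divide)
    qed
    also have "\<dots> = real ?p * (real ?p ^ ?p * real k ^ ?p / ?\<mu> ^ h)" using p0 by simp
    also have "\<dots> = real ?p * ((real (2 * h * k)) ^ 2 / ?\<mu>) ^ h"
    proof -
      have "real ?p ^ ?p * real k ^ ?p = (real (2 * h * k)) ^ ?p" by (simp add: power_mult_distrib)
      also have "\<dots> = ((real (2 * h * k)) ^ 2) ^ h" by (rule power_mult)
      finally show ?thesis by (simp add: power_divide)
    qed
    finally have 1: "real ?p ^ (?p + 1) * ?\<mu> ^ (?p div 2) / (1 / real k * ?\<mu>) ^ ?p
        = real ?p * ((real (2 * h * k)) ^ 2 / ?\<mu>) ^ h" .
    have 2: "real ((2 * card Y) ^ ?p) * ?\<delta> / (1 / real k * ?\<mu>) ^ ?p = (2 * real (card Y) * real k / ?\<mu>) ^ ?p * ?\<delta>"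
      by (simp add: power_mult_distrib power_divide)
    show ?thesis unfolding add_divide_distrib 1 2 by (rule refl)
  qed
  also have "\<dots> \<le> real ?p * (1 / 2 ^ u) + 1 / 2 ^ u"
  proof (rule add_mono)
    let ?r' = "r - r div 2"
    have "(real (2 * h * k)) ^ 2 \<le> 2 ^ (r div 2)"
      using hk by (metis of_nat_le_numeral_power_cancel_iff of_nat_power)
    then have "(real (2 * h * k)) ^ 2 / ?\<mu> \<le> 2 ^ (r div 2) / 2 ^ r"
      using \<mu>r by (intro frac_le) auto
    also have "\<dots> = 1 / 2 ^ ?r'" by (subst power_diff) auto
    finally have "((real (2 * h * k)) ^ 2 / ?\<mu>) ^ h \<le> (1 / 2 ^ ?r') ^ h"
      using \<mu>1 by (intro power_mono) auto
    also have "\<dots> = 1 / 2 ^ (?r' * h)" by (simp add: power_divide power_mult)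
    also have "\<dots> \<le> 1 / 2 ^ u"
    proof (intro divide_left_mono power_increasing)
      have "2 * u \<le> h * (2 * ?r')" using h(3) by (rule order_trans) (intro mult_left_mono, linarith, simp)
      then show "u \<le> ?r' * h" by (simp add: mult_ac)
    qed auto
    finally show "real ?p * ((real (2 * h * k)) ^ 2 / ?\<mu>) ^ h \<le> real ?p * (1 / 2 ^ u)"
      by (intro mult_left_mono) auto
    have "2 * real (card Y) * real k / ?\<mu> \<le> 2 ^ (4 * r)"
    proof -
      have kr: "real k \<le> 2 ^ r" using k(2) by (metis of_nat_le_iff of_nat_numeral of_nat_power)
      have "2 * real (card Y) * real k \<le> 2 * (x * 2 ^ (b + r)) * 2 ^ r"
        using cY kr by (intro mult_mono) auto
      also have "\<dots> = ?\<mu> * 2 ^ (Suc (b + r))" by (simp add: power_add)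
      also have "\<dots> \<le> ?\<mu> * 2 ^ (4 * r)" using b r \<mu>1 by (intro mult_left_mono power_increasing) auto
      finally show ?thesis using \<mu>1 by (simp add: field_simps)
    qed
    then have "(2 * real (card Y) * real k / ?\<mu>) ^ ?p \<le> (2 ^ (4 * r)) ^ ?p"
      using \<mu>1 by (intro power_mono) auto
    also have "\<dots> = 2 ^ (8 * h * r)" by (simp flip: power_mult add: mult_ac)
    finally have "(2 * real (card Y) * real k / ?\<mu>) ^ ?p * ?\<delta> \<le> 2 ^ (8 * h * r) * ?\<delta>"
      by (intro mult_right_mono) auto
    also have "\<dots> \<le> 1 / 2 ^ u"
    proof -
      have "(2::real) ^ (8 * h * r) * 2 ^ u \<le> 2 ^ e"
        unfolding power_add[symmetric] using e by (intro power_increasing) auto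
      then show ?thesis by (simp add: field_simps)
    qed
    finally show "(2 * real (card Y) * real k / ?\<mu>) ^ ?p * ?\<delta> \<le> 1 / 2 ^ u" .
  qed
  also have "\<dots> = (2 * real h + 1) / 2 ^ u" by (simp add: add_divide_distrib)
  finally show ?thesis .
qed

text \<open>Each of the three error terms is brought down to \<open>n ^ (- (c + 1))\<close>.
  \<open>C0 = c + 4\<close> leaves room for the \<open>2 ^ L\<close> strings and for polynomial
  factors in \<open>L\<close>; \<open>17 * C0 + 8\<close> is \<open>8 * (2 * C0 + 1) + C0\<close>,
  from the bias term of a level; \<open>c + 3\<close> in \<open>s\<close> covers the
  \<open>2 ^ L\<close> roots and \<open>2 ^ d \<le> 2 ^ L\<close>.\<close>

lemma (in hash_components) max_load_whp:
  fixes \<rho> :: real and c d s t r g C0 :: nat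
  assumes d: "d \<ge> 2" and xs: "distinct xs" "set xs \<subseteq> U" and kgU: "kg \<le> card U"
    and \<rho>: "\<rho> \<ge> 1" "real (length xs) = \<rho> * 2 ^ L"
    and k: "1 \<le> k" "k \<le> L" and g: "L \<le> 2 ^ g" "12 * g \<le> L div 2 ^ k" "g \<ge> 1"
    and C0: "C0 = c + 4" "4 * C0 + 2 \<le> L"
    and \<delta>1: "\<delta>1 = 1 / 2 ^ ((17 * C0 + 8) * L)" and \<delta>2: "\<delta>2 = 1 / 2 ^ ((L div 2 ^ k) * w)"
    and w: "(4 * C0 + 2) * L \<le> w" "witness_size d s t \<le> w"
    and t: "L \<le> d ^ t" and s: "real s \<ge> 12 * (3 * real d * \<rho>) + real c + 3"
    and r: "r = c + 1" and kg: "kg = (r + 2) * (2 * t + 2)"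
    and H1: "(real kg + 1) * (\<rho> * real (d * kg) ^ d) ^ kg \<le> 2 ^ L"
    and H2: "d * L * ((4 * C0 + 2) * L + 1) \<le> 2 ^ L" and H3: "d \<le> L"
  shows "prob (Pi_pmf {..<d} undefined (\<lambda>_. hash))
      {h. \<exists>load. uniform_greedy d h xs load \<and> max_load L load > s + t + 2 * r + 2}
    \<le> 3 / 2 ^ ((c + 1) * L)"
proof -
  \<comment> \<open>The ideal load after \<open>i\<close> levels is \<open>\<rho>\<close> times 2 to
    the number of bits still open; each level adds a relative error \<open>1 / k\<close>, below a
    factor 3 after \<open>k\<close> levels.\<close>
  define lam where "lam i = (1 + 1 / real k) ^ i * \<rho> * 2 ^ (L div 2 ^ i)" for i
  define \<eta> where "\<eta> = (real ((4 * C0 + 2) * L) + 1) / 2 ^ (C0 * L)"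
  define \<kappa> where "\<kappa> = 3 * real d * \<rho>"
  have \<kappa>1: "\<kappa> \<ge> 1" using d \<rho> mult_mono[of 1 "3 * real d" 1 \<rho>] by (simp add: \<kappa>_def)
  have ll: "last_len = L div 2 ^ k" by (simp add: block_len_def)
  have "prob (Pi_pmf {..<d} undefined (\<lambda>_. hash))
      {h. \<exists>load. uniform_greedy d h xs load \<and> max_load L load > s + t + 2 * r + 2}
    \<le> (real kg + 1) * (\<rho> * real (d * kg) ^ d) ^ kg / 2 ^ (L * (r + 1))
      + (real d * (real k * 2 ^ L * \<eta>) + 2 ^ L * (2 ^ d * (\<kappa> ^ (s + 1) / fact s) ^ (d ^ t)))"
  proof (rule max_load_tail[where lam = lam])
    show "1 \<le> kg" "(r + 2) * (2 * t + 2) \<le> kg" by (simp_all add: kg)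
    have "0 \<le> 12 * (3 * real d * \<rho>)" using \<rho> by simp
    then show "1 \<le> s" using s by linarith
    show "\<delta>2 \<le> 1 / 2 ^ (last_len * w)" unfolding \<delta>2 ll by simp
    show "real d * lam k \<le> \<kappa> * 2 ^ last_len"
    proof -
      have "(1 + 1 / real k) ^ k \<le> exp 1" using exp_ge_one_plus_x_over_n_power_n[of k 1] k by simp
      also have "\<dots> \<le> 3" by (rule exp_le)
      finally have "real d * (\<rho> * 2 ^ last_len) * (1 + 1 / real k) ^ k \<le> real d * (\<rho> * 2 ^ last_len) * 3"
        using \<rho> by (intro mult_left_mono) auto
      then show ?thesis unfolding lam_def \<kappa>_def ll by (simp add: mult_ac)
    qed
    show "real (length xs) \<le> lam 0" "real (length xs) \<le> \<rho> * 2 ^ L" using \<rho> by (simp_all add: lam_def)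
    show "\<eta> \<ge> 0" by (simp add: \<eta>_def)
    fix i :: nat and Y :: "'a set" and tg :: "'a \<Rightarrow> bool list"
    assume i: "i \<in> {1..k}" and Y: "Y \<subseteq> set xs" "real (card Y) \<le> lam (i - 1)"
      and tg: "\<And>y. y \<in> Y \<Longrightarrow> length (tg y) = block_len L k i"
    let ?r = "L div 2 ^ i" and ?b = "block_len L k i"
    txt \<open>The exponent \<open>2 * h\<close> of the moment is chosen such that \<open>h * ?r\<close> is proportional to \<open>L\<close>: the
      moment contributes about \<open>2 ^ (- h * ?r / 2)\<close>, the bias about \<open>2 ^ (8 * h * ?r) * \<delta>1\<close>.\<close>
    define h where "h = 2 * C0 * L div ?r + 1"
    obtain i' where i': "i = Suc i'" using i by (cases i) auto
    have "L div 2 ^ k \<le> ?r" using i by (intro div_le_mono2 power_increasing) auto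
    then have rg: "12 * g \<le> ?r" using g by linarith
    have half: "?r = L div 2 ^ i' div 2" unfolding i' by (simp add: div_mult2_eq mult.commute[of 2])
    have b: "?b = L div 2 ^ i' - ?r" using i by (simp add: block_len_def i')
    have br: "?b + ?r = L div 2 ^ i'" "?b \<le> ?r + 1" using b half by linarith+
    have rL: "?r \<le> L" by (rule div_le_dividend)
    have hr1: "2 * (C0 * L) \<le> h * ?r"
    proof -
      have "?r > 0" using rg g by linarith
      then have "2 * C0 * L < h * ?r" unfolding h_def by (simp add: dividend_less_div_times)
      then show ?thesis by simp
    qed
    have hr2: "h * ?r \<le> (2 * C0 + 1) * L"
    proof -
      have "h * ?r = 2 * C0 * L div ?r * ?r + ?r" by (simp add: h_def)
      also have "\<dots> \<le> 2 * C0 * L + L" using rL by (intro add_mono div_times_less_eq_dividend) auto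
      finally show ?thesis by simp
    qed
    have "h * 1 \<le> h * ?r" using rg g by (intro mult_left_mono) auto
    then have "h \<le> (2 * C0 + 1) * L" using hr2 by linarith
    then have h2: "2 * h \<le> (4 * C0 + 2) * L" by (simp add: algebra_simps)
    have step: "prob (D i) {q. real (card {y \<in> Y. q y = tg y}) > (1 + 1 / real k) * ((1 + 1 / real k) ^ i' * \<rho> * 2 ^ ?r)}
        \<le> (2 * real h + 1) / 2 ^ (C0 * L)"
    proof (rule biased_level_tail[OF finU])
      show "kwise_biased w (1 / 2 ^ ((17 * C0 + 8) * L)) ?b U (D i)" using D1[OF i] \<delta>1 by simp
      show "Y \<subseteq> U" using Y xs by simp
      show "real (card Y) \<le> (1 + 1 / real k) ^ i' * \<rho> * 2 ^ (?b + ?r)"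
        using Y(2) unfolding br(1) by (simp add: lam_def i')
      show "1 \<le> (1 + 1 / real k) ^ i' * \<rho>"
        using \<rho> mult_mono[of 1 "(1 + 1 / real k) ^ i'" 1 \<rho>] by (simp add: one_le_power)
      show "1 \<le> ?r" using rg g by linarith
      have "k \<le> 2 ^ g" using k g by linarith
      also have "\<dots> \<le> 2 ^ ?r" using rg by (intro power_increasing) auto
      finally show "k \<le> 2 ^ ?r" .
      show "2 * h \<le> w" using h2 w by linarith
      \<comment> \<open>The sixth power of \<open>L \<le> 2 ^ g\<close> must fit into half of the
        remaining bits: this is the origin of \<open>12 * g\<close>.\<close>
      have "(2 * h * k) ^ 2 \<le> (L * L * L) ^ 2"
      proof (intro power_mono)
        have "2 * h * k \<le> (4 * C0 + 2) * L * L" by (intro mult_mono h2 k) auto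
        also have "\<dots> \<le> L * L * L" using C0 by (intro mult_mono) auto
        finally show "2 * h * k \<le> L * L * L" .
      qed simp
      also have "\<dots> = L ^ 6" by (simp add: power2_eq_square power_numeral_reduce)
      also have "\<dots> \<le> (2 ^ g) ^ 6" using g by (intro power_mono) auto
      also have "\<dots> = 2 ^ (6 * g)" by (simp flip: power_mult add: mult.commute)
      also have "\<dots> \<le> 2 ^ (?r div 2)" using rg by (intro power_increasing) auto
      finally show "(2 * h * k) ^ 2 \<le> 2 ^ (?r div 2)" .
      have "8 * h * ?r = 8 * (h * ?r)" by simp
      also have "\<dots> \<le> 8 * ((2 * C0 + 1) * L)" using hr2 by simp
      finally show "8 * h * ?r + C0 * L \<le> (17 * C0 + 8) * L" by (simp add: algebra_simps)
    qed (use tg br k hr1 in \<open>auto simp: h_def\<close>)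
    have "lam i = (1 + 1 / real k) * ((1 + 1 / real k) ^ i' * \<rho> * 2 ^ ?r)" by (simp add: lam_def i')
    moreover have "(2 * real h + 1) / 2 ^ (C0 * L) \<le> \<eta>"
    proof -
      have "2 * real h \<le> real ((4 * C0 + 2) * L)" using h2 by (metis of_nat_le_iff of_nat_mult of_nat_numeral)
      then show ?thesis unfolding \<eta>_def by (intro divide_right_mono add_right_mono) auto
    qed
    ultimately show "prob (D i) {q. real (card {y \<in> Y. q y = tg y}) > lam i} \<le> \<eta>"
      using step by simp
  qed (use d xs kgU w \<kappa>1 \<rho> in auto)
  also have "\<dots> \<le> 1 / 2 ^ ((c + 1) * L) + (1 / 2 ^ ((c + 1) * L) + 1 / 2 ^ ((c + 1) * L))"
  proof (intro add_mono)
    have "(real kg + 1) * (\<rho> * real (d * kg) ^ d) ^ kg / 2 ^ (L * (r + 1)) \<le> 2 ^ L / 2 ^ (L * (r + 1))"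
      by (rule divide_right_mono[OF H1]) simp
    also have "\<dots> = 1 / 2 ^ ((c + 1) * L)" by (simp add: r power_add algebra_simps)
    finally show "(real kg + 1) * (\<rho> * real (d * kg) ^ d) ^ kg / 2 ^ (L * (r + 1)) \<le> 1 / 2 ^ ((c + 1) * L)" .
    have "real d * (real k * 2 ^ L * \<eta>) = real d * real k * (real ((4 * C0 + 2) * L) + 1) * (2 ^ L / 2 ^ (C0 * L))"
      by (simp add: \<eta>_def)
    also have "\<dots> \<le> 2 ^ L * (2 ^ L / 2 ^ (C0 * L))"
    proof (rule mult_right_mono)
      have "real d * real k * (real ((4 * C0 + 2) * L) + 1) \<le> real d * real L * (real ((4 * C0 + 2) * L) + 1)"
        using k by (intro mult_right_mono mult_left_mono) auto
      also have "\<dots> = real (d * L * ((4 * C0 + 2) * L + 1))" by (simp add: algebra_simps)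
      also have "\<dots> \<le> 2 ^ L" using H2 by (metis of_nat_le_iff of_nat_numeral of_nat_power)
      finally show "real d * real k * (real ((4 * C0 + 2) * L) + 1) \<le> 2 ^ L" .
    qed simp
    also have "\<dots> = 2 ^ (2 * L) / 2 ^ (C0 * L)" by (simp add: power_add mult_2)
    also have "\<dots> \<le> 1 / 2 ^ ((c + 1) * L)"
    proof -
      have "2 ^ (2 * L) * 2 ^ ((c + 1) * L) \<le> (2 :: real) ^ (C0 * L)"
        unfolding power_add[symmetric] by (intro power_increasing) (auto simp: C0 algebra_simps)
      then show ?thesis by (simp add: field_simps)
    qed
    finally show "real d * (real k * 2 ^ L * \<eta>) \<le> 1 / 2 ^ ((c + 1) * L)" .
    have "real s \<ge> 10 * \<kappa>" using s \<kappa>1 by (simp add: \<kappa>_def)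
    then have "\<kappa> ^ (s + 1) / fact s \<le> 1 / 2 ^ s" by (rule witness_weight[OF \<kappa>1])
    also have "\<dots> \<le> 1 / 2 ^ (c + 3)"
    proof (intro divide_left_mono power_increasing)
      show "c + 3 \<le> s" using s \<kappa>1 by (simp add: \<kappa>_def)
    qed auto
    finally have "(\<kappa> ^ (s + 1) / fact s) ^ (d ^ t) \<le> (1 / 2 ^ (c + 3)) ^ (d ^ t)"
      using \<kappa>1 by (intro power_mono) auto
    also have "\<dots> \<le> (1 / 2 ^ (c + 3)) ^ L"
      using t by (intro power_decreasing) auto
    also have "\<dots> = 1 / 2 ^ ((c + 3) * L)" by (simp add: power_divide flip: power_mult)
    finally have "2 ^ L * (2 ^ d * (\<kappa> ^ (s + 1) / fact s) ^ (d ^ t)) \<le> 2 ^ L * (2 ^ L * (1 / 2 ^ ((c + 3) * L)))"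
      using H3 \<kappa>1 by (intro mult_left_mono mult_mono power_increasing) auto
    also have "\<dots> = 1 / 2 ^ ((c + 1) * L)"
    proof -
      have "(c + 3) * L = (c + 1) * L + L + L" by (simp add: algebra_simps)
      then show ?thesis by (simp add: power_add)
    qed
    finally show "2 ^ L * (2 ^ d * (\<kappa> ^ (s + 1) / fact s) ^ (d ^ t)) \<le> 1 / 2 ^ ((c + 1) * L)" .
  qed
  finally show ?thesis by simp
qed

text \<open>A seed of \<open>2 * e + L\<close> bits suffices for bias \<open>2 ^ (- e)\<close>: the
  number of samples times the squared bias is \<open>2 ^ L\<close>, which exceeds the logarithm of
  the number of characters.\<close>

lemma exists_hash_family:
  assumes fin: "finite U" and U: "card U \<le> 2 ^ (a * L)"
    and large: "2 * (((a + 1) * L + 1) * w + 1) < (2::nat) ^ L"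
  shows "\<exists>S. hash_family L U w (1 / 2 ^ e1) (1 / 2 ^ e2) k kg S \<and>
    sampled_with_bits (k * (2 * e1 + L) + (2 * e2 + L) + (((a + 1) * L + 1) * kg + 1)) S"
proof -
  let ?j = "(a + 1) * L + 1"
  have base: "card U * 2 ^ l + 1 \<le> 2 ^ ?j" if l: "l \<le> L" for l
  proof -
    have "card U * 2 ^ l \<le> 2 ^ (a * L) * 2 ^ L" using U l by (intro mult_mono power_increasing) auto
    also have "\<dots> = 2 ^ ((a + 1) * L)" by (simp add: power_add algebra_simps)
    finally have "card U * 2 ^ l + 1 \<le> 2 ^ ((a + 1) * L) + 2 ^ ((a + 1) * L)"
      by (intro add_mono) auto
    then show ?thesis by simp
  qed
  have biased: "\<exists>D. kwise_biased w (1 / 2 ^ e) l U D \<and> sampled_with_bits (2 * e + L) D" if l: "l \<le> L" for l e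
  proof (rule exists_kwise_biased[OF fin])
    have "2 * (card U * 2 ^ l + 1) ^ w \<le> 2 * (2 ^ ?j) ^ w"
      using base[OF l] by (intro mult_left_mono power_mono) auto
    also have "\<dots> = 2 ^ (?j * w + 1)" unfolding power_add power_mult by simp
    finally have "2 * real ((card U * 2 ^ l + 1) ^ w) \<le> 2 ^ (?j * w + 1)"
      by (metis of_nat_le_iff of_nat_mult of_nat_numeral of_nat_power)
    also have "\<dots> \<le> exp 1 ^ (?j * w + 1)"
      using exp_ge_add_one_self[of 1] by (intro power_mono) auto
    also have "\<dots> = exp (real (?j * w + 1))" by (simp only: exp_of_nat_mult[symmetric] mult_1_right)
    also have "\<dots> < exp (2 ^ L / 2)"
    proof -
      have "real (2 * (?j * w + 1)) < real (2 ^ L)" using large by (simp only: of_nat_less_iff)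
      then have "real (?j * w + 1) < 2 ^ L / 2" by (simp add: field_simps)
      then show ?thesis by (simp only: exp_less_mono)
    qed
    also have "(2::real) ^ L / 2 = 2 ^ (2 * e + L) * (1 / 2 ^ e)\<^sup>2 / 2"
    proof -
      have "(2::real) ^ (2 * e + L) = 2 ^ L * (2 ^ e)\<^sup>2" by (simp add: power_add power_mult power2_eq_square mult_2)
      then show ?thesis by (simp add: power_divide)
    qed
    finally show "2 * real ((card U * 2 ^ l + 1) ^ w) < exp (2 ^ (2 * e + L) * (1 / 2 ^ e)\<^sup>2 / 2)" .
  qed simp
  have bl: "block_len L k i \<le> L" for i
    by (auto simp: block_len_def intro: le_trans[OF diff_le_self div_le_dividend])
  define e where "e i = (if i \<le> k then e1 else e2)" for i
  have "\<forall>i. \<exists>D. kwise_biased w (1 / 2 ^ e i) (block_len L k i) U D \<and> sampled_with_bits (2 * e i + L) D"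
    using biased bl by blast
  then obtain D where D: "\<And>i. kwise_biased w (1 / 2 ^ e i) (block_len L k i) U (D i)"
      "\<And>i. sampled_with_bits (2 * e i + L) (D i)" by metis
  have "(card U * 2 ^ L + 1) ^ kg \<le> (2 ^ ?j) ^ kg" using base[of L] by (intro power_mono) auto
  also have "\<dots> = 2 ^ (?j * kg)" by (rule power_mult[symmetric])
  also have "\<dots> < 2 ^ (?j * kg + 1)" by simp
  finally obtain G where G: "kwise_independent kg L U G" "sampled_with_bits (?j * kg + 1) G"
    using exists_kwise_independent[OF fin] by blast
  define S where "S = pair_pmf (Pi_pmf {1..k + 1} undefined D) G"
  have family: "hash_family L U w (1 / 2 ^ e1) (1 / 2 ^ e2) k kg S"
    unfolding hash_family_def
  proof (intro exI[of _ D] exI[of _ G] conjI ballI)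
    fix i assume "i \<in> {1..k}"
    then show "kwise_biased w (1 / 2 ^ e1) (block_len L k i) U (D i)" using D(1)[of i] by (simp add: e_def)
  next
    show "kwise_biased w (1 / 2 ^ e2) (block_len L k (k + 1)) U (D (k + 1))"
      using D(1)[of "k + 1"] by (simp add: e_def)
  qed (use G in \<open>simp_all add: S_def\<close>)
  have seed: "sampled_with_bits ((\<Sum>i\<in>{1..k + 1}. 2 * e i + L) + (?j * kg + 1)) S"
    unfolding S_def by (intro sampled_with_bits_pair sampled_with_bits_Pi G D) auto
  have sum_eq: "(\<Sum>i\<in>{1..k + 1}. 2 * e i + L) = k * (2 * e1 + L) + (2 * e2 + L)"
  proof -
    have "(\<Sum>i\<in>{1..k + 1}. 2 * e i + L) = (\<Sum>i\<in>{1..k}. 2 * e i + L) + (2 * e (k + 1) + L)"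
      by simp
    also have "(\<Sum>i\<in>{1..k}. 2 * e i + L) = (\<Sum>i\<in>{1..k}. 2 * e1 + L)"
      by (intro sum.cong) (auto simp: e_def)
    finally show ?thesis by (simp add: e_def)
  qed
  show ?thesis using family seed[unfolded sum_eq] by blast
qed

text \<open>\<open>K\<close> is chosen before \<open>c\<close>, \<open>M\<close> and
  \<open>a\<close>, so the implied constant depends on \<open>d\<close> alone. The seed bound asks
  for one instance of the family, whereas the load bound holds for every instance with these
  parameters.\<close>

theorem theorem5p1:
  fixes d :: nat
  assumes "d \<ge> 2"
  shows "\<exists>K>0::real. \<forall>(c::real) (M::real) (a::nat). c \<ge> 2 \<longrightarrow>
    (\<exists>(B::real) (C::real) (N0::nat). \<forall>(n::nat) (L::nat) (m::nat) (U::'a set).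
       n = 2 ^ L \<and> n \<ge> N0 \<and> finite U \<and> card U \<le> n ^ a \<and> n \<le> m \<and> real m \<le> M * real n \<longrightarrow>
       (\<exists>(\<delta>1::real) (\<delta>2::real) (k::nat) (kg::nat) (w::nat).
          \<delta>1 > 0 \<and> \<delta>2 > 0 \<and> real w \<le> B * (log 2 (real n))\<^sup>2 \<and>
          (\<exists>S s. hash_family L U w \<delta>1 \<delta>2 k kg S \<and> sampled_with_bits s S \<and>
             real s \<le> C * log 2 (real n) * log 2 (log 2 (real n))) \<and>
          (\<forall>S. hash_family L U w \<delta>1 \<delta>2 k kg S \<longrightarrow>
             (\<forall>xs. distinct xs \<and> set xs \<subseteq> U \<and> length xs = m \<longrightarrow>
                measure_pmf.prob (Pi_pmf {..<d} undefined (\<lambda>_. map_pmf (hash_fun k) S))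
                  {h. \<forall>load. uniform_greedy d h xs load \<longrightarrow>
                       real (max_load L load)
                         \<le> log (real d) (log 2 (real n)) + K * (c + real m / real n)}
                \<ge> 1 - real n powr (- c)))))"
  (is "\<exists>K>0. \<forall>c M a. ?R c \<longrightarrow> (\<exists>B C N0. \<forall>n L m U. ?Q M a N0 n L m U \<longrightarrow> ?P K c B C n L m U)")
\<comment> \<open>\<open>36 * d\<close> is the coefficient of \<open>m / n\<close> in
  \<open>s\<close>. The remaining terms of \<open>s\<close>, \<open>t\<close> and
  \<open>2 * r + 2\<close> add up to at most \<open>3 * c + 12\<close>, which is at most
  \<open>9 * c\<close> because \<open>c \<ge> 2\<close>.\<close>
proof (rule exI[of _ "36 * real d + 9"], intro conjI allI impI)
  show "0 < 36 * real d + 9" by simp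
  fix c M :: real and a :: nat
  assume c2: "c \<ge> 2"
  define c' where "c' = nat \<lceil>c\<rceil>"
  have c': "c \<le> real c'" "real c' \<le> c + 1" using c2 unfolding c'_def by linarith+
  define C0 where "C0 = c' + 4"
  define r where "r = c' + 1"
  define M' where "M' = max M 1"
  \<comment> \<open>The leaf size depends on \<open>m / n\<close>, but \<open>B\<close>,
    \<open>C\<close> and \<open>N0\<close> must not; they are computed from this bound for all
    \<open>m / n \<le> M'\<close>.\<close>
  define smax where "smax = nat \<lceil>12 * (3 * real d * M')\<rceil> + c' + 3"
  define W1 where "W1 = (smax + 2) * d + (4 * C0 + 2)"
  define u where "u = nat \<lceil>M'\<rceil>"
  define Q where "Q = 6 * (r + 2)"
  \<comment> \<open>\<open>A1\<close>, \<open>A2\<close> and \<open>A3\<close> are the coefficients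
    in three largeness conditions: the error for crowded sets (order \<open>log^2 L\<close> against
    \<open>L\<close>), the factors in the level errors, and the number of characters (both order
    \<open>L^2\<close> against \<open>2 ^ L\<close>).\<close>
  define A1 where "A1 = (1 + u + d * d + d) * Q\<^sup>2"
  define A2 where "A2 = d * (4 * C0 + 3)"
  define A3 where "A3 = 2 * ((a + 2) * W1 + 1)"
  define A where "A = real (50 + (4 * C0 + 2) + d + A1 + A2 + A3)"
  have A_ge: "real A1 \<le> A" "real A2 \<le> A" "real A3 \<le> A" "48 \<le> A" by (simp_all add: A_def)
  obtain N where N: "\<And>L. L \<ge> N \<Longrightarrow> A \<le> real L \<and> A * (log 2 (real L))\<^sup>2 \<le> real L \<and> A * (real L)\<^sup>2 < 2 ^ L"
    using eventually_large[of A] by blast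
  define Cs where "Cs = real (34 * C0 + 17 + 96 * W1 + 2 + (a + 2) * Q)"
  show "\<exists>(B::real) (C::real) (N0::nat). \<forall>(n::nat) (L::nat) (m::nat) (U::'a set).
      ?Q M a N0 n L m U \<longrightarrow> ?P (36 * real d + 9) c B C n L m U"
  proof (rule exI[of _ "real W1"], rule exI[of _ Cs], rule exI[of _ "2 ^ N"], intro allI impI, elim conjE)
    fix n L m :: nat and U :: "'a set"
    assume n: "n = 2 ^ L" "n \<ge> 2 ^ N" and finU: "finite U" and cU: "card U \<le> n ^ a"
      and m: "n \<le> m" "real m \<le> M * real n"
    define lg where "lg = log 2 (real L)"
    define \<rho> where "\<rho> = real m / real n"
    define s where "s = nat \<lceil>12 * (3 * real d * \<rho>)\<rceil> + c' + 3"
    define t where "t = nat \<lceil>log (real d) (real L)\<rceil>"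
    define g where "g = nat \<lceil>lg\<rceil>"
    define kg where "kg = (r + 2) * (2 * t + 2)"
    define w where "w = W1 * L"
    have "N \<le> L" using n by simp
    then have AL: "A \<le> real L" "A * lg\<^sup>2 \<le> real L" "A * (real L)\<^sup>2 < 2 ^ L"
      using N by (auto simp: lg_def)
    have Lbig: "50 + (4 * C0 + 2) + d \<le> L"
      using AL(1) unfolding A_def of_nat_le_iff by linarith
    have logn: "log 2 (real n) = real L" by (simp add: n log_nat_power)
    have n0: "real n > 0" by (simp add: n)
    have \<rho>1: "\<rho> \<ge> 1" using m(1) n0 by (simp add: \<rho>_def)
    have "\<rho> \<le> M" using m(2) n0 by (simp add: \<rho>_def pos_divide_le_eq)
    then have \<rho>M: "\<rho> \<le> M'" by (simp add: M'_def)
    have lg1: "lg \<ge> 1" unfolding lg_def using Lbig by (subst le_log_iff) auto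
    have lg2: "lg \<le> lg\<^sup>2" using lg1 by (simp add: power2_eq_square)
    have absorb: "x * lg\<^sup>2 \<le> real L" if "x \<le> A" for x
      using mult_right_mono[OF that, of "lg\<^sup>2"] AL(2) by simp
    have absorb2: "x * (real L)\<^sup>2 < 2 ^ L" if "x \<le> A" for x
      using mult_right_mono[OF that, of "(real L)\<^sup>2"] AL(3) by simp
    have g: "lg \<le> real g" "real g \<le> lg + 1" using lg1 unfolding g_def by linarith+
    have Lg: "L \<le> 2 ^ g"
    proof -
      have "real L = 2 powr lg" using Lbig by (simp add: lg_def)
      also have "\<dots> \<le> 2 powr real g" using g by (intro powr_mono) auto
      also have "\<dots> = real (2 ^ g)" by (simp add: powr_realpow)
      finally show ?thesis by (simp only: of_nat_le_iff)
    qed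
    have g1: "g \<ge> 1" using g lg1 by linarith
    have "real (24 * g) \<le> 48 * lg\<^sup>2" using g lg1 lg2 by simp
    also have "\<dots> \<le> real L" by (rule absorb[OF A_ge(4)])
    finally have g24: "24 * g \<le> L" by (simp only: of_nat_le_iff)
    \<comment> \<open>The last block is long enough for the moment bound at every level, and short
      enough that its bias, with exponent \<open>L div 2 ^ k\<close> times \<open>w\<close>, still
      fits the seed budget.\<close>
    obtain k where k: "12 * g \<le> L div 2 ^ k" "L div 2 ^ k < 2 * (12 * g)" "2 ^ k \<le> L"
      using exists_cutoff[of "12 * g" L] g1 g24 by auto
    have k1: "1 \<le> k" using k(2) g24 by (cases k) auto
    have kL: "k \<le> L" using k(3) less_exp[of k] by linarith
    have klg: "real k \<le> lg"
      unfolding lg_def using k(3) Lbig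
      by (subst le_log_iff) (auto simp: powr_realpow simp flip: of_nat_le_iff)
    have logd: "0 \<le> log (real d) (real L)" "log (real d) (real L) \<le> lg"
    proof -
      show "0 \<le> log (real d) (real L)" using assms Lbig by (intro zero_le_log_cancel_iff[THEN iffD2]) auto
      have "ln (real L) / ln (real d) \<le> ln (real L) / ln 2"
        using assms Lbig by (intro divide_left_mono) auto
      then show "log (real d) (real L) \<le> lg" by (simp add: lg_def log_def)
    qed
    have t: "log (real d) (real L) \<le> real t" "real t \<le> log (real d) (real L) + 1"
      using logd unfolding t_def by linarith+
    have Lt: "L \<le> d ^ t"
    proof -
      have "real L = real d powr log (real d) (real L)" using assms Lbig by simp
      also have "\<dots> \<le> real d powr real t" using assms t by (intro powr_mono) auto
      also have "\<dots> = real (d ^ t)" using assms by (simp add: powr_realpow)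
      finally show ?thesis by (simp only: of_nat_le_iff)
    qed
    have tL: "d ^ t \<le> d * L"
    proof -
      have "real (d ^ t) = real d powr real t" using assms by (simp add: powr_realpow)
      also have "\<dots> \<le> real d powr (log (real d) (real L) + 1)" using assms t by (intro powr_mono) auto
      also have "\<dots> = real (d * L)" using assms Lbig by (simp add: powr_add)
      finally show ?thesis by (simp only: of_nat_le_iff)
    qed
    have kgQ: "real kg \<le> real Q * lg"
    proof -
      have "real (2 * t + 2) \<le> 6 * lg" using t logd lg1 by simp
      then have "real (r + 2) * real (2 * t + 2) \<le> real (r + 2) * (6 * lg)" by (intro mult_left_mono) auto
      moreover have "real kg = real (r + 2) * real (2 * t + 2)" by (simp only: kg_def of_nat_mult)
      moreover have "real Q * lg = real (r + 2) * (6 * lg)" by (simp add: Q_def)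
      ultimately show ?thesis by (simp only:)
    qed
    have kg1: "1 \<le> kg" by (simp add: kg_def)
    have s: "12 * (3 * real d * \<rho>) + real c' + 3 \<le> real s" "real s \<le> 12 * (3 * real d * \<rho>) + real c' + 4"
    proof -
      have "0 \<le> 12 * (3 * real d * \<rho>)" using \<rho>1 by simp
      then show "12 * (3 * real d * \<rho>) + real c' + 3 \<le> real s" "real s \<le> 12 * (3 * real d * \<rho>) + real c' + 4"
        unfolding s_def by linarith+
    qed
    have "12 * (3 * real d * \<rho>) \<le> 12 * (3 * real d * M')"
      using \<rho>M by (intro mult_left_mono) auto
    then have smax: "s \<le> smax" unfolding s_def smax_def by (intro add_mono nat_mono ceiling_mono) auto
    have size: "witness_size d s t \<le> w"
    proof -
      have "witness_size d s t \<le> (s + 2) * d ^ t" using witness_size_bound[OF assms, of s t] by linarith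
      also have "\<dots> \<le> (smax + 2) * (d * L)" using smax tL by (intro mult_mono) auto
      also have "\<dots> \<le> w" by (simp add: w_def W1_def algebra_simps)
      finally show ?thesis .
    qed
    have w42: "(4 * C0 + 2) * L \<le> w" by (simp add: w_def W1_def algebra_simps)
    have H1: "(real kg + 1) * (\<rho> * real (d * kg) ^ d) ^ kg \<le> 2 ^ L"
    proof -
      have p2: "real x \<le> 2 ^ x" "real x + 1 \<le> 2 ^ x" for x :: nat
      proof -
        have "x + 1 \<le> 2 ^ x" unfolding Suc_eq_plus1[symmetric] Suc_le_eq by (rule less_exp)
        then have "real (x + 1) \<le> real (2 ^ x)" by (simp only: of_nat_le_iff)
        then show "real x \<le> 2 ^ x" "real x + 1 \<le> 2 ^ x" by simp_all
      qed
      have "\<rho> \<le> real u" using \<rho>M by (simp add: u_def) linarith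
      also have "\<dots> \<le> 2 ^ u" by (rule p2)
      finally have \<rho>u: "\<rho> \<le> 2 ^ u" .
      have "real (d * kg) \<le> 2 ^ d * 2 ^ kg" unfolding of_nat_mult by (intro mult_mono p2) auto
      then have "(real kg + 1) * (\<rho> * real (d * kg) ^ d) ^ kg \<le> 2 ^ kg * (2 ^ u * (2 ^ d * 2 ^ kg) ^ d) ^ kg"
        using \<rho>u \<rho>1 by (intro mult_mono power_mono p2) auto
      also have "\<dots> = 2 ^ (kg + (u + (d + kg) * d) * kg)"
        by (simp only: power_add power_mult)
      also have "\<dots> \<le> 2 ^ L"
      proof (rule power_increasing)
        have "kg + (u + (d + kg) * d) * kg \<le> (1 + u + d * d + d) * kg\<^sup>2"
        proof -
          have "kg \<le> kg * kg" using kg1 by simp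
          then have "(1 + u + d * d) * kg + d * kg * kg \<le> (1 + u + d * d) * (kg * kg) + d * kg * kg"
            by (intro add_right_mono mult_left_mono) auto
          then show ?thesis by (simp add: algebra_simps power2_eq_square)
        qed
        then have "real (kg + (u + (d + kg) * d) * kg) \<le> real ((1 + u + d * d + d) * kg\<^sup>2)" by (simp only: of_nat_le_iff)
        also have "\<dots> = real (1 + u + d * d + d) * (real kg)\<^sup>2" by (simp only: of_nat_mult of_nat_power)
        also have "\<dots> \<le> real (1 + u + d * d + d) * (real Q * lg)\<^sup>2"
          using kgQ by (intro mult_left_mono power_mono) auto
        also have "\<dots> = real ((1 + u + d * d + d) * Q\<^sup>2) * lg\<^sup>2"
          by (simp only: of_nat_mult of_nat_power power_mult_distrib mult.assoc)
        also have "\<dots> \<le> real L" by (rule absorb) (use A_ge(1) in \<open>simp only: A1_def\<close>)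
        finally show "kg + (u + (d + kg) * d) * kg \<le> L" by (simp only: of_nat_le_iff)
      qed simp
      finally show ?thesis .
    qed
    have L1: "1 \<le> real L" using Lbig by simp
    have LL: "real L \<le> (real L)\<^sup>2" using L1 by (simp add: power2_eq_square)
    have H2: "d * L * ((4 * C0 + 2) * L + 1) \<le> 2 ^ L"
    proof -
      have "d * L * ((4 * C0 + 2) * L + 1) \<le> d * L * ((4 * C0 + 3) * L)"
        using Lbig by (intro mult_left_mono) (auto simp: algebra_simps)
      then have "real (d * L * ((4 * C0 + 2) * L + 1)) \<le> real (d * L * ((4 * C0 + 3) * L))" by (simp only: of_nat_le_iff)
      also have "\<dots> = real (d * (4 * C0 + 3)) * (real L)\<^sup>2" by (simp add: power2_eq_square)
      also have "\<dots> < 2 ^ L" by (rule absorb2) (use A_ge(2) in \<open>simp only: A2_def\<close>)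
      finally have "real (d * L * ((4 * C0 + 2) * L + 1)) < real (2 ^ L)" by simp
      then show ?thesis by (simp only: of_nat_less_iff)
    qed
    have aL: "(a + 1) * L + 1 \<le> (a + 2) * L" and LL1: "1 \<le> L * L"
      using Lbig by (auto simp: algebra_simps Suc_le_eq)
    have H5: "2 * (((a + 1) * L + 1) * w + 1) < (2::nat) ^ L"
    proof -
      have "2 * (((a + 1) * L + 1) * w + 1) \<le> 2 * ((a + 2) * L * w + L * L)"
        by (intro mult_left_mono add_mono mult_right_mono aL LL1) auto
      then have "real (2 * (((a + 1) * L + 1) * w + 1)) \<le> real (2 * ((a + 2) * L * w + L * L))" by (simp only: of_nat_le_iff)
      also have "\<dots> = real (2 * ((a + 2) * W1 + 1)) * (real L)\<^sup>2"
        by (simp add: w_def power2_eq_square algebra_simps)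
      also have "\<dots> < 2 ^ L" by (rule absorb2) (use A_ge(3) in \<open>simp only: A3_def\<close>)
      finally have "real (2 * (((a + 1) * L + 1) * w + 1)) < real (2 ^ L)" by simp
      then show ?thesis by (simp only: of_nat_less_iff)
    qed
    let ?e1 = "(17 * C0 + 8) * L" and ?e2 = "(L div 2 ^ k) * w"
    let ?s = "k * (2 * ?e1 + L) + (2 * ?e2 + L) + (((a + 1) * L + 1) * kg + 1)"
    have "card U \<le> 2 ^ (a * L)" using cU by (simp add: n mult.commute flip: power_mult)
    then obtain S where S: "hash_family L U w (1 / 2 ^ ?e1) (1 / 2 ^ ?e2) k kg S" "sampled_with_bits ?s S"
      using exists_hash_family[OF finU _ H5] by blast
    have seed: "real ?s \<le> Cs * real L * lg"
    proof -
      have Llg: "real L \<le> real L * lg" using lg1 L1 by simp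
      have 1: "real (k * (2 * ?e1 + L)) \<le> real (34 * C0 + 17) * (real L * lg)"
      proof -
        have "real (k * (2 * ?e1 + L)) = real (34 * C0 + 17) * real L * real k" by (simp add: algebra_simps)
        also have "\<dots> \<le> real (34 * C0 + 17) * real L * lg" using klg by (intro mult_left_mono) auto
        finally show ?thesis by simp
      qed
      have 2: "real (2 * ?e2 + L) \<le> real (96 * W1 + 1) * (real L * lg)"
      proof -
        have "real (L div 2 ^ k) \<le> 24 * real g" using k(2) by linarith
        also have "\<dots> \<le> 48 * lg" using g lg1 by simp
        finally have "real (L div 2 ^ k) * (2 * real W1 * real L) \<le> 48 * lg * (2 * real W1 * real L)"
          by (intro mult_right_mono) auto
        then show ?thesis using Llg by (simp add: w_def algebra_simps)
      qed
      have 3: "real (((a + 1) * L + 1) * kg + 1) \<le> real ((a + 2) * Q + 1) * (real L * lg)"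
      proof -
        have "((a + 1) * L + 1) * kg \<le> (a + 2) * L * kg" by (intro mult_right_mono aL) auto
        then have "real (((a + 1) * L + 1) * kg) \<le> real ((a + 2) * L * kg)" by (simp only: of_nat_le_iff)
        also have "\<dots> = real (a + 2) * real L * real kg" by (simp only: of_nat_mult)
        also have "\<dots> \<le> real (a + 2) * real L * (real Q * lg)" using kgQ by (intro mult_left_mono) auto
        also have "\<dots> = real ((a + 2) * Q) * (real L * lg)" by (simp only: of_nat_mult mult_ac)
        finally have "real (((a + 1) * L + 1) * kg) \<le> real ((a + 2) * Q) * (real L * lg)" .
        moreover have "1 \<le> real L * lg" using Llg L1 by linarith
        ultimately show ?thesis by (simp add: algebra_simps)
      qed
      have "real ?s = real (k * (2 * ?e1 + L)) + real (2 * ?e2 + L) + real (((a + 1) * L + 1) * kg + 1)"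
        by (simp only: of_nat_add)
      also have "\<dots> \<le> Cs * (real L * lg)"
        using 1 2 3 unfolding Cs_def by (simp add: algebra_simps)
      finally show ?thesis by simp
    qed
    \<comment> \<open>A universe that holds \<open>m \<ge> n\<close> distinct balls has at least
      \<open>kg\<close> elements, so the independence of \<open>g\<close> also covers sets of fewer
      than \<open>kg\<close> balls.\<close>
    have kgU: "kg \<le> 2 ^ L"
    proof -
      have "1 * 1 \<le> \<rho> * real (d * kg) ^ d"
        using \<rho>1 assms kg1 by (intro mult_mono one_le_power) (auto simp flip: of_nat_mult simp: Suc_le_eq)
      then have "(real kg + 1) * 1 \<le> (real kg + 1) * (\<rho> * real (d * kg) ^ d) ^ kg"
        by (intro mult_left_mono one_le_power) auto
      then have le: "(real kg + 1) * 1 \<le> 2 ^ L" using H1 by (rule order_trans)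
      have "real kg \<le> (real kg + 1) * 1" by simp
      also note le
      also have "(2::real) ^ L = real (2 ^ L)" by simp
      finally have "real kg \<le> real (2 ^ L)" .
      then show ?thesis by (simp only: of_nat_le_iff)
    qed
    have whp: "1 - real n powr (- c) \<le>
        prob (Pi_pmf {..<d} undefined (\<lambda>_. map_pmf (hash_fun k) S))
          {h. \<forall>load. uniform_greedy d h xs load \<longrightarrow>
             real (max_load L load) \<le> log (real d) (log 2 (real n)) + (36 * real d + 9) * (c + real m / real n)}"
      if S: "hash_family L U w (1 / 2 ^ ?e1) (1 / 2 ^ ?e2) k kg S"
        and xs: "distinct xs" "set xs \<subseteq> U" "length xs = m" for S xs
    proof -
      obtain D G where DG: "\<forall>i\<in>{1..k}. kwise_biased w (1 / 2 ^ ?e1) (block_len L k i) U (D i)"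
          "kwise_biased w (1 / 2 ^ ?e2) (block_len L k (k + 1)) U (D (k + 1))"
          "kwise_independent kg L U G" "S = pair_pmf (Pi_pmf {1..k + 1} undefined D) G"
        using S unfolding hash_family_def by blast
      interpret hash_components L U w "1 / 2 ^ ?e1" "1 / 2 ^ ?e2" k kg D G
        by unfold_locales (use DG finU in simp_all)
      have hash: "map_pmf (hash_fun k) S = hash" by (simp add: DG(4) hash_def)
      have "kg \<le> card U"
        using kgU m n card_mono[OF finU xs(2)] distinct_card[OF xs(1)] xs(3) by linarith
      then have tail: "prob (Pi_pmf {..<d} undefined (\<lambda>_. hash))
          {h. \<exists>load. uniform_greedy d h xs load \<and> max_load L load > s + t + 2 * r + 2} \<le> 3 / 2 ^ ((c' + 1) * L)"
        (is "prob ?M ?bad \<le> _")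
        using assms xs \<rho>1 k1 kL Lg k(1) g1 C0_def Lbig w42 size Lt s(1) r_def kg_def H1 H2 n0
        by (intro max_load_whp[where \<rho> = \<rho> and g = g and ?C0.0 = C0]) (auto simp: \<rho>_def n)
      have "3 / 2 ^ ((c' + 1) * L) \<le> 1 / (2::real) ^ (c' * L)"
      proof -
        have "(3::real) \<le> 2 ^ 2" by simp
        also have "\<dots> \<le> 2 ^ L" using Lbig by (intro power_increasing) auto
        finally show ?thesis by (simp add: power_add field_simps)
      qed
      also have "\<dots> = real n powr (- real c')"
        by (simp add: n powr_minus powr_realpow divide_inverse mult.commute flip: power_mult)
      also have "\<dots> \<le> real n powr (- c)" using c' by (intro powr_mono) (auto simp: n)
      finally have "1 - real n powr (- c) \<le> 1 - prob ?M ?bad" using tail by linarith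
      also have "\<dots> = prob ?M (UNIV - ?bad)"
        using measure_pmf.prob_compl[of ?bad ?M] by simp
      also have "\<dots> \<le> prob ?M {h. \<forall>load. uniform_greedy d h xs load \<longrightarrow>
             real (max_load L load) \<le> log (real d) (log 2 (real n)) + (36 * real d + 9) * (c + real m / real n)}"
      proof (rule measure_pmf.finite_measure_mono; safe?)
        fix h load assume good: "\<nexists>load. uniform_greedy d h xs load \<and> s + t + 2 * r + 2 < max_load L load"
          and load: "uniform_greedy d h xs load"
        have "max_load L load \<le> s + t + 2 * r + 2" using good load by (meson not_le)
        then have "real (max_load L load) \<le> real s + real t + 2 * real c' + 4" by (simp add: r_def)
        also have "\<dots> \<le> log (real d) (real L) + (36 * (real d * \<rho>) + 9 * c)"
          using s(2) t(2) c' c2 by simp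
        also have "\<dots> \<le> log (real d) (real L) + (36 * real d + 9) * (c + \<rho>)"
          using c2 \<rho>1 by (simp add: algebra_simps)
        finally show "real (max_load L load) \<le> log (real d) (log 2 (real n)) + (36 * real d + 9) * (c + real m / real n)"
          by (simp add: logn \<rho>_def)
      qed auto
      finally show ?thesis unfolding hash .
    qed
    show "?P (36 * real d + 9) c (real W1) Cs n L m U"
    proof (rule exI[of _ "1 / 2 ^ ?e1"], rule exI[of _ "1 / 2 ^ ?e2"], rule exI[of _ k], rule exI[of _ kg],
        rule exI[of _ w], intro conjI)
      show "real w \<le> real W1 * (log 2 (real n))\<^sup>2"
        unfolding logn w_def of_nat_mult by (intro mult_left_mono LL) simp
      show "\<exists>S s. hash_family L U w (1 / 2 ^ ?e1) (1 / 2 ^ ?e2) k kg S \<and> sampled_with_bits s S \<and>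
             real s \<le> Cs * log 2 (real n) * log 2 (log 2 (real n))"
        using S seed unfolding logn lg_def by blast
    qed (use whp in auto)
  qed
qed

end
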